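(* Let $\rho,\tilde\rho$ be states and $\sigma,\tilde\sigma$ separable states in $\mathcal B(\mathbb C^d\otimes\mathbb C^d)$ such that $\|\rho^\Gamma-\sigma^\Gamma\|_1\le\epsilon$ and $\|\tilde\rho^\Gamma-\tilde\sigma^\Gamma\|_1\le\epsilon$. Let $\mu:=\min\{\|\rho^\Gamma\|_1,\|\tilde\rho^\Gamma\|_1\}$ and suppose $\epsilon':=\epsilon(\mu+1)\le\frac13$. Then $$K^{\text{single copy}}_{A\leftrightarrow C\leftrightarrow B}(\rho\otimes\tilde\rho)\le4(1+\log d)\,\epsilon'+2\eta(\epsilon'),$$ where $\eta(x)=-x\log x$.
   Context: $\log$ is base 2, $\|\cdot\|_1$ is the trace norm and $\Gamma$ is the partial transpose. $\rho=\rho_{AC_A}$ is shared by Alice and Charlie and $\tilde\rho=\tilde\rho_{C_BB}$ by Charlie and Bob; Charlie holds $C=C_AC_B$; $\Gamma$ is taken on Charlie's systems. $K^{\text{single copy}}_{A\leftrightarrow C\leftrightarrow B}(\rho\otimes\tilde\rho)$ is the quantum key repeater rate when the repeater is restricted to act on single copies of $\rho\otimes\tilde\rho$ only, i.e. $\sup_\Lambda K_D(\mathrm{Tr}_C\Lambda(\rho\otimes\tilde\rho))$ over tripartite LOCC protocols $\Lambda$ among Alice, Bob and Charlie acting on one copy of $\rho_{AC_A}\otimes\tilde\rho_{C_BB}$. Distillable key: $K_D(\rho)=\inf_{\epsilon>0}\limsup_{n\to\infty}\sup_{\Lambda_n\,\mathrm{LOCC},\,\gamma_m}\{\frac mn:\|\Lambda_n(\rho^{\otimes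 n})-\gamma_m\|_1\le\epsilon\}$, where $\gamma_m$ ranges over $m$-bit private states, i.e. states (bipartite in the cut $AA':BB'$) of the form $\gamma_m=2^{-m}\sum_{i,j=0}^{2^m-1}|ii\rangle\langle jj|_{AB}\otimes U_i\,\sigma_{A'B'}\,U_j^\dagger$ with $\sigma_{A'B'}$ a state on systems of arbitrary finite dimension and $U_i$ unitaries on $A'B'$. *)

theory Defs
  imports "Jordan_Normal_Form.Schur_Decomposition" "HOL-Library.Extended_Real"
begin

text \<open>Operators on finite-dimensional Hilbert spaces are complex matrices. The basis of
  \<open>C^a \<otimes> C^b\<close> is ordered lexicographically: \<open>|i>|j>\<close> has index \<open>i * b + j\<close>.\<close>

definition mat_sum :: "nat \<Rightarrow> nat \<Rightarrow> ('i \<Rightarrow> complex mat) \<Rightarrow> 'i set \<Rightarrow> complex mat" where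
  "mat_sum nr nc f S = mat nr nc (\<lambda>ij. \<Sum>x\<in>S. f x $$ ij)"

definition mat_trace :: "complex mat \<Rightarrow> complex" where
  "mat_trace A = (\<Sum>i<dim_row A. A $$ (i, i))"

text \<open>In the order on \<open>complex\<close>, \<open>0 \<le> z\<close> says that \<open>z\<close> is real and nonnegative.\<close>

definition psd :: "complex mat \<Rightarrow> bool" where
  "psd A \<longleftrightarrow> square_mat A \<and> mat_adjoint A = A \<and>
     (\<forall>v\<in>carrier_vec (dim_row A). 0 \<le> (A *\<^sub>v v) \<bullet>c v)"

definition psd_sqrt :: "complex mat \<Rightarrow> complex mat" where
  "psd_sqrt A = (THE P. psd P \<and> P * P = A)"

definition trace_norm :: "complex mat \<Rightarrow> real" where
  "trace_norm A = Re (mat_trace (psd_sqrt (mat_adjoint A * A)))"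

definition unitary_op :: "nat \<Rightarrow> complex mat \<Rightarrow> bool" where
  "unitary_op n U \<longleftrightarrow> U \<in> carrier_mat n n \<and> U * mat_adjoint U = 1\<^sub>m n \<and> mat_adjoint U * U = 1\<^sub>m n"

definition state :: "nat \<Rightarrow> complex mat \<Rightarrow> bool" where
  "state n A \<longleftrightarrow> A \<in> carrier_mat n n \<and> psd A \<and> mat_trace A = 1"

definition kron :: "complex mat \<Rightarrow> complex mat \<Rightarrow> complex mat" where
  "kron A B = mat (dim_row A * dim_row B) (dim_col A * dim_col B)
     (\<lambda>(i, j). A $$ (i div dim_row B, j div dim_col B) * B $$ (i mod dim_row B, j mod dim_col B))"

definition separable_state :: "nat \<Rightarrow> nat \<Rightarrow> complex mat \<Rightarrow> bool" where
  "separable_state a b A \<longleftrightarrow>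
     (\<exists>(r::nat) (p :: nat \<Rightarrow> real) \<alpha> \<beta>.
        (\<forall>i<r. 0 \<le> p i \<and> state a (\<alpha> i) \<and> state b (\<beta> i)) \<and> (\<Sum>i<r. p i) = 1 \<and>
        A = mat_sum (a * b) (a * b) (\<lambda>i. complex_of_real (p i) \<cdot>\<^sub>m kron (\<alpha> i) (\<beta> i)) {..<r})"

text \<open>Partial transposes of an operator on \<open>C^a \<otimes> C^b\<close>, on the first and on the second factor.\<close>

definition ptranspose_fst :: "nat \<Rightarrow> nat \<Rightarrow> complex mat \<Rightarrow> complex mat" where
  "ptranspose_fst a b X = mat (a * b) (a * b)
     (\<lambda>(i, j). X $$ ((j div b) * b + i mod b, (i div b) * b + j mod b))"

definition ptranspose_snd :: "nat \<Rightarrow> nat \<Rightarrow> complex mat \<Rightarrow> complex mat" where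
  "ptranspose_snd a b X = mat (a * b) (a * b)
     (\<lambda>(i, j). X $$ ((i div b) * b + j mod b, (j div b) * b + i mod b))"

text \<open>Partial trace of an operator on \<open>C^a \<otimes> C^c \<otimes> C^b\<close> over the middle factor.\<close>

definition ptrace_mid :: "nat \<Rightarrow> nat \<Rightarrow> nat \<Rightarrow> complex mat \<Rightarrow> complex mat" where
  "ptrace_mid a c b X = mat (a * b) (a * b)
     (\<lambda>(i, j). \<Sum>k<c. X $$ (((i div b) * c + k) * b + i mod b, ((j div b) * c + k) * b + j mod b))"

text \<open>The tensor product of operators \<open>X\<close> on \<open>A1 \<otimes> B1\<close> and \<open>Y\<close> on \<open>A2 \<otimes> B2\<close>, regarded as an
  operator in the cut \<open>A1 A2 : B1 B2\<close>, i.e. on \<open>(A1 \<otimes> A2) \<otimes> (B1 \<otimes> B2)\<close>. The two index functions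
  send a basis index of that space to the basis indices of \<open>A1 \<otimes> B1\<close> and of \<open>A2 \<otimes> B2\<close>.\<close>

definition idx1 :: "nat \<Rightarrow> nat \<Rightarrow> nat \<Rightarrow> nat \<Rightarrow> nat" where
  "idx1 a2 b1 b2 i = (i div (b1 * b2) div a2) * b1 + i mod (b1 * b2) div b2"

definition idx2 :: "nat \<Rightarrow> nat \<Rightarrow> nat \<Rightarrow> nat \<Rightarrow> nat" where
  "idx2 a2 b1 b2 i = (i div (b1 * b2) mod a2) * b2 + i mod (b1 * b2) mod b2"

definition bkron :: "nat \<Rightarrow> nat \<Rightarrow> nat \<Rightarrow> nat \<Rightarrow> complex mat \<Rightarrow> complex mat \<Rightarrow> complex mat" where
  "bkron a1 b1 a2 b2 X Y = mat ((a1 * a2) * (b1 * b2)) ((a1 * a2) * (b1 * b2))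
     (\<lambda>(i, j). X $$ (idx1 a2 b1 b2 i, idx1 a2 b1 b2 j) * Y $$ (idx2 a2 b1 b2 i, idx2 a2 b1 b2 j))"

text \<open>The \<open>n\<close>-fold tensor power of an operator on \<open>A \<otimes> B\<close>, in the cut \<open>A^n : B^n\<close>.\<close>

fun bpower :: "nat \<Rightarrow> nat \<Rightarrow> complex mat \<Rightarrow> nat \<Rightarrow> complex mat" where
  "bpower a b X 0 = 1\<^sub>m 1"
| "bpower a b X (Suc n) = bkron a b (a ^ n) (b ^ n) X (bpower a b X n)"

text \<open>The operator \<open>K\<close> applied by party \<open>p\<close> when the parties' systems have dimensions \<open>ds\<close>.\<close>

definition local_op :: "nat list \<Rightarrow> nat \<Rightarrow> complex mat \<Rightarrow> complex mat" where
  "local_op ds p K =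
     kron (1\<^sub>m (prod_list (take p ds))) (kron K (1\<^sub>m (prod_list (drop (Suc p) ds))))"

text \<open>\<open>locc ds ds' \<Lambda>\<close>: the map \<open>\<Lambda>\<close> is implemented by an LOCC protocol with finitely many rounds,
  among \<open>length ds\<close> parties with local dimensions \<open>ds\<close> initially and \<open>ds'\<close> finally. In a round one
  party \<open>p\<close> applies an instrument with Kraus operators \<open>K 0, \<dots>, K (r - 1)\<close> and broadcasts the
  outcome \<open>i\<close>; the rest of the protocol may depend on \<open>i\<close>. Instruments whose outcomes have
  several Kraus operators (in particular local channels, such as discarding a subsystem) are
  covered, as the continuation may ignore part of \<open>i\<close>. The Kraus operators need not be square, so
  local ancillas are covered.\<close>

inductive locc :: "nat list \<Rightarrow> nat list \<Rightarrow> (complex mat \<Rightarrow> complex mat) \<Rightarrow> bool" where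
  stop: "locc ds ds (\<lambda>X. X)"
| round: "locc ds ds' (\<lambda>X. mat_sum (prod_list ds') (prod_list ds')
            (\<lambda>i. \<Lambda> i (local_op ds p (K i) * X * mat_adjoint (local_op ds p (K i)))) {..<(r::nat)})"
  if "p < length ds"
    and "\<And>i. i < r \<Longrightarrow> dim_col (K i) = ds ! p"
    and "mat_sum (ds ! p) (ds ! p) (\<lambda>i. mat_adjoint (K i) * K i) {..<r} = 1\<^sub>m (ds ! p)"
    and "\<And>i. i < r \<Longrightarrow> locc (ds[p := dim_row (K i)]) ds' (\<Lambda> i)"

text \<open>The operator \<open>|ii><jj|\<close> on \<open>C^D \<otimes> C^D\<close>.\<close>

definition ketbra_diag :: "nat \<Rightarrow> nat \<Rightarrow> nat \<Rightarrow> complex mat" where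
  "ketbra_diag D i j = mat (D * D) (D * D) (\<lambda>(k, l). if k = i * D + i \<and> l = j * D + j then 1 else 0)"

text \<open>An \<open>m\<close>-bit private state on \<open>(A \<otimes> A') \<otimes> (B \<otimes> B')\<close>, where the key systems \<open>A\<close>, \<open>B\<close> have
  dimension \<open>2^m\<close> and the shield systems \<open>A'\<close>, \<open>B'\<close> have dimensions \<open>a'\<close>, \<open>b'\<close>.\<close>

definition private_state :: "nat \<Rightarrow> nat \<Rightarrow> nat \<Rightarrow> complex mat \<Rightarrow> bool" where
  "private_state m a' b' \<gamma> \<longleftrightarrow>
     (\<exists>\<sigma> U. state (a' * b') \<sigma> \<and> (\<forall>i<2^m. unitary_op (a' * b') (U i)) \<and>
        \<gamma> = complex_of_real (1 / 2 ^ m) \<cdot>\<^sub>m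
              mat_sum ((2^m * a') * (2^m * b')) ((2^m * a') * (2^m * b'))
                (\<lambda>(i, j). bkron (2^m) (2^m) a' b' (ketbra_diag (2^m) i j)
                            (U i * \<sigma> * mat_adjoint (U j)))
                ({..<2^m} \<times> {..<2^m}))"

text \<open>Rates are extended reals, so that no supremum below presupposes boundedness.\<close>

definition distillable_key :: "nat \<Rightarrow> nat \<Rightarrow> complex mat \<Rightarrow> ereal" where
  "distillable_key a b \<rho> =
     (INF \<epsilon>\<in>{0::real<..}. limsup (\<lambda>n. Sup {ereal (real m / real n) | m a' b' \<gamma> \<Lambda>.
        locc [a ^ n, b ^ n] [2^m * a', 2^m * b'] \<Lambda> \<and> private_state m a' b' \<gamma> \<and>
        trace_norm (\<Lambda> (bpower a b \<rho> n) - \<gamma>) \<le> \<epsilon>}))"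

text \<open>\<open>\<rho>\<close> acts on \<open>A \<otimes> CA\<close> and \<open>\<tau>\<close> on \<open>CB \<otimes> B\<close>, all of dimension \<open>d\<close>; the three parties, in the
  order of the tensor factors of \<open>\<rho> \<otimes> \<tau>\<close>, are Alice (\<open>A\<close>), Charlie (\<open>CA \<otimes> CB\<close>) and Bob (\<open>B\<close>).\<close>

definition single_copy_repeater_rate :: "nat \<Rightarrow> complex mat \<Rightarrow> complex mat \<Rightarrow> ereal" where
  "single_copy_repeater_rate d \<rho> \<tau> =
     Sup {distillable_key a b (ptrace_mid a c b (\<Lambda> (kron \<rho> \<tau>))) | a c b \<Lambda>.
       locc [d, d * d, d] [a, c, b] \<Lambda>}"

definition \<eta> :: "real \<Rightarrow> real" where
  "\<eta> x = - x * log 2 x"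

end

theory Submission
  imports Defs "HOL-Analysis.L2_Norm"
begin

text \<open>Partially transposing Charlie's systems turns an LOCC protocol into an LOCC protocol, and it does
  not affect the state left after Charlie is traced out. Hence that state is at most \<open>S + D\<close>, where
  \<open>S\<close> is the output for the separable inputs and \<open>D\<close> is the output for a positive operator \<open>Y\<close> of
  trace \<open>\<delta> \<le> \<epsilon>'\<close> that dominates the difference of the partially transposed inputs. Pinching \<open>Y\<close> on
  Alice's system costs a factor \<open>d\<close> and makes it separable, so \<open>D \<le> d E\<close> with \<open>E\<close> separable of trace
  \<open>\<delta>\<close>, whatever the output dimensions are.

  The test for an \<open>m\<close>-bit private state accepts separable states with probability at most \<open>2 ^ (-m)\<close>.
  Expanding \<open>(S + D)\<close> to the \<open>n\<close>-th tensor power, a term with \<open>j\<close> factors \<open>D\<close> has trace \<open>\<delta> ^ j\<close> and is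
  accepted with weight at most \<open>\<delta> ^ j * min 1 (2 ^ (-m) * d ^ j)\<close>, which is at most
  \<open>\<delta> ^ j * (2 ^ (-m) * d ^ j) powr s\<close> for \<open>0 \<le> s \<le> 1\<close>. The sum of these weights is
  \<open>2 ^ (-m s) * (1 + \<delta> * d powr s) ^ n\<close>, and it stays bounded away from \<open>0\<close> only if the rate \<open>m / n\<close> is
  asymptotically at most \<open>log (1 + \<delta> * d powr s) / s\<close>. For \<open>s = 1 / (1 + log d)\<close> we have
  \<open>d powr s \<le> 2\<close>, and the rate is at most \<open>4 (1 + log d) \<delta>\<close>; moreover \<open>\<eta> \<epsilon>' \<ge> 0\<close>.\<close>

section \<open>Matrices with explicit dimensions\<close>

text \<open>The dimensions of the repeater's output are unbounded, so a continuity estimate made at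
  the output would carry the wrong logarithm. Whatever costs a dimension is therefore done at the
  input, where Alice holds C^d, and is then transported through the protocol.

  Moving the transposition works because (C Q C^dagger)^T = conj(C) Q^T conj(C)^dagger: only
  Charlie's Kraus operators change, to their entrywise conjugates. The transposed input need not be
  positive, but the state left for Alice and Bob is.

  The single domination S + D \<le> S + d E would only give the rate log (1 + d \<delta>), which for
  fixed \<delta> grows like log d without the factor \<delta>. Each factor D obeys two bounds, its
  own trace \<delta> and the trace d \<delta> of a separable majorant; interpolating between them
  with exponent s replaces d by d powr s, at the price of the factor 1 / s in the rate.\<close>

lemma dim_mat_adjoint [simp]: "dim_row (mat_adjoint A) = dim_col A" "dim_col (mat_adjoint A) = dim_row A"
  by (auto simp: mat_adjoint_def)

lemma index_mat_adjoint [simp]: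
  fixes A :: "complex mat"
  shows "i < dim_col A \<Longrightarrow> j < dim_row A \<Longrightarrow> mat_adjoint A $$ (i, j) = cnj (A $$ (j, i))"
  by (auto simp: mat_adjoint_def mat_of_rows_def)

lemma mult_assoc_mat:
  fixes A B C :: "complex mat"
  shows "dim_col A = dim_row B \<Longrightarrow> dim_col B = dim_row C \<Longrightarrow> A * B * C = A * (B * C)"
  by (rule assoc_mult_mat[of _ "dim_row A" "dim_row B" _ "dim_row C" _ "dim_col C"]) auto

lemma index_mult_mat_sum:
  fixes A B :: "complex mat"
  assumes "dim_col A = dim_row B" "i < dim_row A" "j < dim_col B"
  shows "(A * B) $$ (i, j) = (\<Sum>k<dim_row B. A $$ (i, k) * B $$ (k, j))"
  using assms by (simp add: scalar_prod_def atLeast0LessThan)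

lemma add_mult_mat:
  fixes A B C :: "complex mat"
  assumes "dim_row A = dim_row B" "dim_col A = dim_col B" "dim_col B = dim_row C"
  shows "(A + B) * C = A * C + B * C"
  using assms by (intro add_mult_distrib_mat[of _ "dim_row A" "dim_row C" _ _ "dim_col C"]) auto

lemma mult_add_mat:
  fixes A B C :: "complex mat"
  assumes "dim_row C = dim_row B" "dim_col C = dim_col B" "dim_col A = dim_row B"
  shows "A * (B + C) = A * B + A * C"
  using assms by (intro mult_add_distrib_mat[of _ "dim_row A" "dim_row C" _ "dim_col C"]) auto

lemma minus_mult_mat:
  fixes A B C :: "complex mat"
  assumes "dim_row A = dim_row B" "dim_col A = dim_col B" "dim_col B = dim_row C"
  shows "(A - B) * C = A * C - B * C"
  using assms by (intro minus_mult_distrib_mat[of _ "dim_row A" "dim_row C" _ _ "dim_col C"]) auto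

lemma mult_minus_mat:
  fixes A B C :: "complex mat"
  assumes "dim_row C = dim_row B" "dim_col C = dim_col B" "dim_col A = dim_row B"
  shows "A * (B - C) = A * B - A * C"
  using assms by (intro mult_minus_distrib_mat[of _ "dim_row A" "dim_row C" _ "dim_col C"]) auto

lemma smult_mult_mat:
  fixes A B :: "complex mat"
  assumes "dim_col A = dim_row B"
  shows "(c \<cdot>\<^sub>m A) * B = c \<cdot>\<^sub>m (A * B)" "A * (c \<cdot>\<^sub>m B) = c \<cdot>\<^sub>m (A * B)"
  using assms by auto

lemma smult_smult_mat: "a \<cdot>\<^sub>m (b \<cdot>\<^sub>m (A::complex mat)) = (a * b) \<cdot>\<^sub>m A"
  by (rule eq_matI) auto

lemma adjoint_adjoint [simp]: "mat_adjoint (mat_adjoint (A::complex mat)) = A"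
  by (rule eq_matI) auto

lemma adjoint_mult:
  fixes A B :: "complex mat"
  assumes "dim_col A = dim_row B"
  shows "mat_adjoint (A * B) = mat_adjoint B * mat_adjoint A"
  using assms by (intro eq_matI) (auto simp: index_mult_mat_sum mult.commute simp del: index_mult_mat(1))

lemma adjoint_add:
  fixes A B :: "complex mat"
  assumes "dim_row A = dim_row B" "dim_col A = dim_col B"
  shows "mat_adjoint (A + B) = mat_adjoint A + mat_adjoint B"
    and "mat_adjoint (A - B) = mat_adjoint A - mat_adjoint B"
  using assms by (auto intro!: eq_matI)

lemma adjoint_smult: "mat_adjoint (c \<cdot>\<^sub>m (A::complex mat)) = cnj c \<cdot>\<^sub>m mat_adjoint A"
  by (rule eq_matI) auto

lemma adjoint_one [simp]: "mat_adjoint (1\<^sub>m n :: complex mat) = 1\<^sub>m n"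
  by (rule eq_matI) auto

lemma adjoint_zero [simp]: "mat_adjoint (0\<^sub>m n m :: complex mat) = 0\<^sub>m m n"
  by (rule eq_matI) auto

lemma mult_one_mat [simp]:
  fixes A :: "complex mat"
  shows "dim_col A = n \<Longrightarrow> A * 1\<^sub>m n = A" "dim_row A = n \<Longrightarrow> 1\<^sub>m n * A = A"
  by (auto intro!: right_mult_one_mat' left_mult_one_mat')

lemma mult_zero_mat [simp]:
  fixes A :: "complex mat"
  shows "dim_col A = n \<Longrightarrow> A * 0\<^sub>m n m = 0\<^sub>m (dim_row A) m" "dim_row A = n \<Longrightarrow> 0\<^sub>m m n * A = 0\<^sub>m m (dim_col A)"
  by (auto intro!: right_mult_zero_mat' left_mult_zero_mat')

lemma trace_add:
  "dim_row A = dim_row B \<Longrightarrow> dim_col A = dim_row A \<Longrightarrow> dim_col B = dim_row B \<Longrightarrow>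
    mat_trace (A + B) = mat_trace A + mat_trace B"
  "dim_row A = dim_row B \<Longrightarrow> dim_col A = dim_row A \<Longrightarrow> dim_col B = dim_row B \<Longrightarrow>
    mat_trace (A - B) = mat_trace A - mat_trace B"
  by (auto simp: mat_trace_def sum.distrib sum_subtractf)

lemma trace_smult: "dim_col A = dim_row A \<Longrightarrow> mat_trace (c \<cdot>\<^sub>m A) = c * mat_trace A"
  by (auto simp: mat_trace_def sum_distrib_left)

lemma trace_zero [simp]: "mat_trace (0\<^sub>m n n) = 0"
  by (auto simp: mat_trace_def)

lemma trace_one [simp]: "mat_trace (1\<^sub>m n) = of_nat n"
  by (auto simp: mat_trace_def)

lemma trace_mult_commute:
  assumes "dim_col A = dim_row B" "dim_row A = dim_col B"
  shows "mat_trace (A * B) = mat_trace (B * A)"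
proof -
  have "mat_trace (A * B) = (\<Sum>i<dim_row A. \<Sum>k<dim_row B. A $$ (i, k) * B $$ (k, i))"
    unfolding mat_trace_def using assms by (auto simp: index_mult_mat_sum simp del: index_mult_mat(1))
  also have "\<dots> = (\<Sum>k<dim_row B. \<Sum>i<dim_row A. B $$ (k, i) * A $$ (i, k))"
    by (subst sum.swap) (simp add: mult.commute)
  also have "\<dots> = mat_trace (B * A)"
    unfolding mat_trace_def using assms by (auto simp: index_mult_mat_sum simp del: index_mult_mat(1))
  finally show ?thesis .
qed

lemma dim_mat_sum [simp]: "dim_row (mat_sum n m f S) = n" "dim_col (mat_sum n m f S) = m"
  by (auto simp: mat_sum_def)

lemma mat_sum_carrier [simp]: "mat_sum n m f S \<in> carrier_mat n m"
  by (auto simp: mat_sum_def)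

lemma index_mat_sum [simp]:
  "i < n \<Longrightarrow> j < m \<Longrightarrow> mat_sum n m f S $$ (i, j) = (\<Sum>x\<in>S. f x $$ (i, j))"
  by (auto simp: mat_sum_def)

lemma mat_sum_empty [simp]: "mat_sum n m f {} = 0\<^sub>m n m"
  by (auto intro!: eq_matI)

lemma mat_sum_insert:
  "finite S \<Longrightarrow> x \<notin> S \<Longrightarrow> f x \<in> carrier_mat n m \<Longrightarrow>
    mat_sum n m f (insert x S) = f x + mat_sum n m f S"
  by (auto intro!: eq_matI)

lemma mat_sum_cong:
  "(\<And>x. x \<in> S \<Longrightarrow> f x = g x) \<Longrightarrow> mat_sum n m f S = mat_sum n m g S"
  by (auto intro!: eq_matI)

lemma mat_sum_induct:
  assumes "finite S" "\<And>x. x \<in> S \<Longrightarrow> f x \<in> carrier_mat n m" "P (0\<^sub>m n m)"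
    "\<And>x B. x \<in> S \<Longrightarrow> B \<in> carrier_mat n m \<Longrightarrow> P B \<Longrightarrow> P (f x + B)"
  shows "P (mat_sum n m f S)"
proof -
  have "T \<subseteq> S \<Longrightarrow> P (mat_sum n m f T)" if "finite T" for T
    using that
  proof (induction T)
    case empty
    then show ?case using assms(3) by simp
  next
    case (insert x T)
    then show ?case using assms(2)[of x] assms(4)[of x "mat_sum n m f T"]
      by (auto simp: mat_sum_insert)
  qed
  then show ?thesis using assms(1) by blast
qed

lemma additive_mat_sum:
  assumes "finite S" "\<And>x. x \<in> S \<Longrightarrow> f x \<in> carrier_mat n m"
    "F (0\<^sub>m n m) = 0\<^sub>m n' m'"
    "\<And>A B. A \<in> carrier_mat n m \<Longrightarrow> B \<in> carrier_mat n m \<Longrightarrow> F (A + B) = F A + F B"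
    "\<And>A. A \<in> carrier_mat n m \<Longrightarrow> F A \<in> carrier_mat n' m'"
  shows "F (mat_sum n m f S) = mat_sum n' m' (\<lambda>x. F (f x)) S"
proof -
  have "T \<subseteq> S \<Longrightarrow> F (mat_sum n m f T) = mat_sum n' m' (\<lambda>x. F (f x)) T" if "finite T" for T
    using that
  proof (induction T)
    case empty
    then show ?case using assms(3) by simp
  next
    case (insert x T)
    then show ?case using assms(2)[of x] assms(4)[of "f x" "mat_sum n m f T"]  assms(5)[of "f x"]
      by (auto simp: mat_sum_insert)
  qed
  then show ?thesis using assms(1) by blast
qed

lemma trace_mat_sum: 
  assumes "finite S" "\<And>x. x \<in> S \<Longrightarrow> f x \<in> carrier_mat n n"
  shows "mat_trace (mat_sum n n f S) = (\<Sum>x\<in>S. mat_trace (f x))"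
proof -
  have "mat_trace (mat_sum n n f S) = (\<Sum>i<n. \<Sum>x\<in>S. f x $$ (i,i))"
    by (simp add: mat_trace_def)
  also have "\<dots> = (\<Sum>x\<in>S. mat_trace (f x))"
    unfolding mat_trace_def using assms(2) by (subst sum.swap) (auto intro!: sum.cong)
  finally show ?thesis .
qed

section \<open>Index arithmetic of lexicographic bases\<close>

lemma sum_less_mult:
  fixes f :: "nat \<Rightarrow> 'a::comm_monoid_add"
  shows "(\<Sum>k<a * b. f k) = (\<Sum>i<a. \<Sum>j<b. f (i * b + j))"
proof -
  have "(\<Sum>k<a * b. f k) = (\<Sum>i<a. sum f {i * b..<i * b + b})"
    by (rule sum.nat_group[symmetric])
  moreover have "sum f {i * b..<i * b + b} = (\<Sum>j<b. f (i * b + j))" for i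
    using sum.shift_bounds_nat_ivl[of f 0 "i * b" b] by (simp add: atLeast0LessThan add.commute)
  ultimately show ?thesis by simp
qed

lemma block_index: "i < a \<Longrightarrow> j < b \<Longrightarrow> i * b + j < a * (b::nat)"
proof -
  assume "i < a" "j < b"
  then have "i * b + j < Suc i * b" by simp
  also have "\<dots> \<le> a * b" using \<open>i < a\<close> by (intro mult_le_mono1) simp
  finally show ?thesis .
qed

lemma block_div: "v < n \<Longrightarrow> (u * n + v) div n = u" "v < n \<Longrightarrow> (u * n + v) mod n = (v::nat)"
  by auto

lemma div_less_fst: "i < a * b \<Longrightarrow> i div b < (a::nat)" 
  by (simp add: less_mult_imp_div_less)

lemma mod_less_snd: "i < a * b \<Longrightarrow> i mod b < (b::nat)"
  by (cases "b = 0") auto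

section \<open>Kronecker products\<close>

lemma dim_kron [simp]: "dim_row (kron A B) = dim_row A * dim_row B" "dim_col (kron A B) = dim_col A * dim_col B"
  by (auto simp: kron_def)

lemma kron_carrier [intro]:
  "A \<in> carrier_mat n m \<Longrightarrow> B \<in> carrier_mat n' m' \<Longrightarrow> kron A B \<in> carrier_mat (n * n') (m * m')"
  by (auto simp: kron_def)

lemma index_kron:
  "i < dim_row A * dim_row B \<Longrightarrow> j < dim_col A * dim_col B \<Longrightarrow>
    kron A B $$ (i, j) = A $$ (i div dim_row B, j div dim_col B) * B $$ (i mod dim_row B, j mod dim_col B)"
  by (auto simp: kron_def)

lemma kron_mult:
  assumes "dim_col A = dim_row C" "dim_col B = dim_row D"
  shows "kron A B * kron C D = kron (A * C) (B * D)"
proof (rule eq_matI)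
  fix i j assume "i < dim_row (kron (A * C) (B * D))" "j < dim_col (kron (A * C) (B * D))"
  then have i: "i < dim_row A * dim_row B" and j: "j < dim_col C * dim_col D" by auto
  note ij = div_less_fst[OF i] mod_less_snd[OF i] div_less_fst[OF j] mod_less_snd[OF j]
  have "(kron A B * kron C D) $$ (i, j)
      = (\<Sum>k<dim_row C * dim_row D. kron A B $$ (i, k) * kron C D $$ (k, j))"
    using assms i j by (simp add: index_mult_mat_sum del: index_mult_mat(1))
  also have "\<dots> = (\<Sum>p<dim_row C. \<Sum>q<dim_row D.
       (A $$ (i div dim_row B, p) * B $$ (i mod dim_row B, q)) * (C $$ (p, j div dim_col D) * D $$ (q, j mod dim_col D)))"
    unfolding sum_less_mult using assms i j by (intro sum.cong refl) (auto simp: index_kron block_index)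
  also have "\<dots> = (\<Sum>p<dim_row C. A $$ (i div dim_row B, p) * C $$ (p, j div dim_col D)) *
      (\<Sum>q<dim_row D. B $$ (i mod dim_row B, q) * D $$ (q, j mod dim_col D))"
    by (simp add: sum_product mult_ac)
  also have "\<dots> = kron (A * C) (B * D) $$ (i, j)"
    using assms i j ij by (simp add: index_kron index_mult_mat_sum del: index_mult_mat(1))
  finally show "(kron A B * kron C D) $$ (i, j) = kron (A * C) (B * D) $$ (i, j)" .
qed auto

lemma adjoint_kron: "mat_adjoint (kron A B) = kron (mat_adjoint A) (mat_adjoint B)"
  by (rule eq_matI) (auto simp: index_kron div_less_fst mod_less_snd)

lemma kron_add:
  "dim_row A = dim_row B \<Longrightarrow> dim_col A = dim_col B \<Longrightarrow> kron (A + B) C = kron A C + kron B C"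
  "dim_row A = dim_row B \<Longrightarrow> dim_col A = dim_col B \<Longrightarrow> kron C (A + B) = kron C A + kron C B"
  "dim_row A = dim_row B \<Longrightarrow> dim_col A = dim_col B \<Longrightarrow> kron (A - B) C = kron A C - kron B C"
  "dim_row A = dim_row B \<Longrightarrow> dim_col A = dim_col B \<Longrightarrow> kron C (A - B) = kron C A - kron C B"
  by (auto intro!: eq_matI simp: index_kron div_less_fst mod_less_snd
      distrib_right distrib_left left_diff_distrib right_diff_distrib)

lemma kron_smult:
  "kron (c \<cdot>\<^sub>m A) B = c \<cdot>\<^sub>m kron A B" "kron A (c \<cdot>\<^sub>m B) = c \<cdot>\<^sub>m kron A B"
  by (auto intro!: eq_matI simp: index_kron div_less_fst mod_less_snd algebra_simps)

lemma kron_zero [simp]: "kron (0\<^sub>m a b) B = 0\<^sub>m (a * dim_row B) (b * dim_col B)"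
  "kron A (0\<^sub>m a b) = 0\<^sub>m (dim_row A * a) (dim_col A * b)"
  by (auto intro!: eq_matI simp: index_kron div_less_fst mod_less_snd)

lemma div_mod_eqD: "i div b = j div b \<Longrightarrow> i mod b = j mod b \<Longrightarrow> i = (j::nat)"
  by (metis div_mult_mod_eq)

lemma kron_one: "kron (1\<^sub>m a) (1\<^sub>m b) = 1\<^sub>m (a * b)"
  by (rule eq_matI)
    (auto simp: index_kron div_less_fst mod_less_snd dest: div_mod_eqD)

lemma kron_one_left [simp]: "kron (1\<^sub>m (Suc 0)) A = A"
  by (rule eq_matI) (auto simp: index_kron)

lemma kron_one_right [simp]: "kron A (1\<^sub>m (Suc 0)) = A"
  by (rule eq_matI) (auto simp: index_kron)

lemma kron_assoc: "kron (kron A B) C = kron A (kron B C)"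
proof (rule eq_matI)
  fix i j assume "i < dim_row (kron A (kron B C))" "j < dim_col (kron A (kron B C))"
  then have i: "i < dim_row A * (dim_row B * dim_row C)" and j: "j < dim_col A * (dim_col B * dim_col C)" by auto
  have i': "i div dim_row C < dim_row A * dim_row B" and j': "j div dim_col C < dim_col A * dim_col B"
    using i j by (auto simp: mult.assoc intro!: div_less_fst)
  have i2: "i mod (dim_row B * dim_row C) < dim_row B * dim_row C"
    and j2: "j mod (dim_col B * dim_col C) < dim_col B * dim_col C"
    using mod_less_snd[OF i] mod_less_snd[OF j] by auto
  have *: "i mod (b * c) mod c = i mod c" "i mod (b * c) div c = i div c mod b"
    "i div (b * c) = i div c div b" for i b c :: nat
  proof -
    have e: "i mod (b * c) = c * (i div c mod b) + i mod c"
      by (simp only: mult.commute[of b c] mod_mult2_eq)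
    show "i mod (b * c) mod c = i mod c" unfolding e by simp
    show "i mod (b * c) div c = i div c mod b" unfolding e by (cases "c = 0") auto
    show "i div (b * c) = i div c div b" by (simp only: mult.commute[of b c] div_mult2_eq)
  qed
  have "kron (kron A B) C $$ (i, j) = A $$ (i div dim_row C div dim_row B, j div dim_col C div dim_col B) *
      B $$ (i div dim_row C mod dim_row B, j div dim_col C mod dim_col B) * C $$ (i mod dim_row C, j mod dim_col C)"
    using i j i' j' by (simp add: index_kron mult.assoc[of _ "dim_row B"] mult.assoc[of _ "dim_col B"])
  also have "\<dots> = kron A (kron B C) $$ (i, j)"
    using i j i2 j2 by (simp add: index_kron * mult.assoc)
  finally show "kron (kron A B) C $$ (i, j) = kron A (kron B C) $$ (i, j)" .
qed auto

lemma trace_kron: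
  "dim_col A = dim_row A \<Longrightarrow> dim_col B = dim_row B \<Longrightarrow>
    mat_trace (kron A B) = mat_trace A * mat_trace B"
  unfolding mat_trace_def
  by (simp add: sum_less_mult sum_product, intro sum.cong refl, subst index_kron)
     (auto simp: block_index)

section \<open>Positive semidefinite matrices\<close>

lemma inner_mult_mat_vec:
  fixes K :: "complex mat"
  assumes "dim_vec x = dim_col K" "dim_vec v = dim_row K"
  shows "(K *\<^sub>v x) \<bullet>c v = x \<bullet>c (mat_adjoint K *\<^sub>v v)"
proof -
  have "(K *\<^sub>v x) \<bullet>c v = (\<Sum>i<dim_row K. (\<Sum>j<dim_col K. K $$ (i, j) * x $ j) * cnj (v $ i))"
    using assms by (simp add: scalar_prod_def atLeast0LessThan mult_mat_vec_def)
  also have "\<dots> = (\<Sum>j<dim_col K. x $ j * (\<Sum>i<dim_row K. K $$ (i, j) * cnj (v $ i)))"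
    by (simp only: sum_distrib_left sum_distrib_right, subst sum.swap) (simp add: mult_ac)
  also have "\<dots> = x \<bullet>c (mat_adjoint K *\<^sub>v v)"
    using assms by (simp add: scalar_prod_def atLeast0LessThan mult_mat_vec_def)
  finally show ?thesis .
qed

lemma mult_mat_vec_assoc:
  fixes A B :: "complex mat"
  assumes "dim_col A = dim_row B" "dim_vec v = dim_col B"
  shows "A * B *\<^sub>v v = A *\<^sub>v (B *\<^sub>v v)"
  using assms by (intro assoc_mult_mat_vec[of _ "dim_row A" "dim_row B" _ "dim_col B"]) (auto intro: carrier_vecI)

lemma dim_mult_mat_vec' [simp]: "dim_vec (A *\<^sub>v v) = dim_row A"
  by (auto simp: mult_mat_vec_def)

lemma inner_self_nonneg: "0 \<le> (x :: complex vec) \<bullet>c x"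
proof -
  have "x \<bullet>c x = (\<Sum>i<dim_vec x. x $ i * cnj (x $ i))"
    by (simp add: scalar_prod_def atLeast0LessThan)
  also have "\<dots> = (\<Sum>i<dim_vec x. of_real ((cmod (x $ i))\<^sup>2))"
    by (simp only: complex_norm_square)
  also have "0 \<le> \<dots>" by (intro sum_nonneg) (simp add: less_eq_complex_def)
  finally show ?thesis .
qed

lemma psd_gram: "psd (mat_adjoint M * M)"
  unfolding psd_def
proof (intro conjI ballI)
  fix v :: "complex vec" assume "v \<in> carrier_vec (dim_row (mat_adjoint M * M))"
  then have "(mat_adjoint M * M *\<^sub>v v) \<bullet>c v = (M *\<^sub>v v) \<bullet>c (M *\<^sub>v v)"
    by (simp add: mult_mat_vec_assoc inner_mult_mat_vec)
  then show "0 \<le> (mat_adjoint M * M *\<^sub>v v) \<bullet>c v"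
    by (simp only: inner_self_nonneg)
qed (auto simp: adjoint_mult)

lemma psd_gram': "psd (M * mat_adjoint M)"
  using psd_gram[of "mat_adjoint M"] by simp

lemma psd_dim: "psd A \<Longrightarrow> dim_col A = dim_row A"
  by (auto simp: psd_def)

lemma psd_adjoint: "psd A \<Longrightarrow> mat_adjoint A = A"
  by (auto simp: psd_def)

lemma psd_inner: "psd A \<Longrightarrow> v \<in> carrier_vec (dim_row A) \<Longrightarrow> 0 \<le> (A *\<^sub>v v) \<bullet>c v"
  by (auto simp: psd_def)

lemma psd_conj:
  assumes "psd A" "dim_col K = dim_row A"
  shows "psd (K * A * mat_adjoint K)"
  unfolding psd_def
proof (intro conjI ballI)
  fix v :: "complex vec" assume "v \<in> carrier_vec (dim_row (K * A * mat_adjoint K))"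
  then have v: "dim_vec v = dim_row K" by auto
  have "(K * A * mat_adjoint K *\<^sub>v v) \<bullet>c v = (A *\<^sub>v (mat_adjoint K *\<^sub>v v)) \<bullet>c (mat_adjoint K *\<^sub>v v)"
    using assms v by (simp add: mult_assoc_mat mult_mat_vec_assoc inner_mult_mat_vec psd_dim)
  moreover have "mat_adjoint K *\<^sub>v v \<in> carrier_vec (dim_row A)"
    using assms by (intro carrier_vecI) simp
  ultimately show "0 \<le> (K * A * mat_adjoint K *\<^sub>v v) \<bullet>c v"
    using psd_inner[OF assms(1)] by presburger
qed (use assms in \<open>auto simp: adjoint_mult mult_assoc_mat psd_dim psd_adjoint\<close>)

lemma psd_diag:
  assumes "psd A" "i < dim_row A"
  shows "0 \<le> A $$ (i, i)"
proof -
  have "(A *\<^sub>v unit_vec (dim_row A) i) \<bullet>c unit_vec (dim_row A) i = A $$ (i, i)"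
    using assms psd_dim[OF assms(1)]
    by (simp add: scalar_prod_def mult_mat_vec_def unit_vec_def if_distrib[of cnj] if_distrib[of "(*) _"] cong: if_cong)
  then show ?thesis using psd_inner[OF assms(1), of "unit_vec (dim_row A) i"] by simp
qed

lemma psd_trace: "psd A \<Longrightarrow> 0 \<le> mat_trace A"
  unfolding mat_trace_def by (intro sum_nonneg psd_diag) auto

lemma psd_add:
  assumes "psd A" "psd B" "dim_row A = dim_row B"
  shows "psd (A + B)"
  unfolding psd_def
proof (intro conjI ballI)
  fix v :: "complex vec" assume v: "v \<in> carrier_vec (dim_row (A + B))"
  have "(A + B) *\<^sub>v v = A *\<^sub>v v + B *\<^sub>v v"
    using assms v psd_dim[OF assms(1)] psd_dim[OF assms(2)]
    by (intro add_mult_distrib_mat_vec[of _ "dim_row A" "dim_row A"] carrier_matI) auto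
  then have "((A + B) *\<^sub>v v) \<bullet>c v = (A *\<^sub>v v) \<bullet>c v + (B *\<^sub>v v) \<bullet>c v"
    using assms v by (simp, intro add_scalar_prod_distrib[of _ "dim_row B"]) (auto intro!: carrier_vecI)
  then show "0 \<le> ((A + B) *\<^sub>v v) \<bullet>c v"
    using assms v psd_inner[of A v] psd_inner[of B v] by auto
qed (use assms in \<open>auto simp: adjoint_add psd_dim psd_adjoint\<close>)

lemma psd_smult:
  assumes "psd A" "0 \<le> c"
  shows "psd (complex_of_real c \<cdot>\<^sub>m A)"
  unfolding psd_def
proof (intro conjI ballI)
  fix v :: "complex vec" assume v: "v \<in> carrier_vec (dim_row (complex_of_real c \<cdot>\<^sub>m A))"
  have "(complex_of_real c \<cdot>\<^sub>m A) *\<^sub>v v = complex_of_real c \<cdot>\<^sub>v (A *\<^sub>v v)"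
    using v by (auto intro!: eq_vecI simp: psd_dim[OF assms(1)])
  then have "((complex_of_real c \<cdot>\<^sub>m A) *\<^sub>v v) \<bullet>c v = complex_of_real c * ((A *\<^sub>v v) \<bullet>c v)"
    using v by (simp only:) (subst smult_scalar_prod_distrib[of _ "dim_row A"]; auto intro!: carrier_vecI)
  then show "0 \<le> ((complex_of_real c \<cdot>\<^sub>m A) *\<^sub>v v) \<bullet>c v"
    using assms(2) psd_inner[OF assms(1), of v] v by (auto intro!: mult_nonneg_nonneg simp: less_eq_complex_def)
qed (use assms in \<open>auto simp: adjoint_smult psd_dim psd_adjoint\<close>)

lemma psd_zero [simp]: "psd (0\<^sub>m n n)"
  using psd_gram[of "0\<^sub>m n n"] by simp

lemma psd_one [simp]: "psd (1\<^sub>m n)"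
  using psd_gram[of "1\<^sub>m n"] by simp

lemma psd_mat_sum:
  assumes "finite S" "\<And>x. x \<in> S \<Longrightarrow> psd (f x)" "\<And>x. x \<in> S \<Longrightarrow> f x \<in> carrier_mat n n"
  shows "psd (mat_sum n n f S)"
proof (rule mat_sum_induct[where P = psd, OF assms(1)])
  fix x B assume "x \<in> S" "B \<in> carrier_mat n n" "psd B"
  then show "psd (f x + B)" using assms(2,3)[of x] by (intro psd_add) auto
qed (use assms in auto)

section \<open>Spectral theorem and trace norm\<close>

text \<open>The squared Frobenius norm, equal to tr (M M^dagger) by \<open>trace_gram\<close>; it
  links traces of positive operators with the \<open>L2_set\<close> inequalities.\<close>

definition frob2 :: "complex mat \<Rightarrow> real" where
  "frob2 M = (\<Sum>i<dim_row M. \<Sum>j<dim_col M. (cmod (M $$ (i, j)))\<^sup>2)"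

lemma frob2_nonneg: "0 \<le> frob2 M"
  by (auto simp: frob2_def intro!: sum_nonneg)

lemma trace_gram: "mat_trace (M * mat_adjoint M) = of_real (frob2 M)"
  by (auto simp: mat_trace_def frob2_def index_mult_mat_sum complex_norm_square simp del: index_mult_mat(1) of_real_power)

lemma frob2_adjoint: "frob2 (mat_adjoint M) = frob2 M"
  unfolding frob2_def by (subst sum.swap) auto

lemma frob2_eq_0D: "frob2 M = 0 \<Longrightarrow> M = 0\<^sub>m (dim_row M) (dim_col M)"
  by (intro eq_matI) (auto simp: frob2_def sum_nonneg_eq_0_iff sum_nonneg)

text \<open>If all roots of the characteristic polynomial were 0, the triangular factor B of a Schur
  decomposition would be strictly upper triangular, so tr (H H) = tr (B B) = 0. For self-adjoint H
  this trace is the squared Frobenius norm, and H would vanish.\<close>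

lemma hermitian_nonzero_eigenvalue:
  fixes H :: "complex mat"
  assumes H: "H \<in> carrier_mat n n" and adj: "mat_adjoint H = H" and nz: "H \<noteq> 0\<^sub>m n n"
  obtains \<mu> v where "\<mu> \<noteq> 0" "v \<in> carrier_vec n" "v \<noteq> 0\<^sub>v n" "H *\<^sub>v v = \<mu> \<cdot>\<^sub>v v"
proof (rule ccontr)
  note goal = that
  assume "\<not> thesis"
  then have no: "\<mu> = 0" if "eigenvalue H \<mu>" for \<mu>
    using goal H that unfolding eigenvalue_def eigenvector_def by auto
  obtain es where es: "char_poly H = (\<Prod>a\<leftarrow>es. [:- a, 1:])"
    using char_poly_factorized[OF H] by auto
  obtain B P Q where s: "schur_decomposition H es = (B, P, Q)" by (metis prod_cases3)
  have sim: "similar_mat_wit H B P Q" and ut: "upper_triangular B" and dg: "diag_mat B = es"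
    using schur_decomposition[OF H es s] by auto
  note w = similar_mat_witD2[OF H sim]
  have "a = 0" if "a \<in> set es" for a
    using that unfolding es by (intro no) (auto simp: eigenvalue_root_char_poly[OF H] es poly_prod_list prod_list_zero_iff)
  then have d0: "B $$ (i, i) = 0" if "i < n" for i
    using that w(5) dg by (auto simp: diag_mat_def)
  have B0: "B $$ (i, j) = 0" if "i < n" "j \<le> i" for i j
    using that w(5) ut d0 by (cases "i = j") auto
  have "mat_trace (H * H) = mat_trace (P * (B * (B * Q)))"
  proof -
    have "H * H = P * (B * ((Q * P) * (B * Q)))"
      unfolding w(3) using w(4-7) by (simp add: mult_assoc_mat)
    then show ?thesis using w by simp
  qed
  also have "\<dots> = mat_trace ((B * (B * Q)) * P)"
    using w by (intro trace_mult_commute) auto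
  also have "(B * (B * Q)) * P = B * B"
    using w by (simp add: mult_assoc_mat)
  also have "mat_trace (B * B) = (\<Sum>i<n. \<Sum>k<n. B $$ (i, k) * B $$ (k, i))"
    using w(5) by (auto simp: mat_trace_def index_mult_mat_sum simp del: index_mult_mat(1))
  also have "\<dots> = 0"
    using B0 by (intro sum.neutral ballI) (metis lessThan_iff linorder_le_cases mult_eq_0_iff)
  finally have "frob2 H = 0" using trace_gram[of H] adj by simp
  then show False using frob2_eq_0D[of H] nz H by auto
qed

text \<open>The eigenvector is normalised and stored as a one-column matrix so that later
  computations stay inside matrix algebra. The eigenvalue is real because the 1 by 1 matrix w^dagger
  H w is self-adjoint.\<close>

lemma hermitian_eigencolumn:
  fixes H :: "complex mat"
  assumes H: "H \<in> carrier_mat n n" and adj: "mat_adjoint H = H" and nz: "H \<noteq> 0\<^sub>m n n"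
  obtains \<mu> :: real and w where "\<mu> \<noteq> 0" "w \<in> carrier_mat n 1" "mat_adjoint w * w = 1\<^sub>m 1"
    "H * w = complex_of_real \<mu> \<cdot>\<^sub>m w"
proof -
  obtain \<mu> v where \<mu>: "\<mu> \<noteq> 0" and v: "v \<in> carrier_vec n" "v \<noteq> 0\<^sub>v n" and ev: "H *\<^sub>v v = \<mu> \<cdot>\<^sub>v v"
    using hermitian_nonzero_eigenvalue[OF assms] by metis
  define s where "s = sqrt (\<Sum>i<n. (cmod (v $ i))\<^sup>2)"
  have spos: "s > 0"
  proof -
    obtain i where "i < n" "v $ i \<noteq> 0"
      using v by (metis carrier_vecD eq_vecI index_zero_vec)
    then have "(\<Sum>i<n. (cmod (v $ i))\<^sup>2) > 0" by (intro sum_pos2[of _ i]) auto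
    then show ?thesis by (simp add: s_def)
  qed
  have s2: "s\<^sup>2 = (\<Sum>i<n. (cmod (v $ i))\<^sup>2)" unfolding s_def by (simp add: sum_nonneg)
  define w where "w = mat n 1 (\<lambda>(i, j). v $ i / of_real s)"
  have wc: "w \<in> carrier_mat n 1" by (auto simp: w_def)
  have ww: "mat_adjoint w * w = 1\<^sub>m 1"
  proof (rule eq_matI)
    fix i j assume "i < dim_row (1\<^sub>m 1 :: complex mat)" "j < dim_col (1\<^sub>m 1 :: complex mat)"
    then have ij: "i = 0" "j = 0" by auto
    have "(mat_adjoint w * w) $$ (0, 0) = (\<Sum>k<n. cnj (v $ k / of_real s) * (v $ k / of_real s))"
      using wc by (simp add: index_mult_mat_sum w_def del: index_mult_mat(1))
    also have "\<dots> = (\<Sum>k<n. of_real ((cmod (v $ k))\<^sup>2)) / (of_real s)\<^sup>2"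
      by (simp add: sum_divide_distrib complex_norm_square power2_eq_square[of "complex_of_real s"] mult_ac del: of_real_power)
    also have "\<dots> = of_real (s\<^sup>2) / (of_real s)\<^sup>2" unfolding s2 by simp
    also have "\<dots> = 1" using spos by simp
    finally show "(mat_adjoint w * w) $$ (i, j) = 1\<^sub>m 1 $$ (i, j)" using ij by simp
  qed (use wc in auto)
  have Hw: "H * w = \<mu> \<cdot>\<^sub>m w"
  proof (rule eq_matI)
    fix i j assume "i < dim_row (\<mu> \<cdot>\<^sub>m w)" "j < dim_col (\<mu> \<cdot>\<^sub>m w)"
    then have i: "i < n" and j: "j = 0" using wc by auto
    have "(H * w) $$ (i, 0) = (\<Sum>k<n. H $$ (i, k) * v $ k) / of_real s"
      using wc H i by (simp add: index_mult_mat_sum w_def sum_divide_distrib del: index_mult_mat(1))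
    also have "(\<Sum>k<n. H $$ (i, k) * v $ k) = (H *\<^sub>v v) $ i"
      using H v i by (simp add: mult_mat_vec_def scalar_prod_def atLeast0LessThan)
    also have "\<dots> / of_real s = (\<mu> \<cdot>\<^sub>m w) $$ (i, 0)"
      unfolding ev using i v by (simp add: w_def)
    finally show "(H * w) $$ (i, j) = (\<mu> \<cdot>\<^sub>m w) $$ (i, j)" using j by simp
  qed (use H wc in auto)
  have "mat_adjoint w * (H * w) = \<mu> \<cdot>\<^sub>m 1\<^sub>m 1"
    unfolding Hw using wc ww by (simp add: smult_mult_mat)
  moreover have "mat_adjoint (mat_adjoint w * (H * w)) = mat_adjoint w * (H * w)"
    using wc H adj by (simp add: adjoint_mult mult_assoc_mat)
  ultimately have "cnj \<mu> \<cdot>\<^sub>m 1\<^sub>m 1 = \<mu> \<cdot>\<^sub>m (1\<^sub>m 1 :: complex mat)"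
    by (metis adjoint_one adjoint_smult)
  then have "(cnj \<mu> \<cdot>\<^sub>m 1\<^sub>m 1) $$ (0, 0) = (\<mu> \<cdot>\<^sub>m (1\<^sub>m 1 :: complex mat)) $$ (0, 0)" by simp
  then have "\<mu> = of_real (Re \<mu>)" by (simp add: complex_eq_iff)
  then show thesis using that[of "Re \<mu>" w] \<mu> wc ww Hw by (metis of_real_0)
qed

text \<open>Since P P = Q Q, the sum P (P - Q) + (P - Q) Q vanishes. Sandwiched by a unit
  eigenvector of P - Q with eigenvalue \<mu> \<noteq> 0 it gives \<mu> (p + q) = 0 for the
  expectations p, q \<ge> 0 of P and Q. So both are 0, against p - q = \<mu>. This uniqueness makes
  the description in \<open>psd_sqrt\<close> meaningful.\<close>

lemma psd_square_unique:
  assumes P: "psd P" and Q: "psd Q" and dim: "P \<in> carrier_mat n n" "Q \<in> carrier_mat n n" and eq: "P * P = Q * Q"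
  shows "P = Q"
proof (rule ccontr)
  assume "P \<noteq> Q"
  have nz: "P - Q \<noteq> 0\<^sub>m n n"
  proof
    assume z: "P - Q = 0\<^sub>m n n"
    have "P $$ (i, j) = Q $$ (i, j)" if "i < n" "j < n" for i j
      using arg_cong[OF z, of "\<lambda>A. A $$ (i, j)"] that dim by auto
    then have "P = Q" using dim by (intro eq_matI) auto
    with \<open>P \<noteq> Q\<close> show False by simp
  qed
  have adj: "mat_adjoint (P - Q) = P - Q" using dim P Q by (auto simp: adjoint_add psd_adjoint)
  have DQ: "P - Q \<in> carrier_mat n n" using dim by auto
  obtain \<mu> :: real and w where \<mu>: "\<mu> \<noteq> 0" and w: "w \<in> carrier_mat n 1" "mat_adjoint w * w = 1\<^sub>m 1"
    and ev: "(P - Q) * w = complex_of_real \<mu> \<cdot>\<^sub>m w"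
    using hermitian_eigencolumn[OF DQ adj nz] by metis
  have ev': "mat_adjoint w * (P - Q) = complex_of_real \<mu> \<cdot>\<^sub>m mat_adjoint w"
    using arg_cong[OF ev, of mat_adjoint] dim w adj by (simp add: adjoint_mult adjoint_smult)
  define p where "p = (mat_adjoint w * P * w) $$ (0, 0)"
  define q where "q = (mat_adjoint w * Q * w) $$ (0, 0)"
  have pp: "0 \<le> p" "0 \<le> q" 
    using psd_diag[OF psd_conj[OF P, of "mat_adjoint w"], of 0] psd_diag[OF psd_conj[OF Q, of "mat_adjoint w"], of 0] w dim
    by (auto simp: p_def q_def)
  have eq': "P * (P * w) = Q * (Q * w)"
  proof -
    have "P * (P * w) = P * P * w" using w dim by (intro mult_assoc_mat[symmetric]) auto
    also have "\<dots> = Q * (Q * w)" unfolding eq using w dim by (intro mult_assoc_mat) auto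
    finally show ?thesis .
  qed
  have "mat_adjoint w * (P * ((P - Q) * w)) = mat_adjoint w * (P * (P * w)) - mat_adjoint w * (P * (Q * w))"
    using w dim by (simp add: minus_mult_mat mult_minus_mat)
  then have "complex_of_real \<mu> \<cdot>\<^sub>m (mat_adjoint w * (P * w)) = mat_adjoint w * (P * (P * w)) - mat_adjoint w * (P * (Q * w))"
    unfolding ev using w dim by (simp add: smult_mult_mat)
  moreover have "(mat_adjoint w * (P - Q)) * (Q * w) = mat_adjoint w * (P * (Q * w)) - mat_adjoint w * (P * (P * w))"
    using w dim eq' by (simp add: minus_mult_mat mult_minus_mat mult_assoc_mat)
  then have "complex_of_real \<mu> \<cdot>\<^sub>m (mat_adjoint w * (Q * w)) = mat_adjoint w * (P * (Q * w)) - mat_adjoint w * (P * (P * w))"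
    unfolding ev' using w dim by (simp add: smult_mult_mat)
  ultimately have
    "(complex_of_real \<mu> \<cdot>\<^sub>m (mat_adjoint w * (P * w))) $$ (0, 0) = (mat_adjoint w * (P * (P * w)) - mat_adjoint w * (P * (Q * w))) $$ (0, 0)"
    "(complex_of_real \<mu> \<cdot>\<^sub>m (mat_adjoint w * (Q * w))) $$ (0, 0) = (mat_adjoint w * (P * (Q * w)) - mat_adjoint w * (P * (P * w))) $$ (0, 0)"
    by simp_all
  moreover have "p = (mat_adjoint w * (P * w)) $$ (0, 0)" "q = (mat_adjoint w * (Q * w)) $$ (0, 0)"
    using w dim by (simp_all add: p_def q_def mult_assoc_mat del: index_mult_mat(1))
  ultimately have "complex_of_real \<mu> * p + complex_of_real \<mu> * q = 0"
    using w dim by (simp del: index_mult_mat(1))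
  then have "p + q = 0" using \<mu> by (simp flip: distrib_left)
  then have "p = 0" "q = 0" using pp by (auto simp: add_nonneg_eq_0_iff)
  have "mat_adjoint w * ((P - Q) * w) = mat_adjoint w * P * w - mat_adjoint w * Q * w"
    using w dim by (simp add: mult_assoc_mat minus_mult_mat mult_minus_mat)
  then have "(mat_adjoint w * ((P - Q) * w)) $$ (0, 0) = p - q"
    using w dim by (simp add: p_def q_def del: index_mult_mat(1))
  moreover have "(mat_adjoint w * ((P - Q) * w)) $$ (0, 0) = complex_of_real \<mu>"
    unfolding ev using w by (simp add: smult_mult_mat del: index_mult_mat(1))
  ultimately show False using \<open>p = 0\<close> \<open>q = 0\<close> \<mu> by simp
qed

definition rdiag :: "nat \<Rightarrow> (nat \<Rightarrow> real) \<Rightarrow> complex mat" where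
  "rdiag k l = mat k k (\<lambda>(i, j). if i = j then complex_of_real (l i) else 0)"

lemma dim_rdiag [simp]: "dim_row (rdiag k l) = k" "dim_col (rdiag k l) = k"
  by (auto simp: rdiag_def)

lemma index_rdiag: "i < k \<Longrightarrow> j < k \<Longrightarrow> rdiag k l $$ (i, j) = (if i = j then complex_of_real (l i) else 0)"
  by (auto simp: rdiag_def)

lemma index_mult_rdiag:
  assumes "dim_col U = k" "i < dim_row U" "j < k"
  shows "(U * rdiag k l) $$ (i, j) = U $$ (i, j) * complex_of_real (l j)"
  using assms by (simp add: index_mult_mat_sum rdiag_def if_distrib[of "(*) _"] cong: if_cong del: index_mult_mat(1))

lemma rdiag_mult: "rdiag k f * rdiag k g = rdiag k (\<lambda>i. f i * g i)"
  by (rule eq_matI) (auto simp: index_mult_rdiag index_rdiag simp del: index_mult_mat(1))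

lemma rdiag_adjoint [simp]: "mat_adjoint (rdiag k f) = rdiag k f"
  by (rule eq_matI) (auto simp: rdiag_def)

lemma rdiag_add: "rdiag k f + rdiag k g = rdiag k (\<lambda>i. f i + g i)" "rdiag k f - rdiag k g = rdiag k (\<lambda>i. f i - g i)"
  by (auto intro!: eq_matI simp: rdiag_def)

lemma psd_rdiag_conj:
  assumes "dim_col U = k" "\<And>i. 0 \<le> f i"
  shows "psd (U * rdiag k f * mat_adjoint U)"
proof -
  have "rdiag k f = rdiag k (\<lambda>i. sqrt (f i)) * mat_adjoint (rdiag k (\<lambda>i. sqrt (f i)))"
    using assms by (simp add: rdiag_mult)
  then have "psd (rdiag k f)" using psd_gram' by metis
  then show ?thesis using assms by (intro psd_conj) auto
qed

text \<open>The matrix G = 1 - V V^dagger is a self-adjoint idempotent, hence the Gram matrix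
  G^dagger G.\<close>

lemma psd_one_minus_isometry:
  assumes "V \<in> carrier_mat n k" "mat_adjoint V * V = 1\<^sub>m k"
  shows "psd (1\<^sub>m n - V * mat_adjoint V)"
proof -
  let ?G = "1\<^sub>m n - V * mat_adjoint V"
  have a: "mat_adjoint ?G = ?G" using assms(1) by (simp add: adjoint_add adjoint_mult)
  have "V * (mat_adjoint V * (V * mat_adjoint V)) = V * ((mat_adjoint V * V) * mat_adjoint V)"
    using assms(1) by (simp add: mult_assoc_mat)
  also have "\<dots> = V * mat_adjoint V" using assms by simp
  finally have u: "V * (mat_adjoint V * (V * mat_adjoint V)) = V * mat_adjoint V" .
  have "?G * ?G = ?G"
    using assms(1) u by (simp add: minus_mult_mat mult_minus_mat mult_assoc_mat, intro eq_matI) (auto simp del: index_mult_mat(1))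
  then show ?thesis using psd_gram[of ?G] a by simp
qed

lemma orthonormal_columns_le:
  fixes U :: "complex mat"
  assumes "U \<in> carrier_mat n k" "mat_adjoint U * U = 1\<^sub>m k"
  shows "k \<le> n"
proof -
  have "mat_trace (1\<^sub>m n - U * mat_adjoint U) = of_nat n - of_nat k"
    using assms trace_mult_commute[of U "mat_adjoint U"] by (simp add: trace_add)
  then have "0 \<le> Re (of_nat n - of_nat k)"
    using psd_trace[OF psd_one_minus_isometry[OF assms]] by (simp only: less_eq_complex_def zero_complex.sel)
  then show ?thesis by simp
qed

text \<open>Deflation: as long as the residual H - U D U^dagger is nonzero, it has an eigencolumn w
  with nonzero eigenvalue. The residual annihilates the columns of U, so w is orthogonal to them and
  is an eigencolumn of H itself; it is appended to U. If this never stopped, C^n would contain n + 1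
  orthonormal columns. Here k may be smaller than n, as the kernel can be left out.\<close>

lemma hermitian_spectral:
  assumes H: "H \<in> carrier_mat n n" and adj: "mat_adjoint H = H"
  obtains k U l where "U \<in> carrier_mat n k" "mat_adjoint U * U = 1\<^sub>m k" "H = U * rdiag k l * mat_adjoint U"
proof (rule ccontr)
  note goal = that
  assume no: "\<not> thesis"
  have ex: "\<exists>U l. U \<in> carrier_mat n k \<and> mat_adjoint U * U = 1\<^sub>m k \<and> H * U = U * rdiag k l" for k
  proof (induction k)
    case 0
    show ?case by (rule exI[of _ "0\<^sub>m n 0"]) (use H in \<open>auto intro!: eq_matI\<close>)
  next
    case (Suc k)
    then obtain U l where U: "U \<in> carrier_mat n k" and UU: "mat_adjoint U * U = 1\<^sub>m k" and HU: "H * U = U * rdiag k l"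
      by auto
    let ?R = "U * rdiag k l * mat_adjoint U"
    let ?H = "H - ?R"
    have "?H \<noteq> 0\<^sub>m n n"
    proof
      assume z: "?H = 0\<^sub>m n n"
      have "H = ?R"
      proof (rule eq_matI)
        fix i j assume "i < dim_row ?R" "j < dim_col ?R"
        then show "H $$ (i, j) = ?R $$ (i, j)" 
          using arg_cong[OF z, of "\<lambda>A. A $$ (i, j)"] U H by (auto simp del: index_mult_mat(1))
      qed (use U H in auto)
      then show False using goal[OF U UU] no by auto
    qed
    moreover have adj': "mat_adjoint ?H = ?H" "?H \<in> carrier_mat n n"
      using H U adj by (auto simp: adjoint_add adjoint_mult mult_assoc_mat)
    ultimately obtain \<mu> :: real and w where \<mu>: "\<mu> \<noteq> 0" and w: "w \<in> carrier_mat n 1"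
      and ww: "mat_adjoint w * w = 1\<^sub>m 1" and ev: "?H * w = complex_of_real \<mu> \<cdot>\<^sub>m w"
      using hermitian_eigencolumn by metis
    have "?H * U = 0\<^sub>m n k"
    proof -
      have "?H * U = H * U - U * (rdiag k l * (mat_adjoint U * U))"
        using H U by (simp add: minus_mult_mat mult_assoc_mat)
      also have "\<dots> = 0\<^sub>m n k" unfolding HU UU using U by (auto intro!: eq_matI)
      finally show ?thesis .
    qed
    from arg_cong[OF this, of mat_adjoint] have UH: "mat_adjoint U * ?H = 0\<^sub>m k n"
      using H U adj' by (simp add: adjoint_mult)
    have "mat_adjoint U * (?H * w) = mat_adjoint U * ?H * w" 
      using H U w by (intro mult_assoc_mat[symmetric]) auto
    then have "complex_of_real \<mu> \<cdot>\<^sub>m (mat_adjoint U * w) = 0\<^sub>m k 1"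
      unfolding UH ev using U w by (simp add: smult_mult_mat)
    have Uw: "mat_adjoint U * w = 0\<^sub>m k 1"
    proof (rule eq_matI)
      fix i j assume "i < dim_row (0\<^sub>m k 1 :: complex mat)" "j < dim_col (0\<^sub>m k 1 :: complex mat)"
      then show "(mat_adjoint U * w) $$ (i, j) = 0\<^sub>m k 1 $$ (i, j)"
        using arg_cong[OF \<open>complex_of_real \<mu> \<cdot>\<^sub>m (mat_adjoint U * w) = 0\<^sub>m k 1\<close>, of "\<lambda>A. A $$ (i, j)"] U w \<mu>
        by (simp del: index_mult_mat(1))
    qed (use U w in auto)
    have wU: "mat_adjoint w * U = 0\<^sub>m 1 k"
      using arg_cong[OF Uw, of mat_adjoint] U w by (simp add: adjoint_mult)
    have "?H * w = H * w - U * (rdiag k l * (mat_adjoint U * w))"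
      using H U w by (simp add: minus_mult_mat mult_assoc_mat)
    also have "\<dots> = H * w" unfolding Uw using H U w by (intro eq_matI) (auto simp del: index_mult_mat(1))
    finally have Hw: "H * w = complex_of_real \<mu> \<cdot>\<^sub>m w" using ev by simp
    define V where "V = mat n (Suc k) (\<lambda>(i, j). if j < k then U $$ (i, j) else w $$ (i, 0))"
    define l' where "l' j = (if j < k then l j else \<mu>)" for j
    have V: "V \<in> carrier_mat n (Suc k)" by (auto simp: V_def)
    have "mat_adjoint V * V = 1\<^sub>m (Suc k)"
    proof (rule eq_matI)
      fix i j assume "i < dim_row (1\<^sub>m (Suc k) :: complex mat)" "j < dim_col (1\<^sub>m (Suc k) :: complex mat)"
      then have i: "i < Suc k" and j: "j < Suc k" by auto
      have e: "(mat_adjoint V * V) $$ (i, j) = (\<Sum>p<n. cnj (V $$ (p, i)) * V $$ (p, j))"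
        using V i j by (simp add: index_mult_mat_sum del: index_mult_mat(1))
      have g: "(mat_adjoint X * Y) $$ (i', j') = (\<Sum>p<n. cnj (X $$ (p, i')) * Y $$ (p, j'))"
        if "i' < dim_col X" "j' < dim_col Y" "dim_row X = n" "dim_row Y = n" for X Y :: "complex mat" and i' j'
        using that by (simp add: index_mult_mat_sum del: index_mult_mat(1))
      consider "i < k" "j < k" | "i < k" "j = k" | "i = k" "j < k" | "i = k" "j = k" using i j by linarith
      then show "(mat_adjoint V * V) $$ (i, j) = 1\<^sub>m (Suc k) $$ (i, j)"
      proof cases
        case 1
        then have "(mat_adjoint V * V) $$ (i, j) = (mat_adjoint U * U) $$ (i, j)"
          unfolding e using U by (subst g) (auto simp: V_def)
        then show ?thesis using 1 UU by simp
      next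
        case 2
        then have "(mat_adjoint V * V) $$ (i, j) = (mat_adjoint U * w) $$ (i, 0)"
          unfolding e using U w by (subst g) (auto simp: V_def)
        then show ?thesis using 2 Uw by simp
      next
        case 3
        then have "(mat_adjoint V * V) $$ (i, j) = (mat_adjoint w * U) $$ (0, j)"
          unfolding e using U w by (subst g) (auto simp: V_def)
        then show ?thesis using 3 wU by simp
      next
        case 4
        then have "(mat_adjoint V * V) $$ (i, j) = (mat_adjoint w * w) $$ (0, 0)"
          unfolding e using U w by (subst g) (auto simp: V_def)
        then show ?thesis using 4 ww by simp
      qed
    qed (use V in auto)
    moreover have "H * V = V * rdiag (Suc k) l'"
    proof (rule eq_matI)
      fix i j assume "i < dim_row (V * rdiag (Suc k) l')" "j < dim_col (V * rdiag (Suc k) l')"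
      then have i: "i < n" and j: "j < Suc k" using V by auto
      have "(H * V) $$ (i, j) = (if j < k then (H * U) $$ (i, j) else (H * w) $$ (i, 0))"
        using H U w V i j by (auto simp: index_mult_mat_sum V_def simp del: index_mult_mat(1))
      also have "\<dots> = (if j < k then U $$ (i, j) * l j else w $$ (i, 0) * \<mu>)"
        unfolding HU Hw using U w i j by (auto simp: index_mult_rdiag simp del: index_mult_mat(1))
      also have "\<dots> = (V * rdiag (Suc k) l') $$ (i, j)"
        using V i j by (subst index_mult_rdiag) (auto simp: V_def l'_def)
      finally show "(H * V) $$ (i, j) = (V * rdiag (Suc k) l') $$ (i, j)" .
    qed (use H V in auto)
    ultimately show ?case using V by blast
  qed
  from ex[of "Suc n"] obtain U :: "complex mat" where
    "U \<in> carrier_mat n (Suc n)" "mat_adjoint U * U = 1\<^sub>m (Suc n)" by blast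
  then have "Suc n \<le> n" by (rule orthonormal_columns_le)
  then show False by simp
qed

text \<open>The witness A is |H|, built from the absolute eigenvalues. The facts -A \<le> H \<le> A
  and tr A = trace norm are the only form in which the trace norm enters later estimates.\<close>

lemma trace_norm_hermitian:
  assumes H: "H \<in> carrier_mat n n" and adj: "mat_adjoint H = H"
  obtains A where "A \<in> carrier_mat n n" "psd A" "psd (A + H)" "psd (A - H)" "mat_trace A = complex_of_real (trace_norm H)"
proof -
  obtain k U l where U: "U \<in> carrier_mat n k" and UU: "mat_adjoint U * U = 1\<^sub>m k" and Hd: "H = U * rdiag k l * mat_adjoint U"
    using hermitian_spectral[OF assms] .
  define A where "A = U * rdiag k (\<lambda>i. \<bar>l i\<bar>) * mat_adjoint U"
  have Ac: "A \<in> carrier_mat n n" using U by (auto simp: A_def)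
  have sq: "U * rdiag k f * mat_adjoint U * (U * rdiag k f * mat_adjoint U) = U * rdiag k (\<lambda>i. f i * f i) * mat_adjoint U" for f
  proof -
    have "U * rdiag k f * mat_adjoint U * (U * rdiag k f * mat_adjoint U) 
       = U * (rdiag k f * ((mat_adjoint U * U) * (rdiag k f * mat_adjoint U)))"
      using U by (simp add: mult_assoc_mat)
    also have "\<dots> = U * (rdiag k f * rdiag k f) * mat_adjoint U"
      unfolding UU using U by (simp add: mult_assoc_mat)
    finally show ?thesis by (simp add: rdiag_mult)
  qed
  have psdA: "psd A" unfolding A_def using U by (intro psd_rdiag_conj) auto
  have AA: "A * A = mat_adjoint H * H"
    unfolding adj unfolding A_def Hd sq by simp
  have "psd_sqrt (mat_adjoint H * H) = A"
    unfolding psd_sqrt_def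
  proof (rule the_equality)
    \<comment> \<open>The description ranges over matrices of every size, so the dimension of P is
      first read off from P P.\<close>
    fix P assume P: "psd P \<and> P * P = mat_adjoint H * H"
    then have "dim_row P = dim_row (mat_adjoint H * H)" by (metis index_mult_mat(2))
    then have "P \<in> carrier_mat n n" using H P psd_dim[of P] by (intro carrier_matI) auto
    then show "P = A" using psd_square_unique[of P A n] P psdA Ac AA by auto
  qed (use psdA AA in auto)
  then have tr: "trace_norm H = Re (mat_trace A)" by (simp add: trace_norm_def)
  have pm: "A + H = U * rdiag k (\<lambda>i. \<bar>l i\<bar> + l i) * mat_adjoint U"
    "A - H = U * rdiag k (\<lambda>i. \<bar>l i\<bar> - l i) * mat_adjoint U"
    unfolding A_def Hd rdiag_add[symmetric] using U
    by (simp_all add: minus_mult_mat mult_minus_mat add_mult_mat mult_add_mat)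
  have "psd (A + H)" "psd (A - H)"
    unfolding pm using U by (auto intro!: psd_rdiag_conj)
  moreover have "mat_trace A = complex_of_real (trace_norm H)"
    unfolding tr using psd_trace[OF psdA] by (auto simp: less_eq_complex_def complex_eq_iff)
  ultimately show thesis using that Ac psdA by blast
qed

text \<open>Square roots of the eigenvalues give a Gram factor. Positivity of tensor products,
  reindexings and transposes, and the trace bounds for tests, are all read off from such a
  factor.\<close>

lemma psd_factor:
  assumes "psd A" "A \<in> carrier_mat n n"
  obtains M k where "M \<in> carrier_mat n k" "A = M * mat_adjoint M"
proof -
  obtain k U l where U: "U \<in> carrier_mat n k" and UU: "mat_adjoint U * U = 1\<^sub>m k" and Ad: "A = U * rdiag k l * mat_adjoint U"
    using hermitian_spectral[OF assms(2) psd_adjoint[OF assms(1)]] .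
  have "mat_adjoint U * A * U = (mat_adjoint U * U) * (rdiag k l * (mat_adjoint U * U))"
    unfolding Ad using U by (simp add: mult_assoc_mat)
  also have "\<dots> = rdiag k l" by (simp add: UU)
  finally have "psd (rdiag k l)"
    using psd_conj[OF assms(1), of "mat_adjoint U"] U assms by simp
  then have "0 \<le> l i" if "i < k" for i
    using psd_diag[of "rdiag k l" i] that by (simp add: rdiag_def less_eq_complex_def)
  then have "rdiag k l = rdiag k (\<lambda>i. sqrt (l i)) * rdiag k (\<lambda>i. sqrt (l i))"
    unfolding rdiag_mult by (auto simp: rdiag_def intro!: eq_matI)
  then have "A = (U * rdiag k (\<lambda>i. sqrt (l i))) * mat_adjoint (U * rdiag k (\<lambda>i. sqrt (l i)))"
    unfolding Ad using U by (simp add: adjoint_mult mult_assoc_mat)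
  moreover have "U * rdiag k (\<lambda>i. sqrt (l i)) \<in> carrier_mat n k"
    using U by (intro carrier_matI) auto
  ultimately show thesis using that by blast
qed

lemma psd_kron:
  assumes "psd A" "psd B"
  shows "psd (kron A B)"
proof -
  obtain M k where M: "M \<in> carrier_mat (dim_row A) k" "A = M * mat_adjoint M"
    using psd_factor[OF assms(1)] psd_dim[OF assms(1)] by (metis carrier_matI)
  obtain N l where N: "N \<in> carrier_mat (dim_row B) l" "B = N * mat_adjoint N"
    using psd_factor[OF assms(2)] psd_dim[OF assms(2)] by (metis carrier_matI)
  have "kron A B = kron M N * mat_adjoint (kron M N)"
    unfolding M(2) N(2) by (simp add: adjoint_kron kron_mult)
  then show ?thesis using psd_gram' by metis
qed

section \<open>Separable operators\<close>

text \<open>For A = M M^dagger the defect tr A - tr (V^dagger A V) is the trace of M^dagger (1 - V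
  V^dagger) M. Thus the test V V^dagger never accepts more than the whole trace.\<close>

lemma isometry_trace_le:
  assumes V: "V \<in> carrier_mat n k" "mat_adjoint V * V = 1\<^sub>m k" and A: "A \<in> carrier_mat n n" "psd A"
  shows "mat_trace (mat_adjoint V * A * V) \<le> mat_trace A"
proof -
  obtain M m where M: "M \<in> carrier_mat n m" "A = M * mat_adjoint M"
    using psd_factor[OF A(2,1)] by metis
  have "0 \<le> mat_trace (mat_adjoint M * (1\<^sub>m n - V * mat_adjoint V) * M)"
    using psd_trace[OF psd_conj[OF psd_one_minus_isometry[OF V], of "mat_adjoint M"]] M V by simp
  also have "mat_adjoint M * (1\<^sub>m n - V * mat_adjoint V) * M = mat_adjoint M * M - mat_adjoint M * (V * (mat_adjoint V * M))"
    using M V by (simp add: mult_minus_mat minus_mult_mat mult_assoc_mat)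
  also have "mat_trace \<dots> = mat_trace (mat_adjoint M * M) - mat_trace (mat_adjoint M * (V * (mat_adjoint V * M)))"
    using M V by (simp add: trace_add)
  also have "mat_trace (mat_adjoint M * M) = mat_trace A"
    unfolding M(2) using M by (intro trace_mult_commute) auto
  also have "mat_trace (mat_adjoint M * (V * (mat_adjoint V * M))) = mat_trace ((mat_adjoint M * V) * (mat_adjoint V * M))"
    using M V by (simp add: mult_assoc_mat)
  also have "\<dots> = mat_trace ((mat_adjoint V * M) * (mat_adjoint M * V))"
    using M V by (intro trace_mult_commute) auto
  also have "(mat_adjoint V * M) * (mat_adjoint M * V) = mat_adjoint V * A * V"
    unfolding M(2) using M V by (simp add: mult_assoc_mat)
  finally show ?thesis by simp
qed

text \<open>Separable operators without normalisation. Dropping the trace condition makes the class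
  a cone that is stable under single product Kraus operators, and adding one product term at a time
  reduces linear claims to products.\<close>

inductive sep_cone :: "nat \<Rightarrow> nat \<Rightarrow> complex mat \<Rightarrow> bool" for a b where
  sep_cone_zero: "sep_cone a b (0\<^sub>m (a * b) (a * b))"
| sep_cone_step: "psd P \<Longrightarrow> psd Q \<Longrightarrow> P \<in> carrier_mat a a \<Longrightarrow> Q \<in> carrier_mat b b \<Longrightarrow> sep_cone a b X \<Longrightarrow>
    sep_cone a b (kron P Q + X)"

lemma sep_cone_carrier: "sep_cone a b X \<Longrightarrow> X \<in> carrier_mat (a * b) (a * b)"
  by (induction rule: sep_cone.induct) auto

lemma sep_cone_psd: "sep_cone a b X \<Longrightarrow> psd X"
proof (induction rule: sep_cone.induct)
  case (sep_cone_step P Q X)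
  then show ?case using sep_cone_carrier[of a b X] by (intro psd_add psd_kron) auto
qed simp

lemma sep_cone_kron:
  assumes "psd P" "psd Q" "P \<in> carrier_mat a a" "Q \<in> carrier_mat b b"
  shows "sep_cone a b (kron P Q)"
proof -
  have "kron P Q + 0\<^sub>m (a * b) (a * b) = kron P Q"
    using assms by (intro right_add_zero_mat) auto
  then show ?thesis using sep_cone_step[OF assms sep_cone_zero] by simp
qed

lemma sep_cone_add: "sep_cone a b X \<Longrightarrow> sep_cone a b Y \<Longrightarrow> sep_cone a b (X + Y)"
proof (induction rule: sep_cone.induct)
  case sep_cone_zero
  then show ?case using sep_cone_carrier[of a b Y] by simp
next
  case (sep_cone_step P Q X)
  have "kron P Q + X + Y = kron P Q + (X + Y)"
    using sep_cone_step sep_cone_carrier[of a b X] sep_cone_carrier[of a b Y]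
    by (intro assoc_add_mat[of _ "a * b" "a * b"]) auto
  then show ?case using sep_cone_step sep_cone.sep_cone_step[of P Q a b "X + Y"] by simp
qed

lemma sep_cone_mat_sum:
  assumes "finite S" "\<And>x. x \<in> S \<Longrightarrow> sep_cone a b (f x)"
  shows "sep_cone a b (mat_sum (a * b) (a * b) f S)"
  by (rule mat_sum_induct[where P = "sep_cone a b", OF assms(1)])
    (use assms sep_cone_carrier sep_cone_zero sep_cone_add in blast)+

lemma sep_cone_conj:
  assumes "sep_cone a b X" "K \<in> carrier_mat a' a" "L \<in> carrier_mat b' b"
  shows "sep_cone a' b' (kron K L * X * mat_adjoint (kron K L))"
  using assms(1)
proof (induction rule: sep_cone.induct)
  case sep_cone_zero
  have "kron K L * 0\<^sub>m (a * b) (a * b) * mat_adjoint (kron K L) = 0\<^sub>m (a' * b') (a' * b')"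
    using assms by simp
  then show ?case using sep_cone.sep_cone_zero by metis
next
  case (sep_cone_step P Q X)
  note X = sep_cone_carrier[OF sep_cone_step(5)]
  have "kron K L * (kron P Q + X) * mat_adjoint (kron K L) =
      kron (K * P * mat_adjoint K) (L * Q * mat_adjoint L) + kron K L * X * mat_adjoint (kron K L)"
    using sep_cone_step(3,4) assms X by (simp add: mult_add_mat add_mult_mat adjoint_kron kron_mult)
  moreover have "sep_cone a' b' \<dots>"
    using sep_cone_step assms by (intro sep_cone.sep_cone_step psd_conj) auto
  ultimately show ?case by simp
qed

text \<open>The scalar is realised as conjugation by sqrt c times the identity, so that
  \<open>sep_cone_conj\<close> applies.\<close>

lemma sep_cone_smult:
  assumes "sep_cone a b X" "0 \<le> c"
  shows "sep_cone a b (complex_of_real c \<cdot>\<^sub>m X)"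
proof -
  have "kron (complex_of_real (sqrt c) \<cdot>\<^sub>m 1\<^sub>m a) (1\<^sub>m b) = complex_of_real (sqrt c) \<cdot>\<^sub>m 1\<^sub>m (a * b)"
    by (simp add: kron_smult kron_one)
  then have "kron (complex_of_real (sqrt c) \<cdot>\<^sub>m 1\<^sub>m a) (1\<^sub>m b) * X * mat_adjoint (kron (complex_of_real (sqrt c) \<cdot>\<^sub>m 1\<^sub>m a) (1\<^sub>m b))
      = complex_of_real c \<cdot>\<^sub>m X"
    using sep_cone_carrier[OF assms(1)] assms(2)
    by (simp add: adjoint_smult smult_mult_mat smult_smult_mat flip: of_real_mult)
  then show ?thesis
    using sep_cone_conj[OF assms(1), of "complex_of_real (sqrt c) \<cdot>\<^sub>m 1\<^sub>m a" a "1\<^sub>m b" b] by simp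
qed

section \<open>Tensor products regrouped along a bipartite cut\<close>

lemma idx_eq:
  assumes "q < a2" "r < b1" "s < b2"
  shows "idx1 a2 b1 b2 ((p * a2 + q) * (b1 * b2) + (r * b2 + s)) = p * b1 + r"
    and "idx2 a2 b1 b2 ((p * a2 + q) * (b1 * b2) + (r * b2 + s)) = q * b2 + s"
  using assms block_index[of r b1 s b2] by (auto simp: idx1_def idx2_def)

lemma idx_split:
  assumes "i < (a1 * a2) * (b1 * (b2::nat))"
  obtains p q r s where "p < a1" "q < a2" "r < b1" "s < b2" "i = (p * a2 + q) * (b1 * b2) + (r * b2 + s)"
proof
  let ?u = "i div (b1 * b2)" and ?v = "i mod (b1 * b2)"
  have u: "?u < a1 * a2" and v: "?v < b1 * b2" using div_less_fst[OF assms] mod_less_snd[OF assms] .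
  show "?u div a2 < a1" "?u mod a2 < a2" "?v div b2 < b1" "?v mod b2 < b2"
    using div_less_fst[OF u] mod_less_snd[OF u] div_less_fst[OF v] mod_less_snd[OF v] .
  show "i = (?u div a2 * a2 + ?u mod a2) * (b1 * b2) + (?v div b2 * b2 + ?v mod b2)"
    by (simp only: div_mult_mod_eq)
qed

lemma idx_less:
  assumes "i < (a1 * a2) * (b1 * b2)"
  shows "idx1 a2 b1 b2 i < a1 * b1" "idx2 a2 b1 b2 i < a2 * b2"
proof -
  obtain p q r s where "p < a1" "q < a2" "r < b1" "s < b2" "i = (p * a2 + q) * (b1 * b2) + (r * b2 + s)"
    using idx_split[OF assms] .
  then show "idx1 a2 b1 b2 i < a1 * b1" "idx2 a2 b1 b2 i < a2 * b2"
    by (simp_all only: idx_eq block_index)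
qed

lemma dim_bkron [simp]: "dim_row (bkron a1 b1 a2 b2 X Y) = (a1 * a2) * (b1 * b2)"
  "dim_col (bkron a1 b1 a2 b2 X Y) = (a1 * a2) * (b1 * b2)"
  by (auto simp: bkron_def)

lemma bkron_carrier [simp]: "bkron a1 b1 a2 b2 X Y \<in> carrier_mat ((a1 * a2) * (b1 * b2)) ((a1 * a2) * (b1 * b2))"
  by (auto simp: bkron_def)

lemma index_bkron:
  "i < (a1 * a2) * (b1 * b2) \<Longrightarrow> j < (a1 * a2) * (b1 * b2) \<Longrightarrow> bkron a1 b1 a2 b2 X Y $$ (i, j) =
     X $$ (idx1 a2 b1 b2 i, idx1 a2 b1 b2 j) * Y $$ (idx2 a2 b1 b2 i, idx2 a2 b1 b2 j)"
  by (auto simp: bkron_def)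

lemma bkron_add:
  assumes "X \<in> carrier_mat (a1 * b1) (a1 * b1)" "Y \<in> carrier_mat (a1 * b1) (a1 * b1)"
  shows "bkron a1 b1 a2 b2 (X + Y) Z = bkron a1 b1 a2 b2 X Z + bkron a1 b1 a2 b2 Y Z"
    and "bkron a1 b1 a2 b2 (X - Y) Z = bkron a1 b1 a2 b2 X Z - bkron a1 b1 a2 b2 Y Z"
  using assms by (auto intro!: eq_matI simp: index_bkron idx_less distrib_right left_diff_distrib)

lemma bkron_add_right:
  assumes "X \<in> carrier_mat (a2 * b2) (a2 * b2)" "Y \<in> carrier_mat (a2 * b2) (a2 * b2)"
  shows "bkron a1 b1 a2 b2 Z (X + Y) = bkron a1 b1 a2 b2 Z X + bkron a1 b1 a2 b2 Z Y"
    and "bkron a1 b1 a2 b2 Z (X - Y) = bkron a1 b1 a2 b2 Z X - bkron a1 b1 a2 b2 Z Y"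
  using assms by (auto intro!: eq_matI simp: index_bkron idx_less distrib_left right_diff_distrib)

lemma bkron_zero [simp]:
  "bkron a1 b1 a2 b2 (0\<^sub>m (a1 * b1) (a1 * b1)) Z = 0\<^sub>m ((a1 * a2) * (b1 * b2)) ((a1 * a2) * (b1 * b2))"
  "bkron a1 b1 a2 b2 Z (0\<^sub>m (a2 * b2) (a2 * b2)) = 0\<^sub>m ((a1 * a2) * (b1 * b2)) ((a1 * a2) * (b1 * b2))"
  by (auto intro!: eq_matI simp: index_bkron idx_less)

text \<open>Selecting the rows \<pi> i of a Gram factor gives a Gram factor of the reindexed
  matrix.\<close>

lemma psd_reindex:
  assumes "psd A" "A \<in> carrier_mat n n" "\<And>i. i < m \<Longrightarrow> \<pi> i < n"
  shows "psd (mat m m (\<lambda>(i, j). A $$ (\<pi> i, \<pi> j)))"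
proof -
  obtain M k where M: "M \<in> carrier_mat n k" "A = M * mat_adjoint M"
    using psd_factor[OF assms(1,2)] .
  let ?N = "mat m k (\<lambda>(i, j). M $$ (\<pi> i, j))"
  have "mat m m (\<lambda>(i, j). A $$ (\<pi> i, \<pi> j)) = ?N * mat_adjoint ?N"
    using M assms(3) by (intro eq_matI) (auto simp: index_mult_mat_sum simp del: index_mult_mat(1))
  then show ?thesis using psd_gram' by metis
qed

text \<open>\<open>bkron\<close> is \<open>kron\<close> in a permuted basis, which transfers
  positivity from one to the other.\<close>

lemma bkron_eq_reindex:
  assumes "X \<in> carrier_mat (a1 * b1) (a1 * b1)" "Y \<in> carrier_mat (a2 * b2) (a2 * b2)"
  shows "bkron a1 b1 a2 b2 X Y = mat ((a1 * a2) * (b1 * b2)) ((a1 * a2) * (b1 * b2))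
    (\<lambda>(i, j). kron X Y $$ (idx1 a2 b1 b2 i * (a2 * b2) + idx2 a2 b1 b2 i, idx1 a2 b1 b2 j * (a2 * b2) + idx2 a2 b1 b2 j))"
proof (rule eq_matI; clarsimp)
  fix i j assume ij: "i < (a1 * a2) * (b1 * b2)" "j < (a1 * a2) * (b1 * b2)"
  let ?\<pi> = "\<lambda>i. idx1 a2 b1 b2 i * (a2 * b2) + idx2 a2 b1 b2 i"
  have l: "?\<pi> i < (a1 * b1) * (a2 * b2)" "?\<pi> j < (a1 * b1) * (a2 * b2)"
    using idx_less[OF ij(1)] idx_less[OF ij(2)] by (auto intro!: block_index)
  show "bkron a1 b1 a2 b2 X Y $$ (i, j) = kron X Y $$ (?\<pi> i, ?\<pi> j)"
    using assms l idx_less[OF ij(1)] idx_less[OF ij(2)] ij by (simp add: index_kron index_bkron block_div)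
qed

lemma psd_bkron:
  assumes "psd X" "psd Y" "X \<in> carrier_mat (a1 * b1) (a1 * b1)" "Y \<in> carrier_mat (a2 * b2) (a2 * b2)"
  shows "psd (bkron a1 b1 a2 b2 X Y)"
  unfolding bkron_eq_reindex[OF assms(3,4)]
proof (rule psd_reindex)
  show "kron X Y \<in> carrier_mat ((a1 * b1) * (a2 * b2)) ((a1 * b1) * (a2 * b2))" using assms by auto
  fix i assume "i < (a1 * a2) * (b1 * b2)"
  from idx_less[OF this] show "idx1 a2 b1 b2 i * (a2 * b2) + idx2 a2 b1 b2 i < (a1 * b1) * (a2 * b2)"
    by (rule block_index)
qed (use assms psd_kron in auto)

lemma trace_bkron:
  assumes "X \<in> carrier_mat (a1 * b1) (a1 * b1)" "Y \<in> carrier_mat (a2 * b2) (a2 * b2)"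
  shows "mat_trace (bkron a1 b1 a2 b2 X Y) = mat_trace X * mat_trace Y"
proof -
  let ?x = "\<lambda>p r. X $$ (p * b1 + r, p * b1 + r)" and ?y = "\<lambda>q s. Y $$ (q * b2 + s, q * b2 + s)"
  have "mat_trace (bkron a1 b1 a2 b2 X Y) = (\<Sum>p<a1. \<Sum>q<a2. \<Sum>r<b1. \<Sum>s<b2. ?x p r * ?y q s)"
    unfolding mat_trace_def dim_bkron sum_less_mult
    by (intro sum.cong refl) (subst index_bkron; simp add: idx_eq block_index)
  also have "\<dots> = (\<Sum>p<a1. \<Sum>r<b1. \<Sum>q<a2. \<Sum>s<b2. ?x p r * ?y q s)"
    by (intro sum.cong refl sum.swap)
  also have "\<dots> = mat_trace X * mat_trace Y"
  proof -
    have "mat_trace X = (\<Sum>p<a1. \<Sum>r<b1. ?x p r)" "mat_trace Y = (\<Sum>q<a2. \<Sum>s<b2. ?y q s)"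
      using assms by (auto simp: mat_trace_def sum_less_mult)
    then show ?thesis by (simp only: sum_distrib_right) (simp only: sum_distrib_left)
  qed
  finally show ?thesis .
qed

lemma bkron_kron:
  assumes "P1 \<in> carrier_mat a1 a1" "Q1 \<in> carrier_mat b1 b1" "P2 \<in> carrier_mat a2 a2" "Q2 \<in> carrier_mat b2 b2"
  shows "bkron a1 b1 a2 b2 (kron P1 Q1) (kron P2 Q2) = kron (kron P1 P2) (kron Q1 Q2)"
proof (rule eq_matI)
  fix i j assume "i < dim_row (kron (kron P1 P2) (kron Q1 Q2))" "j < dim_col (kron (kron P1 P2) (kron Q1 Q2))"
  then have i: "i < (a1 * a2) * (b1 * b2)" and j: "j < (a1 * a2) * (b1 * b2)" using assms by auto
  have l: "i div (b1 * b2) < a1 * a2" "i mod (b1 * b2) < b1 * b2" "j div (b1 * b2) < a1 * a2" "j mod (b1 * b2) < b1 * b2"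
    using div_less_fst[OF i] mod_less_snd[OF i] div_less_fst[OF j] mod_less_snd[OF j] .
  note l2 = div_less_fst[OF l(2)] mod_less_snd[OF l(2)] div_less_fst[OF l(4)] mod_less_snd[OF l(4)]
  show "bkron a1 b1 a2 b2 (kron P1 Q1) (kron P2 Q2) $$ (i, j) = kron (kron P1 P2) (kron Q1 Q2) $$ (i, j)"
    using assms i j idx_less[OF i] idx_less[OF j] l l2
    by (simp add: index_bkron index_kron, simp add: idx1_def idx2_def)
qed (use assms in auto)

text \<open>Products in the two separate cuts regroup to a product in the joint cut
  (\<open>bkron_kron\<close>), and \<open>bkron\<close> is additive in each argument; hence two
  nested inductions.\<close>

lemma sep_cone_bkron:
  assumes "sep_cone a1 b1 X" "sep_cone a2 b2 Y"
  shows "sep_cone (a1 * a2) (b1 * b2) (bkron a1 b1 a2 b2 X Y)"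
  using assms(1)
proof (induction rule: sep_cone.induct)
  case sep_cone_zero
  then show ?case by (simp add: sep_cone.sep_cone_zero)
next
  case (sep_cone_step P Q X)
  have "sep_cone (a1 * a2) (b1 * b2) (bkron a1 b1 a2 b2 (kron P Q) Y)"
    using assms(2)
  proof (induction rule: sep_cone.induct)
    case sep_cone_zero
    then show ?case by (simp add: sep_cone.sep_cone_zero)
  next
    case (sep_cone_step P' Q' Y)
    have "sep_cone (a1 * a2) (b1 * b2) (kron (kron P P') (kron Q Q'))"
      using \<open>psd P\<close> \<open>psd Q\<close> sep_cone_step \<open>P \<in> _\<close> \<open>Q \<in> _\<close> by (intro sep_cone_kron psd_kron) auto
    moreover have "bkron a1 b1 a2 b2 (kron P Q) (kron P' Q' + Y) = kron (kron P P') (kron Q Q') + bkron a1 b1 a2 b2 (kron P Q) Y"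
      using sep_cone_step \<open>P \<in> _\<close> \<open>Q \<in> _\<close> sep_cone_carrier[of a2 b2 Y] by (subst bkron_add_right) (auto simp: bkron_kron)
    ultimately show ?case using sep_cone_step sep_cone_add by simp
  qed
  moreover have "bkron a1 b1 a2 b2 (kron P Q + X) Y = bkron a1 b1 a2 b2 (kron P Q) Y + bkron a1 b1 a2 b2 X Y"
    using sep_cone_step sep_cone_carrier[of a1 b1 X] by (subst bkron_add) auto
  ultimately show ?case using sep_cone_step sep_cone_add by simp
qed

section \<open>LOCC maps\<close>

lemma mult_mat_sum:
  assumes "finite S" "\<And>x. x \<in> S \<Longrightarrow> f x \<in> carrier_mat n m" "dim_col A = n" "dim_row B = m"
  shows "A * mat_sum n m f S * B = mat_sum (dim_row A) (dim_col B) (\<lambda>x. A * f x * B) S"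
proof (rule additive_mat_sum[where F = "\<lambda>X. A * X * B"])
  fix X Y :: "complex mat" assume "X \<in> carrier_mat n m" "Y \<in> carrier_mat n m"
  then show "A * (X + Y) * B = A * X * B + A * Y * B"
    using assms by (simp add: mult_add_mat add_mult_mat)
qed (use assms in auto)

lemma mat_sum_mult:
  assumes "finite S" "\<And>x. x \<in> S \<Longrightarrow> f x \<in> carrier_mat n m" "dim_row B = m"
  shows "mat_sum n m f S * B = mat_sum n (dim_col B) (\<lambda>x. f x * B) S"
proof (rule additive_mat_sum[where F = "\<lambda>X. X * B"])
  fix X Y :: "complex mat" assume "X \<in> carrier_mat n m" "Y \<in> carrier_mat n m"
  then show "(X + Y) * B = X * B + Y * B"
    using assms by (simp add: add_mult_mat)
qed (use assms in auto)

lemma mat_sum_add: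
  assumes "\<And>x. x \<in> S \<Longrightarrow> f x \<in> carrier_mat n m" "\<And>x. x \<in> S \<Longrightarrow> g x \<in> carrier_mat n m"
  shows "mat_sum n m (\<lambda>x. f x + g x) S = mat_sum n m f S + mat_sum n m g S"
proof (rule eq_matI)
  fix i j assume "i < dim_row (mat_sum n m f S + mat_sum n m g S)" "j < dim_col (mat_sum n m f S + mat_sum n m g S)"
  then have ij: "i < n" "j < m" by auto
  have "(f x + g x) $$ (i, j) = f x $$ (i, j) + g x $$ (i, j)" if "x \<in> S" for x
    using assms(2)[OF that] ij by simp
  then show "mat_sum n m (\<lambda>x. f x + g x) S $$ (i, j) = (mat_sum n m f S + mat_sum n m g S) $$ (i, j)"
    using ij by (simp add: sum.distrib)
qed auto

lemma prod_list_split: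
  fixes ds :: "nat list"
  assumes "p < length ds"
  shows "prod_list (take p ds) * (ds ! p * prod_list (drop (Suc p) ds)) = prod_list ds"
    and "prod_list (ds[p := x]) = prod_list (take p ds) * (x * prod_list (drop (Suc p) ds))"
  by (subst (4) id_take_nth_drop[OF assms], simp) (simp add: upd_conv_take_nth_drop[OF assms])

lemma dim_local_op:
  assumes "p < length ds" "dim_col K = ds ! p"
  shows "dim_col (local_op ds p K) = prod_list ds" "dim_row (local_op ds p K) = prod_list (ds[p := dim_row K])"
  using assms by (simp_all add: local_op_def prod_list_split)

lemma adjoint_local_op: "mat_adjoint (local_op ds p K) = local_op ds p (mat_adjoint K)"
  by (simp add: local_op_def adjoint_kron)

lemma local_op_mult: "dim_col K = dim_row L \<Longrightarrow> local_op ds p K * local_op ds p L = local_op ds p (K * L)"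
  by (simp add: local_op_def kron_mult)

lemma local_op_one: "p < length ds \<Longrightarrow> local_op ds p (1\<^sub>m (ds ! p)) = 1\<^sub>m (prod_list ds)"
  by (simp add: local_op_def kron_one prod_list_split)

lemma local_op_add:
  "dim_row K = dim_row L \<Longrightarrow> dim_col K = dim_col L \<Longrightarrow> local_op ds p (K + L) = local_op ds p K + local_op ds p L"
  by (simp add: local_op_def kron_add)

lemma local_op_complete:
  assumes "p < length ds" "\<And>i. i < r \<Longrightarrow> dim_col (K i) = ds ! p"
    and "mat_sum (ds ! p) (ds ! p) (\<lambda>i. mat_adjoint (K i) * K i) {..<(r::nat)} = 1\<^sub>m (ds ! p)"
  shows "mat_sum (prod_list ds) (prod_list ds)
    (\<lambda>i. mat_adjoint (local_op ds p (K i)) * local_op ds p (K i)) {..<r} = 1\<^sub>m (prod_list ds)"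
proof -
  have "local_op ds p (mat_sum (ds ! p) (ds ! p) (\<lambda>i. mat_adjoint (K i) * K i) {..<r})
      = mat_sum (prod_list ds) (prod_list ds) (\<lambda>i. local_op ds p (mat_adjoint (K i) * K i)) {..<r}"
  proof (rule additive_mat_sum)
    show "local_op ds p (0\<^sub>m (ds ! p) (ds ! p)) = 0\<^sub>m (prod_list ds) (prod_list ds)"
      using assms(1) by (simp add: local_op_def prod_list_split)
    fix A :: "complex mat" assume A: "A \<in> carrier_mat (ds ! p) (ds ! p)"
    then show "local_op ds p A \<in> carrier_mat (prod_list ds) (prod_list ds)"
      using assms(1) dim_local_op[OF assms(1), of A] by (intro carrier_matI) auto
    fix B :: "complex mat" assume "B \<in> carrier_mat (ds ! p) (ds ! p)"
    with A show "local_op ds p (A + B) = local_op ds p A + local_op ds p B"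
      by (intro local_op_add) auto
  qed (use assms(2) in auto)
  moreover have "\<dots> = mat_sum (prod_list ds) (prod_list ds)
      (\<lambda>i. mat_adjoint (local_op ds p (K i)) * local_op ds p (K i)) {..<r}"
    by (intro mat_sum_cong) (simp add: adjoint_local_op local_op_mult)
  ultimately show ?thesis using assms(1,3) local_op_one by simp
qed

text \<open>Only positivity is required, not complete positivity.\<close>

definition channel :: "nat \<Rightarrow> nat \<Rightarrow> (complex mat \<Rightarrow> complex mat) \<Rightarrow> bool" where
  "channel n m F \<longleftrightarrow> (\<forall>X\<in>carrier_mat n n. F X \<in> carrier_mat m m \<and> mat_trace (F X) = mat_trace X \<and>
     (psd X \<longrightarrow> psd (F X)) \<and> (\<forall>Y\<in>carrier_mat n n. F (X + Y) = F X + F Y))"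

lemma channelD:
  assumes "channel n m F" "X \<in> carrier_mat n n"
  shows "F X \<in> carrier_mat m m" "mat_trace (F X) = mat_trace X" "psd X \<Longrightarrow> psd (F X)"
    "Y \<in> carrier_mat n n \<Longrightarrow> F (X + Y) = F X + F Y"
  using assms by (auto simp: channel_def)

lemma channel_diff:
  assumes "channel n m F" "X \<in> carrier_mat n n" "Y \<in> carrier_mat n n"
  shows "F (X - Y) = F X - F Y"
proof -
  have "X - Y + Y = X" using assms by (intro eq_matI) auto
  then have "F X = F (X - Y) + F Y"
    using channelD(4)[OF assms(1) minus_carrier_mat[OF assms(3)] assms(3), of X] by simp
  moreover have "F (X - Y) \<in> carrier_mat m m" "F Y \<in> carrier_mat m m"
    using channelD(1)[OF assms(1) minus_carrier_mat[OF assms(3)]] channelD(1)[OF assms(1,3)] by auto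
  ultimately show ?thesis by (intro eq_matI) auto
qed

lemma channel_comp: "channel n m F \<Longrightarrow> channel m k G \<Longrightarrow> channel n k (\<lambda>X. G (F X))"
  by (simp add: channel_def)

text \<open>The trace is preserved by cyclicity and completeness, positivity by conjugation. As the
  operators L i are general, the lemma serves both a round of a protocol and the block measurement
  in \<open>frob2_block_rows\<close>.\<close>

lemma channel_round:
  assumes L: "\<And>i. i < r \<Longrightarrow> L i \<in> carrier_mat (k i) n"
    and c: "mat_sum n n (\<lambda>i. mat_adjoint (L i) * L i) {..<(r::nat)} = 1\<^sub>m n"
    and F: "\<And>i. i < r \<Longrightarrow> channel (k i) m (F i)"
  shows "channel n m (\<lambda>X. mat_sum m m (\<lambda>i. F i (L i * X * mat_adjoint (L i))) {..<r})"
  unfolding channel_def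
proof (intro conjI ballI impI)
  fix X :: "complex mat" assume X: "X \<in> carrier_mat n n"
  have LX: "L i * Z * mat_adjoint (L i) \<in> carrier_mat (k i) (k i)" if "i < r" "Z \<in> carrier_mat n n" for i Z
    using L[OF that(1)] that(2) by auto
  have LLX: "mat_adjoint (L i) * L i * X \<in> carrier_mat n n" if "i < r" for i
    using L[OF that] X by (intro carrier_matI) auto
  have LL: "mat_adjoint (L i) * L i \<in> carrier_mat n n" if "i < r" for i
    using L[OF that] by (intro carrier_matI) auto
  note FX = channelD[OF F LX, OF _ _ X]
  show "mat_trace (mat_sum m m (\<lambda>i. F i (L i * X * mat_adjoint (L i))) {..<r}) = mat_trace X"
  proof -
    have "mat_trace (mat_sum m m (\<lambda>i. F i (L i * X * mat_adjoint (L i))) {..<r}) =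
        (\<Sum>i<r. mat_trace (F i (L i * X * mat_adjoint (L i))))"
      using FX by (intro trace_mat_sum) auto
    also have "\<dots> = (\<Sum>i<r. mat_trace (mat_adjoint (L i) * L i * X))"
    proof (intro sum.cong refl)
      fix i assume i: "i \<in> {..<r}"
      then have "mat_trace (F i (L i * X * mat_adjoint (L i))) = mat_trace ((L i * X) * mat_adjoint (L i))"
        using FX by auto
      also have "\<dots> = mat_trace (mat_adjoint (L i) * (L i * X))"
        using L[of i] X i by (intro trace_mult_commute) auto
      also have "mat_adjoint (L i) * (L i * X) = mat_adjoint (L i) * L i * X"
        using L[of i] X i by (intro mult_assoc_mat[symmetric]) auto
      finally show "mat_trace (F i (L i * X * mat_adjoint (L i))) = mat_trace (mat_adjoint (L i) * L i * X)" .
    qed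
    also have "\<dots> = mat_trace (mat_sum n n (\<lambda>i. mat_adjoint (L i) * L i * X) {..<r})"
      using LLX by (intro trace_mat_sum[symmetric]) auto
    also have "mat_sum n n (\<lambda>i. mat_adjoint (L i) * L i * X) {..<r} =
        mat_sum n n (\<lambda>i. mat_adjoint (L i) * L i) {..<r} * X"
      using LL X by (subst mat_sum_mult[of _ _ n n]) auto
    also have "\<dots> = X" unfolding c using X by simp
    finally show ?thesis .
  qed
  show "psd (mat_sum m m (\<lambda>i. F i (L i * X * mat_adjoint (L i))) {..<r})" if "psd X"
  proof (rule psd_mat_sum)
    fix i assume "i \<in> {..<r}"
    then have i: "i < r" by simp
    show "psd (F i (L i * X * mat_adjoint (L i)))"
      using L[OF i] X that i by (intro FX(3)[OF i] psd_conj) auto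
    show "F i (L i * X * mat_adjoint (L i)) \<in> carrier_mat m m" using FX(1)[OF i i] .
  qed auto
  fix Y :: "complex mat" assume Y: "Y \<in> carrier_mat n n"
  have "F i (L i * (X + Y) * mat_adjoint (L i)) = F i (L i * X * mat_adjoint (L i)) + F i (L i * Y * mat_adjoint (L i))"
    if i: "i < r" for i
  proof -
    have "L i * (X + Y) * mat_adjoint (L i) = L i * X * mat_adjoint (L i) + L i * Y * mat_adjoint (L i)"
      using L[OF i] X Y by (simp add: mult_add_mat add_mult_mat)
    then show ?thesis using FX(4)[OF i i LX[OF i Y]] by simp
  qed
  then have "mat_sum m m (\<lambda>i. F i (L i * (X + Y) * mat_adjoint (L i))) {..<r} =
      mat_sum m m (\<lambda>i. F i (L i * X * mat_adjoint (L i)) + F i (L i * Y * mat_adjoint (L i))) {..<r}"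
    by (intro mat_sum_cong) auto
  then show "mat_sum m m (\<lambda>i. F i (L i * (X + Y) * mat_adjoint (L i))) {..<r} =
      mat_sum m m (\<lambda>i. F i (L i * X * mat_adjoint (L i))) {..<r} + mat_sum m m (\<lambda>i. F i (L i * Y * mat_adjoint (L i))) {..<r}"
    using channelD(1)[OF F LX[OF _ X]] channelD(1)[OF F LX[OF _ Y]] by (subst mat_sum_add[symmetric]) auto
qed auto

lemma locc_channel: "locc ds ds' \<Lambda> \<Longrightarrow> channel (prod_list ds) (prod_list ds') \<Lambda>"
proof (induction rule: locc.induct)
  case (stop ds)
  then show ?case by (auto simp: channel_def)
next
  case (round p ds r K ds' \<Lambda>)
  show ?case
  proof (rule channel_round)
    fix i assume i: "i < r"
    show "local_op ds p (K i) \<in> carrier_mat (prod_list (ds[p := dim_row (K i)])) (prod_list ds)"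
      using dim_local_op[of p ds "K i"] round(1,2) i by auto
    show "channel (prod_list (ds[p := dim_row (K i)])) (prod_list ds') (\<Lambda> i)"
      using round i by auto
  qed (use round local_op_complete in auto)
qed

text \<open>Across the cut between the first party and all others, an operator applied by a single
  party is a product in which one factor is the identity.\<close>

lemma local_op_bipartite:
  assumes "p < length ds" "dim_col K = ds ! p"
  obtains M L where "M \<in> carrier_mat (hd (ds[p := dim_row K])) (hd ds)"
    "L \<in> carrier_mat (prod_list (tl (ds[p := dim_row K]))) (prod_list (tl ds))" "local_op ds p K = kron M L"
proof (cases p)
  case 0
  then obtain x xs where ds: "ds = x # xs" using assms by (cases ds) auto
  show thesis
    by (rule that[of K "1\<^sub>m (prod_list xs)"]) (use assms 0 ds in \<open>auto simp: local_op_def\<close>)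
next
  case (Suc q)
  then obtain x xs where ds: "ds = x # xs" and q: "q < length xs" using assms by (cases ds) auto
  have "local_op ds p K = kron (1\<^sub>m x) (local_op xs q K)"
    by (simp add: ds Suc local_op_def kron_one[symmetric] kron_assoc)
  moreover have "local_op xs q K \<in> carrier_mat (prod_list (xs[q := dim_row K])) (prod_list xs)"
    using dim_local_op[OF q, of K] assms ds Suc by auto
  ultimately show thesis
    by (intro that[of "1\<^sub>m x" "local_op xs q K"]) (use ds Suc in auto)
qed

text \<open>Each Kraus operator of each round is a product across the cut between the first party
  and the rest, so product terms go to product terms. With three parties the cut is Alice versus
  Charlie and Bob.\<close>

lemma locc_sepc:
  "locc ds ds' \<Lambda> \<Longrightarrow> ds \<noteq> [] \<Longrightarrow> ds' \<noteq> [] \<Longrightarrow> sep_cone (hd ds) (prod_list (tl ds)) X \<Longrightarrow>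
    sep_cone (hd ds') (prod_list (tl ds')) (\<Lambda> X)"
proof (induction arbitrary: X rule: locc.induct)
  case (round p ds r K ds' \<Lambda>)
  have *: "sep_cone (hd ds') (prod_list (tl ds')) (\<Lambda> i (local_op ds p (K i) * X * mat_adjoint (local_op ds p (K i))))"
    if i: "i < r" for i
  proof -
    obtain M L where cut: "M \<in> carrier_mat (hd (ds[p := dim_row (K i)])) (hd ds)"
      "L \<in> carrier_mat (prod_list (tl (ds[p := dim_row (K i)]))) (prod_list (tl ds))" "local_op ds p (K i) = kron M L"
      using local_op_bipartite round(1,2) i by metis
    have "sep_cone (hd (ds[p := dim_row (K i)])) (prod_list (tl (ds[p := dim_row (K i)])))
        (local_op ds p (K i) * X * mat_adjoint (local_op ds p (K i)))"
      unfolding cut(3) using round.prems cut by (intro sep_cone_conj) auto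
    then show ?thesis using round.IH[OF i] round.prems by simp
  qed
  have "prod_list ds' = hd ds' * prod_list (tl ds')" using round.prems by (cases ds') auto
  then show ?case using sep_cone_mat_sum[of "{..<r}", OF _ *] by simp
qed auto

section \<open>Partial transposition and pinching\<close>

definition unitm :: "nat \<Rightarrow> nat \<Rightarrow> nat \<Rightarrow> complex mat" where
  "unitm n k l = mat n n (\<lambda>(i, j). if i = k \<and> j = l then 1 else 0)"

lemma unitm_carrier [simp]: "unitm n k l \<in> carrier_mat n n"
  by (auto simp: unitm_def)

lemma unitm_kron:
  assumes "k < a * b" "l < a * b"
  shows "unitm (a * b) k l = kron (unitm a (k div b) (l div b)) (unitm b (k mod b) (l mod b))"
  by (rule eq_matI)
    (auto simp: unitm_def index_kron div_less_fst mod_less_snd dest: div_mod_eqD)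

lemma mat_sum_unitm:
  assumes "X \<in> carrier_mat n n"
  shows "X = mat_sum n n (\<lambda>(k, l). X $$ (k, l) \<cdot>\<^sub>m unitm n k l) ({..<n} \<times> {..<n})"
proof (rule eq_matI)
  fix i j assume "i < dim_row (mat_sum n n (\<lambda>(k, l). X $$ (k, l) \<cdot>\<^sub>m unitm n k l) ({..<n} \<times> {..<n}))"
    "j < dim_col (mat_sum n n (\<lambda>(k, l). X $$ (k, l) \<cdot>\<^sub>m unitm n k l) ({..<n} \<times> {..<n}))"
  then have ij: "i < n" "j < n" by auto
  have "mat_sum n n (\<lambda>(k, l). X $$ (k, l) \<cdot>\<^sub>m unitm n k l) ({..<n} \<times> {..<n}) $$ (i, j)
      = (\<Sum>x\<in>{..<n} \<times> {..<n}. if x = (i, j) then X $$ (i, j) else 0)"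
    unfolding index_mat_sum[OF ij] using ij by (intro sum.cong refl) (auto simp: unitm_def split: if_splits)
  also have "\<dots> = X $$ (i, j)" using ij by (simp add: sum.delta')
  finally show "X $$ (i, j) = mat_sum n n (\<lambda>(k, l). X $$ (k, l) \<cdot>\<^sub>m unitm n k l) ({..<n} \<times> {..<n}) $$ (i, j)" by simp
qed (use assms in auto)

text \<open>Matrix units of a tensor product are products of matrix units, and a coefficient can be
  absorbed into the first factor, so an additive property need only be checked on products.\<close>

lemma kron3_induct [consumes 1, case_names zero add kron]:
  assumes "X \<in> carrier_mat (a * (c * b)) (a * (c * b))"
    and "P (0\<^sub>m (a * (c * b)) (a * (c * b)))"
    and "\<And>X Y. X \<in> carrier_mat (a * (c * b)) (a * (c * b)) \<Longrightarrow> Y \<in> carrier_mat (a * (c * b)) (a * (c * b)) \<Longrightarrow>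
       P X \<Longrightarrow> P Y \<Longrightarrow> P (X + Y)"
    and "\<And>A C B. A \<in> carrier_mat a a \<Longrightarrow> C \<in> carrier_mat c c \<Longrightarrow> B \<in> carrier_mat b b \<Longrightarrow> P (kron A (kron C B))"
  shows "P X"
proof -
  let ?n = "a * (c * b)"
  have *: "P (x \<cdot>\<^sub>m unitm ?n k l)" if "k < ?n" "l < ?n" for x k l
  proof -
    have "k mod (c * b) < c * b" "l mod (c * b) < c * b" using that by (auto intro: mod_less_snd)
    then have "x \<cdot>\<^sub>m unitm ?n k l = kron (x \<cdot>\<^sub>m unitm a (k div (c * b)) (l div (c * b)))
        (kron (unitm c (k mod (c * b) div b) (l mod (c * b) div b)) (unitm b (k mod (c * b) mod b) (l mod (c * b) mod b)))"
      using that by (simp add: unitm_kron kron_smult)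
    then show ?thesis using assms(4) by simp
  qed
  show ?thesis
    by (subst mat_sum_unitm[OF assms(1)], rule mat_sum_induct[where P = P])
      (use assms(2,3) * in auto)
qed

definition ptranspose_mid :: "nat \<Rightarrow> nat \<Rightarrow> nat \<Rightarrow> complex mat \<Rightarrow> complex mat" where
  "ptranspose_mid a c b X = mat (a * (c * b)) (a * (c * b)) (\<lambda>(i, j).
     X $$ (i div (c * b) * (c * b) + (j mod (c * b) div b * b + i mod (c * b) mod b),
           j div (c * b) * (c * b) + (i mod (c * b) div b * b + j mod (c * b) mod b)))"

lemma ptranspose_mid_carrier [simp]: "ptranspose_mid a c b X \<in> carrier_mat (a * (c * b)) (a * (c * b))"
  by (auto simp: ptranspose_mid_def)

lemma dim_ptranspose_mid [simp]: "dim_row (ptranspose_mid a c b X) = a * (c * b)" "dim_col (ptranspose_mid a c b X) = a * (c * b)"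
  by (auto simp: ptranspose_mid_def)

lemma ptranspose_mid_index_less:
  assumes "i < a * (c * b)" "j < a * (c * (b::nat))"
  shows "i div (c * b) * (c * b) + (j mod (c * b) div b * b + i mod (c * b) mod b) < a * (c * b)"
proof -
  have l: "i mod (c * b) < c * b" "j mod (c * b) < c * b" using assms mod_less_snd by blast+
  show ?thesis
    using div_less_fst[OF assms(1)] div_less_fst[OF l(2)] mod_less_snd[OF l(1)] by (intro block_index)
qed

lemma index_ptranspose_mid:
  assumes "i0 < a" "i1 < c" "i2 < b" "j0 < a" "j1 < c" "j2 < b"
  shows "ptranspose_mid a c b X $$ (i0 * (c * b) + (i1 * b + i2), j0 * (c * b) + (j1 * b + j2)) =
    X $$ (i0 * (c * b) + (j1 * b + i2), j0 * (c * b) + (i1 * b + j2))"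
  using assms by (simp add: ptranspose_mid_def block_index block_div)

lemma index_split3:
  assumes "i < a * (c * (b::nat))"
  obtains i0 i1 i2 where "i0 < a" "i1 < c" "i2 < b" "i = i0 * (c * b) + (i1 * b + i2)"
proof
  have l: "i mod (c * b) < c * b" using mod_less_snd[OF assms] .
  show "i div (c * b) < a" "i mod (c * b) div b < c" "i mod (c * b) mod b < b"
    using div_less_fst[OF assms] div_less_fst[OF l] mod_less_snd[OF l] .
  show "i = i div (c * b) * (c * b) + (i mod (c * b) div b * b + i mod (c * b) mod b)"
    by (simp only: div_mult_mod_eq)
qed

lemma ptranspose_mid_zero [simp]: "ptranspose_mid a c b (0\<^sub>m (a * (c * b)) (a * (c * b))) = 0\<^sub>m (a * (c * b)) (a * (c * b))"
  by (rule eq_matI) (auto simp: ptranspose_mid_def ptranspose_mid_index_less)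

lemma ptranspose_mid_add:
  assumes "X \<in> carrier_mat (a * (c * b)) (a * (c * b))" "Y \<in> carrier_mat (a * (c * b)) (a * (c * b))"
  shows "ptranspose_mid a c b (X + Y) = ptranspose_mid a c b X + ptranspose_mid a c b Y"
  using assms by (intro eq_matI) (auto simp: ptranspose_mid_def ptranspose_mid_index_less)

lemma ptranspose_mid_mat_sum:
  "ptranspose_mid a c b (mat_sum (a * (c * b)) (a * (c * b)) f S) = mat_sum (a * (c * b)) (a * (c * b)) (\<lambda>x. ptranspose_mid a c b (f x)) S"
  by (intro eq_matI) (auto simp: ptranspose_mid_def ptranspose_mid_index_less)

lemma ptranspose_mid_kron:
  assumes "A \<in> carrier_mat a a" "C \<in> carrier_mat c c" "B \<in> carrier_mat b b"
  shows "ptranspose_mid a c b (kron A (kron C B)) = kron A (kron (transpose_mat C) B)"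
proof (rule eq_matI)
  fix i j assume "i < dim_row (kron A (kron (transpose_mat C) B))" "j < dim_col (kron A (kron (transpose_mat C) B))"
  then have "i < a * (c * b)" "j < a * (c * b)" using assms by auto
  then obtain i0 i1 i2 j0 j1 j2 where i: "i0 < a" "i1 < c" "i2 < b" "i = i0 * (c * b) + (i1 * b + i2)"
    and j: "j0 < a" "j1 < c" "j2 < b" "j = j0 * (c * b) + (j1 * b + j2)"
    using index_split3 by metis
  show "ptranspose_mid a c b (kron A (kron C B)) $$ (i, j) = kron A (kron (transpose_mat C) B) $$ (i, j)"
    unfolding i(4) j(4) using assms i(1-3) j(1-3)
    by (simp add: index_ptranspose_mid index_kron block_index block_div)
qed (use assms in auto)

definition mconj :: "complex mat \<Rightarrow> complex mat" where
  "mconj A = map_mat cnj A"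

lemma dim_mconj [simp]: "dim_row (mconj A) = dim_row A" "dim_col (mconj A) = dim_col A"
  by (auto simp: mconj_def)

lemma mconj_adjoint: "mat_adjoint (mconj A) = transpose_mat A" "mconj A = transpose_mat (mat_adjoint A)"
  "mat_adjoint (mconj A) = mconj (mat_adjoint A)"
  by (auto intro!: eq_matI simp: mconj_def)

lemma mconj_mult: "dim_col A = dim_row B \<Longrightarrow> mconj (A * B) = mconj A * mconj B"
  by (rule eq_matI) (auto simp: mconj_def index_mult_mat_sum simp del: index_mult_mat(1))

lemma mconj_mat_sum:
  assumes "\<And>x. x \<in> S \<Longrightarrow> f x \<in> carrier_mat n m"
  shows "mconj (mat_sum n m f S) = mat_sum n m (\<lambda>x. mconj (f x)) S"
proof (rule eq_matI)
  fix i j assume "i < dim_row (mat_sum n m (\<lambda>x. mconj (f x)) S)" "j < dim_col (mat_sum n m (\<lambda>x. mconj (f x)) S)"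
  then have ij: "i < n" "j < m" by auto
  have "mconj (f x) $$ (i, j) = cnj (f x $$ (i, j))" if "x \<in> S" for x
    using assms[OF that] ij by (simp add: mconj_def)
  then show "mconj (mat_sum n m f S) $$ (i, j) = mat_sum n m (\<lambda>x. mconj (f x)) S $$ (i, j)"
    using ij by (simp add: mconj_def)
qed auto

lemma mconj_one [simp]: "mconj (1\<^sub>m n) = 1\<^sub>m n"
  by (rule eq_matI) (auto simp: mconj_def)

lemma transpose_mult':
  fixes A B :: "complex mat"
  shows "dim_col A = dim_row B \<Longrightarrow> transpose_mat (A * B) = transpose_mat B * transpose_mat A"
  by (intro transpose_mult[of _ "dim_row A" "dim_row B" _ "dim_col B"]) auto

text \<open>Both sides are additive in X, so products suffice. There the middle factor obeys (C Q
  C^dagger)^T = conj(C) Q^T conj(C)^dagger, and the outer factors are untouched.\<close>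

lemma ptranspose_mid_conj:
  assumes "A \<in> carrier_mat a' a" "C \<in> carrier_mat c' c" "B \<in> carrier_mat b' b"
    and X: "X \<in> carrier_mat (a * (c * b)) (a * (c * b))"
  defines "L \<equiv> kron A (kron C B)" and "L' \<equiv> kron A (kron (mconj C) B)"
  shows "ptranspose_mid a' c' b' (L * X * mat_adjoint L) = L' * ptranspose_mid a c b X * mat_adjoint L'"
  using X
proof (induction rule: kron3_induct)
  case zero
  then show ?case using assms(1-3) by (simp add: L_def L'_def)
next
  case (add X Y)
  have "L * (X + Y) * mat_adjoint L = L * X * mat_adjoint L + L * Y * mat_adjoint L"
    using add assms(1-3) by (simp add: L_def mult_add_mat add_mult_mat)
  moreover have "ptranspose_mid a' c' b' \<dots> = ptranspose_mid a' c' b' (L * X * mat_adjoint L) + ptranspose_mid a' c' b' (L * Y * mat_adjoint L)"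
    using add assms(1-3) by (intro ptranspose_mid_add) (auto simp: L_def intro!: carrier_matI)
  ultimately show ?case
    using add assms(1-3) by (simp add: L'_def mult_add_mat add_mult_mat ptranspose_mid_add)
next
  case (kron P Q R)
  have "L * kron P (kron Q R) * mat_adjoint L =
      kron (A * P * mat_adjoint A) (kron (C * Q * mat_adjoint C) (B * R * mat_adjoint B))"
    using kron assms(1-3) by (simp add: L_def adjoint_kron kron_mult)
  moreover have "ptranspose_mid a' c' b' \<dots> =
      kron (A * P * mat_adjoint A) (kron (transpose_mat (C * Q * mat_adjoint C)) (B * R * mat_adjoint B))"
    using kron assms(1-3) by (intro ptranspose_mid_kron) (auto intro!: carrier_matI)
  moreover have "transpose_mat (C * Q * mat_adjoint C) = mconj C * transpose_mat Q * mat_adjoint (mconj C)"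
    using kron assms(1-3) by (simp add: transpose_mult' mult_assoc_mat mconj_adjoint(1) flip: mconj_adjoint(2))
  ultimately show ?case
    using kron assms(1-3) by (simp add: L'_def adjoint_kron kron_mult ptranspose_mid_kron)
qed

text \<open>The new protocol keeps the Kraus operators of Alice and Bob and conjugates those of
  Charlie entrywise; conjugating the completeness relation shows that they are again complete.
  Intermediate dimensions change from round to round, so a, c, b are generalised in the induction
  while the final dimensions stay fixed.\<close>

lemma locc_ptranspose_mid:
  "locc ds ds' \<Lambda> \<Longrightarrow> ds = [a, c, b] \<Longrightarrow> ds' = [a', c', b'] \<Longrightarrow>
    \<exists>\<Lambda>'. locc ds ds' \<Lambda>' \<and>
      (\<forall>X\<in>carrier_mat (a * (c * b)) (a * (c * b)). ptranspose_mid a' c' b' (\<Lambda> X) = \<Lambda>' (ptranspose_mid a c b X))"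
proof (induction arbitrary: a c b rule: locc.induct)
  case (stop ds)
  then show ?case by (intro exI[of _ "\<lambda>X. X"]) (auto intro: locc.stop)
next
  case (round p ds r K ds' \<Lambda>)
  define K' where "K' i = (if p = 1 then mconj (K i) else K i)" for i
  have dK: "dim_row (K' i) = dim_row (K i)" "dim_col (K' i) = dim_col (K i)" for i
    by (auto simp: K'_def)
  \<comment> \<open>The three local dimensions after outcome i; only that of the acting party
    changes.\<close>
  define e where "e i = (if p = 0 then dim_row (K i) else a, if p = 1 then dim_row (K i) else c, if p = 2 then dim_row (K i) else b)" for i
  have pl: "prod_list ds' = a' * (c' * b')" using round.prems by simp
  have p: "p = 0 \<or> p = 1 \<or> p = 2" using round by (auto simp: less_Suc_eq)
  have upd: "ds[p := dim_row (K i)] = [fst (e i), fst (snd (e i)), snd (snd (e i))]" for i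
    using p round.prems by (auto simp: e_def)
  have "\<forall>i\<in>{..<r}. \<exists>\<Lambda>'. locc (ds[p := dim_row (K i)]) ds' \<Lambda>' \<and>
     (\<forall>X\<in>carrier_mat (prod_list (ds[p := dim_row (K i)])) (prod_list (ds[p := dim_row (K i)])).
       ptranspose_mid a' c' b' (\<Lambda> i X) = \<Lambda>' (ptranspose_mid (fst (e i)) (fst (snd (e i))) (snd (snd (e i))) X))"
    using round.IH[OF _ upd round.prems(2)] unfolding upd by simp
  then obtain \<Lambda>' where \<Lambda>': "\<And>i. i < r \<Longrightarrow> locc (ds[p := dim_row (K i)]) ds' (\<Lambda>' i)"
     "\<And>i X. i < r \<Longrightarrow> X \<in> carrier_mat (prod_list (ds[p := dim_row (K i)])) (prod_list (ds[p := dim_row (K i)])) \<Longrightarrow>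
       ptranspose_mid a' c' b' (\<Lambda> i X) = \<Lambda>' i (ptranspose_mid (fst (e i)) (fst (snd (e i))) (snd (snd (e i))) X)"
    unfolding bchoice_iff by auto
  have c: "mat_sum (ds ! p) (ds ! p) (\<lambda>i. mat_adjoint (K' i) * K' i) {..<r} = 1\<^sub>m (ds ! p)"
  proof (cases "p = 1")
    case True
    have "mat_sum (ds ! p) (ds ! p) (\<lambda>i. mat_adjoint (K' i) * K' i) {..<r}
       = mat_sum (ds ! p) (ds ! p) (\<lambda>i. mconj (mat_adjoint (K i) * K i)) {..<r}"
      using True by (intro mat_sum_cong) (simp add: K'_def mconj_mult mconj_adjoint(3))
    also have "\<dots> = mconj (mat_sum (ds ! p) (ds ! p) (\<lambda>i. mat_adjoint (K i) * K i) {..<r})"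
      using round(2) by (intro mconj_mat_sum[symmetric]) auto
    finally show ?thesis using round(3) by simp
  next
    case False
    then show ?thesis using round(3) by (simp add: K'_def)
  qed
  let ?\<Lambda> = "\<lambda>X. mat_sum (prod_list ds') (prod_list ds')
            (\<lambda>i. \<Lambda>' i (local_op ds p (K' i) * X * mat_adjoint (local_op ds p (K' i)))) {..<r}"
  have "locc ds ds' ?\<Lambda>"
    using round(1,2) c \<Lambda>'(1) by (intro locc.round) (auto simp: dK)
  moreover have "ptranspose_mid a' c' b' (mat_sum (prod_list ds') (prod_list ds')
            (\<lambda>i. \<Lambda> i (local_op ds p (K i) * X * mat_adjoint (local_op ds p (K i)))) {..<r}) = ?\<Lambda> (ptranspose_mid a c b X)"
    if X: "X \<in> carrier_mat (a * (c * b)) (a * (c * b))" for X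
  proof -
    have "ptranspose_mid a' c' b' (\<Lambda> i (local_op ds p (K i) * X * mat_adjoint (local_op ds p (K i))))
       = \<Lambda>' i (local_op ds p (K' i) * ptranspose_mid a c b X * mat_adjoint (local_op ds p (K' i)))" if i: "i < r" for i
    proof -
      obtain A C B where ACB: "A \<in> carrier_mat (fst (e i)) a" "C \<in> carrier_mat (fst (snd (e i))) c" "B \<in> carrier_mat (snd (snd (e i))) b"
        "local_op ds p (K i) = kron A (kron C B)" "local_op ds p (K' i) = kron A (kron (mconj C) B)"
      proof -
        define A where "A = (if p = 0 then K i else 1\<^sub>m a)"
        define C where "C = (if p = 1 then K i else 1\<^sub>m c)"
        define B where "B = (if p = 2 then K i else 1\<^sub>m b)"
        show thesis
          by (rule that[of A C B])
           (use p round(2)[OF i] round.prems in \<open>auto simp: A_def B_def C_def e_def K'_def local_op_def kron_one[symmetric] kron_assoc\<close>)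
      qed
      have "local_op ds p (K i) * X * mat_adjoint (local_op ds p (K i)) \<in>
          carrier_mat (prod_list (ds[p := dim_row (K i)])) (prod_list (ds[p := dim_row (K i)]))"
        using dim_local_op[OF round(1) round(2)[OF i]] by (intro carrier_matI) auto
      from \<Lambda>'(2)[OF i this] show ?thesis
        unfolding ACB(4,5) ptranspose_mid_conj[OF ACB(1-3) X] .
    qed
    then show ?thesis
      unfolding pl ptranspose_mid_mat_sum by (intro mat_sum_cong) auto
  qed
  ultimately show ?case by blast
qed

section \<open>The partial trace as a protocol\<close>

lemma block_eq_iff: "v < n \<Longrightarrow> v' < n \<Longrightarrow> u * n + v = u' * n + v' \<longleftrightarrow> u = u' \<and> v = (v'::nat)"
  by (metis block_div)

text \<open>Each row of L has a single 1, so conjugation by L reads off entries. The Kraus operators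
  of a partial trace have this form.\<close>

lemma selector_conj:
  assumes "X \<in> carrier_mat n n" "\<And>i. i < m \<Longrightarrow> \<pi> i < n" "i < m" "j < m"
  defines "L \<equiv> mat m n (\<lambda>(i, j). if j = \<pi> i then 1 else (0::complex))"
  shows "(L * X * mat_adjoint L) $$ (i, j) = X $$ (\<pi> i, \<pi> j)"
proof -
  have "(L * X) $$ (i, l) = X $$ (\<pi> i, l)" if "l < n" for l
    using assms(1-4) that by (simp add: L_def index_mult_mat_sum if_distrib[of "\<lambda>x. x * _"] cong: if_cong del: index_mult_mat(1))
  then have "(L * X * mat_adjoint L) $$ (i, j) = (\<Sum>l<n. X $$ (\<pi> i, l) * (if l = \<pi> j then 1 else 0))"
  proof -
    have d: "dim_row L = m" "dim_col L = n" by (auto simp: L_def)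
    have "(L * X * mat_adjoint L) $$ (i, j) = (\<Sum>l<n. (L * X) $$ (i, l) * mat_adjoint L $$ (l, j))"
      using assms(1-4) d by (subst index_mult_mat_sum) auto
    moreover have "mat_adjoint L $$ (l, j) = (if l = \<pi> j then 1 else 0)" if "l < n" for l
      using assms(4) that d by (simp add: L_def)
    ultimately show ?thesis using \<open>\<And>l. l < n \<Longrightarrow> (L * X) $$ (i, l) = X $$ (\<pi> i, l)\<close> by simp
  qed
  also have "\<dots> = X $$ (\<pi> i, \<pi> j)"
    using assms(1-4) by (simp add: if_distrib[of "(*) _"] cong: if_cong)
  finally show ?thesis .
qed

text \<open>Discarding the middle system is a measurement whose outcome is ignored.\<close>

lemma ptrace_mid_locc:
  "\<exists>T. locc [a, c, b] [a, 1, b] T \<and> (\<forall>X\<in>carrier_mat (a * (c * b)) (a * (c * b)). T X = ptrace_mid a c b X)"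
proof -
  define K where "K k = (mat 1 c (\<lambda>(i, j). if j = k then 1 else 0) :: complex mat)" for k
  define T where "T X = mat_sum (prod_list [a, 1, b]) (prod_list [a, 1, b])
       (\<lambda>k. (\<lambda>X. X) (local_op [a, c, b] 1 (K k) * X * mat_adjoint (local_op [a, c, b] 1 (K k)))) {..<c}" for X
  have "locc [a, c, b] [a, 1, b] T"
    unfolding T_def
  proof (rule locc.round)
    show "mat_sum ([a, c, b] ! 1) ([a, c, b] ! 1) (\<lambda>k. mat_adjoint (K k) * K k) {..<c} = 1\<^sub>m ([a, c, b] ! 1)"
    proof (rule eq_matI)
      fix i j assume "i < dim_row (1\<^sub>m ([a, c, b] ! 1) :: complex mat)" "j < dim_col (1\<^sub>m ([a, c, b] ! 1) :: complex mat)"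
      then have ij: "i < c" "j < c" by auto
      have "(mat_adjoint (K k) * K k) $$ (i, j) = (if i = k then if j = k then 1 else 0 else 0)" for k
        using ij by (simp add: index_mult_mat_sum K_def del: index_mult_mat(1))
      then show "mat_sum ([a, c, b] ! 1) ([a, c, b] ! 1) (\<lambda>k. mat_adjoint (K k) * K k) {..<c} $$ (i, j)
          = 1\<^sub>m ([a, c, b] ! 1) $$ (i, j)"
        using ij by simp
    qed auto
    show "locc ([a, c, b][1 := dim_row (K k)]) [a, 1, b] (\<lambda>X. X)" for k
      using locc.stop[of "[a, 1, b]"] by (simp add: K_def)
  qed (auto simp: K_def)
  moreover have "T X = ptrace_mid a c b X" if X: "X \<in> carrier_mat (a * (c * b)) (a * (c * b))" for X
  proof (rule eq_matI)
    fix i j assume "i < dim_row (ptrace_mid a c b X)" "j < dim_col (ptrace_mid a c b X)"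
    then have ij: "i < a * b" "j < a * b" by (auto simp: ptrace_mid_def)
    define \<pi> where "\<pi> k i = i div b * (c * b) + (k * b + i mod b)" for k i :: nat
    have \<pi>: "\<pi> k i < a * (c * b)" if "i < a * b" "k < c" for i k
      unfolding \<pi>_def using that div_less_fst[of i a b] mod_less_snd[of i a b] by (intro block_index) auto
    have L: "local_op [a, c, b] 1 (K k) = mat (a * b) (a * (c * b)) (\<lambda>(i, j). if j = \<pi> k i then 1 else 0)" if k: "k < c" for k
    proof (rule eq_matI)
      fix i j assume "i < dim_row (mat (a * b) (a * (c * b)) (\<lambda>(i, j). if j = \<pi> k i then 1 else (0::complex)))"
        "j < dim_col (mat (a * b) (a * (c * b)) (\<lambda>(i, j). if j = \<pi> k i then 1 else (0::complex)))"
      then have i: "i < a * b" and j: "j < a * (c * b)" by auto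
      note i' = div_less_fst[OF i] mod_less_snd[OF i]
      obtain j0 j1 j2 where j': "j0 < a" "j1 < c" "j2 < b" "j = j0 * (c * b) + (j1 * b + j2)"
        using index_split3[OF j] .
      have "local_op [a, c, b] 1 (K k) $$ (i, j) = (if j0 = i div b \<and> j1 = k \<and> j2 = i mod b then 1 else 0)"
        unfolding j'(4) using i i' j'(1-3)
        by (simp add: local_op_def index_kron K_def block_index block_div)
      also have "(j0 = i div b \<and> j1 = k \<and> j2 = i mod b) \<longleftrightarrow> j = \<pi> k i"
        unfolding j'(4) \<pi>_def using i' j'(1-3) k by (simp add: block_eq_iff block_index)
      finally show "local_op [a, c, b] 1 (K k) $$ (i, j) =
          mat (a * b) (a * (c * b)) (\<lambda>(i, j). if j = \<pi> k i then 1 else 0) $$ (i, j)"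
        using i j by simp
    qed (auto simp: local_op_def K_def)
    have "T X $$ (i, j) = (\<Sum>k<c. (local_op [a, c, b] 1 (K k) * X * mat_adjoint (local_op [a, c, b] 1 (K k))) $$ (i, j))"
      unfolding T_def using ij by (subst index_mat_sum) auto
    also have "\<dots> = (\<Sum>k<c. X $$ (\<pi> k i, \<pi> k j))"
    proof (intro sum.cong refl)
      fix k assume "k \<in> {..<c}"
      then have k: "k < c" by simp
      show "(local_op [a, c, b] 1 (K k) * X * mat_adjoint (local_op [a, c, b] 1 (K k))) $$ (i, j) = X $$ (\<pi> k i, \<pi> k j)"
        unfolding L[OF k] using X \<pi>[OF _ k] ij by (rule selector_conj)
    qed
    also have "\<dots> = ptrace_mid a c b X $$ (i, j)"
      using ij by (simp add: ptrace_mid_def \<pi>_def algebra_simps)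
    finally show "T X $$ (i, j) = ptrace_mid a c b X $$ (i, j)" .
  qed (auto simp: T_def ptrace_mid_def)
  ultimately show ?thesis by blast
qed

lemma channel_ptrace_mid: "channel (a * (c * b)) (a * b) (ptrace_mid a c b)"
proof -
  obtain T where T: "locc [a, c, b] [a, 1, b] T"
    "\<And>X. X \<in> carrier_mat (a * (c * b)) (a * (c * b)) \<Longrightarrow> T X = ptrace_mid a c b X"
    using ptrace_mid_locc by metis
  from locc_channel[OF T(1)] have "channel (a * (c * b)) (a * b) T" by simp
  then show ?thesis using T(2) by (simp add: channel_def)
qed

lemma sep_cone_ptrace_mid:
  assumes "sep_cone a (c * b) X"
  shows "sep_cone a b (ptrace_mid a c b X)"
proof -
  obtain T where T: "locc [a, c, b] [a, 1, b] T"
    "\<And>X. X \<in> carrier_mat (a * (c * b)) (a * (c * b)) \<Longrightarrow> T X = ptrace_mid a c b X"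
    using ptrace_mid_locc by metis
  show ?thesis using locc_sepc[OF T(1), of X] assms T(2)[OF sep_cone_carrier[OF assms]] by simp
qed

text \<open>The partial trace only sees entries whose row and column agree in the middle digit, and
  these are fixed by the transposition.\<close>

lemma ptrace_mid_ptranspose_mid: "ptrace_mid a c b (ptranspose_mid a c b X) = ptrace_mid a c b X"
proof (rule eq_matI)
  fix i j assume "i < dim_row (ptrace_mid a c b X)" "j < dim_col (ptrace_mid a c b X)"
  then have ij: "i < a * b" "j < a * b" by (auto simp: ptrace_mid_def)
  have "ptranspose_mid a c b X $$ ((i div b * c + k) * b + i mod b, (j div b * c + k) * b + j mod b) =
      X $$ ((i div b * c + k) * b + i mod b, (j div b * c + k) * b + j mod b)" if "k < c" for k
    using index_ptranspose_mid[of "i div b" a k c "i mod b" b "j div b" k "j mod b" X]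
      div_less_fst[OF ij(1)] mod_less_snd[OF ij(1)] div_less_fst[OF ij(2)] mod_less_snd[OF ij(2)] that
    by (simp add: add_mult_distrib mult.assoc add.assoc)
  then show "ptrace_mid a c b (ptranspose_mid a c b X) $$ (i, j) = ptrace_mid a c b X $$ (i, j)"
    using ij by (simp add: ptrace_mid_def)
qed (auto simp: ptrace_mid_def)

text \<open>Pinching in the basis of the first factor: the difference \<open>a E - Y\<close> is
  \<open>(1/2) \<Sum> (P i - P j) Y (P i - P j)\<close>, where \<open>P i\<close> projects onto the block \<open>i\<close>.\<close>

lemma index_rdiag_conj:
  assumes "Y \<in> carrier_mat n n" "k < n" "l < n"
  shows "(rdiag n f * Y * mat_adjoint (rdiag n f)) $$ (k, l) = complex_of_real (f k * f l) * Y $$ (k, l)"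
proof -
  have "(rdiag n f * Y) $$ (k, l) = complex_of_real (f k) * Y $$ (k, l)"
    using assms by (simp add: index_mult_mat_sum rdiag_def if_distrib[of "\<lambda>x. x * _"] cong: if_cong del: index_mult_mat(1))
  then show ?thesis using assms by (simp add: index_mult_rdiag mult_ac del: index_mult_mat(1))
qed

lemma pinching:
  assumes "psd Y" "Y \<in> carrier_mat (a * r) (a * r)"
  obtains E where "sep_cone a r E" "mat_trace E = mat_trace Y" "psd (complex_of_real (real a) \<cdot>\<^sub>m E - Y)"
proof
  let ?n = "a * r"
  \<comment> \<open>E is the block-diagonal part of Y. It is separable as the sum of the products of
    |i><i| with the i-th diagonal block \<open>Z i\<close> of Y.\<close>
  define E where "E = mat ?n ?n (\<lambda>(k, l). if k div r = l div r then Y $$ (k, l) else 0)"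
  define Z where "Z i = mat r r (\<lambda>(k, l). Y $$ (i * r + k, i * r + l))" for i
  have "unitm a i i = 1\<^sub>m a * rdiag a (\<lambda>k. if k = i then 1 else 0) * mat_adjoint (1\<^sub>m a)" for i
    by (simp, rule eq_matI) (auto simp: unitm_def rdiag_def)
  then have unit: "psd (unitm a i i)" for i
    using psd_rdiag_conj[of "1\<^sub>m a" a "\<lambda>k. if k = i then 1 else 0"] by (metis index_one_mat(3) order_refl zero_le_one)
  have "sep_cone a r (mat_sum ?n ?n (\<lambda>i. kron (unitm a i i) (Z i)) {..<a})"
  proof (rule sep_cone_mat_sum)
    fix i assume "i \<in> {..<a}"
    then have "psd (Z i)"
      unfolding Z_def using block_index[of i a _ r] by (intro psd_reindex[OF assms]) auto
    then show "sep_cone a r (kron (unitm a i i) (Z i))"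
      using unit by (intro sep_cone_kron) (auto simp: Z_def)
  qed auto
  also have "mat_sum ?n ?n (\<lambda>i. kron (unitm a i i) (Z i)) {..<a} = E"
  proof (rule eq_matI)
    fix k l assume "k < dim_row E" "l < dim_col E"
    then have kl: "k < ?n" "l < ?n" by (auto simp: E_def)
    note b = div_less_fst[OF kl(1)] mod_less_snd[OF kl(1)] div_less_fst[OF kl(2)] mod_less_snd[OF kl(2)]
    have "kron (unitm a i i) (Z i) $$ (k, l) = (if i = k div r then if k div r = l div r then Y $$ (k, l) else 0 else 0)" for i
      using kl b by (auto simp: index_kron unitm_def Z_def)
    then show "mat_sum ?n ?n (\<lambda>i. kron (unitm a i i) (Z i)) {..<a} $$ (k, l) = E $$ (k, l)"
      using kl b by (simp add: E_def)
  qed (auto simp: E_def)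
  finally show "sep_cone a r E" .
  show "mat_trace E = mat_trace Y"
    using assms(2) by (simp add: mat_trace_def E_def)
  \<comment> \<open>The diagonal of P i - P j.\<close>
  define f where "f = (\<lambda>(i, j) k. of_bool (k div r = i) - of_bool (k div r = j) :: real)"
  let ?D = "\<lambda>x. rdiag ?n (f x) * Y * mat_adjoint (rdiag ?n (f x))"
  have "psd (mat_sum ?n ?n ?D ({..<a} \<times> {..<a}))"
    using assms by (intro psd_mat_sum psd_conj) (auto intro!: carrier_matI)
  then have "psd (complex_of_real (1/2) \<cdot>\<^sub>m mat_sum ?n ?n ?D ({..<a} \<times> {..<a}))"
    by (rule psd_smult) simp
  also have "complex_of_real (1/2) \<cdot>\<^sub>m mat_sum ?n ?n ?D ({..<a} \<times> {..<a}) = complex_of_real (real a) \<cdot>\<^sub>m E - Y"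
  proof (rule eq_matI)
    fix k l assume "k < dim_row (complex_of_real (real a) \<cdot>\<^sub>m E - Y)" "l < dim_col (complex_of_real (real a) \<cdot>\<^sub>m E - Y)"
    then have kl: "k < ?n" "l < ?n" using assms by auto
    note b = div_less_fst[OF kl(1)] div_less_fst[OF kl(2)]
    have "(\<Sum>x\<in>{..<a} \<times> {..<a}. f x k * f x l) =
        (\<Sum>i<a. \<Sum>j<a. of_bool (k div r = i) * of_bool (l div r = i) + of_bool (k div r = j) * of_bool (l div r = j)
           - of_bool (k div r = i) * of_bool (l div r = j) - of_bool (k div r = j) * of_bool (l div r = i))"
      unfolding f_def sum.cartesian_product by (intro sum.cong refl) (clarsimp simp: algebra_simps)
    \<comment> \<open>Of the four sums over pairs, the first two are each a if k and l lie in the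
      same block and 0 otherwise; the last two are always 1 each. Halved, this is the coefficient a
      - 1 inside the blocks and -1 outside, as in a E - Y.\<close>
    also have "\<dots> = 2 * real a * of_bool (k div r = l div r) - 2"
    proof -
      have o: "(\<Sum>i<a. of_bool (u = i) * g i) = (g u :: real)" if "u < a" for u g
        using that by (simp add: of_bool_def if_distrib[of "\<lambda>x. x * _"] cong: if_cong)
      have o1: "(\<Sum>i<a. of_bool (u = i)) = (1 :: real)" if "u < a" for u
        using o[OF that, of "\<lambda>_. 1"] by simp
      show ?thesis
        using b by (simp add: sum.distrib sum_subtractf o o1 flip: sum_distrib_left sum_distrib_right)
    qed
    finally have s: "(\<Sum>x\<in>{..<a} \<times> {..<a}. f x k * f x l) = 2 * real a * of_bool (k div r = l div r) - 2" .
    have "mat_sum ?n ?n ?D ({..<a} \<times> {..<a}) $$ (k, l) = (\<Sum>x\<in>{..<a} \<times> {..<a}. complex_of_real (f x k * f x l) * Y $$ (k, l))"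
      unfolding index_mat_sum[OF kl] by (intro sum.cong refl index_rdiag_conj[OF assms(2) kl])
    also have "\<dots> = complex_of_real (2 * real a * of_bool (k div r = l div r) - 2) * Y $$ (k, l)"
      unfolding s[symmetric] by (simp add: sum_distrib_right)
    finally show "(complex_of_real (1/2) \<cdot>\<^sub>m mat_sum ?n ?n ?D ({..<a} \<times> {..<a})) $$ (k, l) =
        (complex_of_real (real a) \<cdot>\<^sub>m E - Y) $$ (k, l)"
      using kl assms(2) by (cases "k div r = l div r")
        (simp_all add: E_def field_simps del: index_mult_mat(1) index_mat_sum)
  qed (use assms in \<open>auto simp: E_def\<close>)
  finally show "psd (complex_of_real (real a) \<cdot>\<^sub>m E - Y)" .
qed

section \<open>Partial transposes of the input states\<close>

text \<open>Charlie holds the second factor of the first state and the first factor of the second,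
  so transposing his system performs exactly the two partial transpositions that the hypotheses of
  \<open>theorem2\<close> speak of.\<close>

lemma ptranspose_mid_kron_states:
  assumes "X \<in> carrier_mat (d * d) (d * d)" "Y \<in> carrier_mat (d * d) (d * d)"
  shows "ptranspose_mid d (d * d) d (kron X Y) = kron (ptranspose_snd d d X) (ptranspose_fst d d Y)"
proof (rule eq_matI)
  fix i j assume "i < dim_row (kron (ptranspose_snd d d X) (ptranspose_fst d d Y))"
    "j < dim_col (kron (ptranspose_snd d d X) (ptranspose_fst d d Y))"
  then have "i < d * (d * d * d)" "j < d * (d * d * d)" by (auto simp: ptranspose_snd_def ptranspose_fst_def mult.assoc)
  then obtain i0 u i3 j0 v j3 where i: "i0 < d" "u < d * d" "i3 < d" "i = i0 * (d * d * d) + (u * d + i3)"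
    and j: "j0 < d" "v < d * d" "j3 < d" "j = j0 * (d * d * d) + (v * d + j3)"
    using index_split3 by metis
  obtain i1 i2 where u: "i1 < d" "i2 < d" "u = i1 * d + i2"
    using div_less_fst[OF i(2)] mod_less_snd[OF i(2)] that[of "u div d" "u mod d"] by simp
  obtain j1 j2 where v: "j1 < d" "j2 < d" "v = j1 * d + j2"
    using div_less_fst[OF j(2)] mod_less_snd[OF j(2)] that[of "v div d" "v mod d"] by simp
  \<comment> \<open>Regroups the four base-d digits from the cut A : CA CB : B to the cut A CA : CB
    B.\<close>
  have e: "p * (d * d * d) + ((q * d + r) * d + s) = (p * d + q) * (d * d) + (r * d + s)" for p q r s
    by (simp add: algebra_simps)
  have "ptranspose_mid d (d * d) d (kron X Y) $$ (i, j) = kron X Y $$ (i0 * (d * d * d) + (v * d + i3), j0 * (d * d * d) + (u * d + j3))"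
    unfolding i(4) j(4) using i(1-3) j(1-3) by (rule index_ptranspose_mid)
  also have "\<dots> = X $$ (i0 * d + j1, j0 * d + i1) * Y $$ (j2 * d + i3, i2 * d + j3)"
    unfolding u(3) v(3) e using assms i(1,3) j(1,3) u(1,2) v(1,2)
    by (simp add: index_kron block_index block_div)
  also have "\<dots> = kron (ptranspose_snd d d X) (ptranspose_fst d d Y) $$ (i, j)"
    unfolding i(4) j(4) unfolding u(3) v(3) e using assms i(1,3) j(1,3) u(1,2) v(1,2)
    by (simp add: index_kron ptranspose_snd_def ptranspose_fst_def block_index block_div)
  finally show "ptranspose_mid d (d * d) d (kron X Y) $$ (i, j) = kron (ptranspose_snd d d X) (ptranspose_fst d d Y) $$ (i, j)" .
qed (auto simp: ptranspose_snd_def ptranspose_fst_def)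

lemma ptranspose_carrier [simp]:
  "ptranspose_snd a b X \<in> carrier_mat (a * b) (a * b)" "ptranspose_fst a b X \<in> carrier_mat (a * b) (a * b)"
  by (auto simp: ptranspose_snd_def ptranspose_fst_def)

lemma dim_ptranspose [simp]:
  "dim_row (ptranspose_snd a b X) = a * b" "dim_col (ptranspose_snd a b X) = a * b"
  "dim_row (ptranspose_fst a b X) = a * b" "dim_col (ptranspose_fst a b X) = a * b"
  by (auto simp: ptranspose_snd_def ptranspose_fst_def)

lemma trace_ptranspose:
  assumes "X \<in> carrier_mat (a * b) (a * b)"
  shows "mat_trace (ptranspose_snd a b X) = mat_trace X" "mat_trace (ptranspose_fst a b X) = mat_trace X"
  using assms by (auto simp: mat_trace_def ptranspose_snd_def ptranspose_fst_def)

lemma ptranspose_index_less: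
  assumes "i < a * b" "j < a * (b::nat)"
  shows "i div b * b + j mod b < a * b"
  using assms div_less_fst[OF assms(1)] mod_less_snd[OF assms(2)] by (intro block_index)

lemma adjoint_ptranspose:
  assumes "X \<in> carrier_mat (a * b) (a * b)" "mat_adjoint X = X"
  shows "mat_adjoint (ptranspose_snd a b X) = ptranspose_snd a b X"
    "mat_adjoint (ptranspose_fst a b X) = ptranspose_fst a b X"
proof -
  have X: "cnj (X $$ (j, i)) = X $$ (i, j)" if "i < a * b" "j < a * b" for i j
    using arg_cong[OF assms(2), of "\<lambda>A. A $$ (i, j)"] assms(1) that by simp
  show "mat_adjoint (ptranspose_snd a b X) = ptranspose_snd a b X"
    "mat_adjoint (ptranspose_fst a b X) = ptranspose_fst a b X"
    by (auto intro!: eq_matI simp: ptranspose_snd_def ptranspose_fst_def X ptranspose_index_less)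
qed

text \<open>For self-adjoint A the transpose is the entrywise conjugate, and conjugating a Gram
  factor gives a Gram factor.\<close>

lemma psd_transpose:
  assumes "psd A"
  shows "psd (transpose_mat A)"
proof -
  obtain M k where M: "M \<in> carrier_mat (dim_row A) k" "A = M * mat_adjoint M"
    using psd_factor[OF assms] psd_dim[OF assms] by (metis carrier_matI)
  have "transpose_mat A = mconj (mat_adjoint A)" by (simp add: mconj_adjoint(2))
  also have "\<dots> = mconj M * mat_adjoint (mconj M)"
    unfolding psd_adjoint[OF assms] M(2) using M by (simp add: adjoint_mult mconj_mult mconj_adjoint(3))
  finally show ?thesis using psd_gram' by metis
qed

lemma ptranspose_mat_sum:
  "ptranspose_snd a b (mat_sum (a * b) (a * b) f S) = mat_sum (a * b) (a * b) (\<lambda>x. ptranspose_snd a b (f x)) S"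
  "ptranspose_fst a b (mat_sum (a * b) (a * b) f S) = mat_sum (a * b) (a * b) (\<lambda>x. ptranspose_fst a b (f x)) S"
  by (auto intro!: eq_matI simp: ptranspose_snd_def ptranspose_fst_def ptranspose_index_less)

lemma ptranspose_kron:
  assumes "A \<in> carrier_mat a a" "B \<in> carrier_mat b b"
  shows "ptranspose_snd a b (c \<cdot>\<^sub>m kron A B) = c \<cdot>\<^sub>m kron A (transpose_mat B)"
    "ptranspose_fst a b (c \<cdot>\<^sub>m kron A B) = c \<cdot>\<^sub>m kron (transpose_mat A) B"
  using assms by (auto intro!: eq_matI simp: ptranspose_snd_def ptranspose_fst_def ptranspose_index_less index_kron
      div_less_fst mod_less_snd block_div)

text \<open>Transposing one factor of a product of states leaves a product of positive operators.
  This is what separability is for: the partial transposes remain separable inputs for the modified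
  protocol.\<close>

lemma separable_state_ptranspose:
  assumes "separable_state a b X"
  shows "sep_cone a b (ptranspose_snd a b X)" "sep_cone a b (ptranspose_fst a b X)"
    "mat_trace (ptranspose_snd a b X) = 1" "mat_trace (ptranspose_fst a b X) = 1"
    "X \<in> carrier_mat (a * b) (a * b)" "psd X"
proof -
  obtain r :: nat and p \<alpha> \<beta> where *: "\<forall>i<r. 0 \<le> p i \<and> state a (\<alpha> i) \<and> state b (\<beta> i)" and p2: "sum p {..<r} = 1"
    and X: "X = mat_sum (a * b) (a * b) (\<lambda>i. complex_of_real (p i) \<cdot>\<^sub>m kron (\<alpha> i) (\<beta> i)) {..<r}"
    using assms unfolding separable_state_def by blast
  have p: "\<And>i. i < r \<Longrightarrow> 0 \<le> p i" and st: "\<And>i. i < r \<Longrightarrow> state a (\<alpha> i)" "\<And>i. i < r \<Longrightarrow> state b (\<beta> i)"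
    using * by auto
  have ab: "\<alpha> i \<in> carrier_mat a a" "\<beta> i \<in> carrier_mat b b" "psd (\<alpha> i)" "psd (\<beta> i)" "mat_trace (\<alpha> i) = 1" "mat_trace (\<beta> i) = 1"
    if "i < r" for i using st[OF that] by (auto simp: state_def)
  show "sep_cone a b (ptranspose_snd a b X)"
    unfolding X ptranspose_mat_sum
  proof (rule sep_cone_mat_sum)
    fix i assume "i \<in> {..<r}"
    then show "sep_cone a b (ptranspose_snd a b (complex_of_real (p i) \<cdot>\<^sub>m kron (\<alpha> i) (\<beta> i)))"
      using ab[of i] p[of i] by (simp add: ptranspose_kron sep_cone_smult sep_cone_kron psd_transpose)
  qed auto
  show "sep_cone a b (ptranspose_fst a b X)"
    unfolding X ptranspose_mat_sum
  proof (rule sep_cone_mat_sum)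
    fix i assume "i \<in> {..<r}"
    then show "sep_cone a b (ptranspose_fst a b (complex_of_real (p i) \<cdot>\<^sub>m kron (\<alpha> i) (\<beta> i)))"
      using ab[of i] p[of i] by (simp add: ptranspose_kron sep_cone_smult sep_cone_kron psd_transpose)
  qed auto
  have "sep_cone a b X" unfolding X
  proof (rule sep_cone_mat_sum)
    fix i assume "i \<in> {..<r}"
    then show "sep_cone a b (complex_of_real (p i) \<cdot>\<^sub>m kron (\<alpha> i) (\<beta> i))"
      using ab[of i] p[of i] by (simp add: sep_cone_smult sep_cone_kron)
  qed auto
  then show c: "X \<in> carrier_mat (a * b) (a * b)" and "psd X"
    using sep_cone_carrier sep_cone_psd by auto
  have "mat_trace X = (\<Sum>i<r. mat_trace (complex_of_real (p i) \<cdot>\<^sub>m kron (\<alpha> i) (\<beta> i)))"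
    unfolding X by (intro trace_mat_sum smult_carrier_mat kron_carrier) (auto simp: ab)
  also have "\<dots> = (\<Sum>i<r. complex_of_real (p i))"
  proof (intro sum.cong refl)
    fix i assume "i \<in> {..<r}"
    then show "mat_trace (complex_of_real (p i) \<cdot>\<^sub>m kron (\<alpha> i) (\<beta> i)) = complex_of_real (p i)"
      using ab[of i] by (simp add: trace_smult trace_kron)
  qed
  also have "\<dots> = 1" using p2 by (metis of_real_1 of_real_sum)
  finally have "mat_trace X = 1" .
  then show "mat_trace (ptranspose_snd a b X) = 1" "mat_trace (ptranspose_fst a b X) = 1"
    using trace_ptranspose[OF c] by simp_all
qed

text \<open>The cut runs inside X: Alice holds the first factor of X, and the whole operator Y goes
  to the other side.\<close>

lemma sep_cone_kron_right:
  assumes "sep_cone a b X" "psd Y" "Y \<in> carrier_mat n n"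
  shows "sep_cone a (b * n) (kron X Y)"
  using assms(1)
proof (induction rule: sep_cone.induct)
  case sep_cone_zero
  then show ?case using sep_cone.sep_cone_zero[of a "b * n"] assms(3) by (simp add: mult.assoc)
next
  case (sep_cone_step P Q X)
  have "kron (kron P Q + X) Y = kron P (kron Q Y) + kron X Y"
    using sep_cone_step sep_cone_carrier[of a b X] by (simp add: kron_add kron_assoc)
  then show ?case
    using sep_cone_step assms(2,3) by (auto intro!: sep_cone.sep_cone_step psd_kron)
qed

section \<open>Testing a private state\<close>

lemma adjoint_mat_sum:
  assumes "\<And>x. x \<in> S \<Longrightarrow> f x \<in> carrier_mat n m"
  shows "mat_adjoint (mat_sum n m f S) = mat_sum m n (\<lambda>x. mat_adjoint (f x)) S"
proof (rule eq_matI)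
  fix i j assume "i < dim_row (mat_sum m n (\<lambda>x. mat_adjoint (f x)) S)" "j < dim_col (mat_sum m n (\<lambda>x. mat_adjoint (f x)) S)"
  then have ij: "i < m" "j < n" by auto
  have "mat_adjoint (f x) $$ (i, j) = cnj (f x $$ (j, i))" if "x \<in> S" for x
    using assms[OF that] ij by simp
  then show "mat_adjoint (mat_sum n m f S) $$ (i, j) = mat_sum m n (\<lambda>x. mat_adjoint (f x)) S $$ (i, j)"
    using ij by simp
qed auto

lemma mat_sum_mult_mat_sum:
  assumes S: "finite S" and T: "finite T"
    and f: "\<And>x. x \<in> S \<Longrightarrow> f x \<in> carrier_mat n k" and Z: "Z \<in> carrier_mat k l"
    and g: "\<And>x. x \<in> T \<Longrightarrow> g x \<in> carrier_mat l m"
  shows "mat_sum n k f S * Z * mat_sum l m g T = mat_sum n m (\<lambda>(x, y). f x * Z * g y) (S \<times> T)"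
proof -
  have "mat_sum n k f S * Z * mat_sum l m g T = mat_sum n k f S * (Z * mat_sum l m g T)"
    using Z by (intro mult_assoc_mat) auto
  also have "\<dots> = mat_sum n m (\<lambda>x. f x * (Z * mat_sum l m g T)) S"
    using S f Z by (subst mat_sum_mult) auto
  also have "\<dots> = mat_sum n m (\<lambda>x. mat_sum n m (\<lambda>y. f x * Z * g y) T) S"
  proof (rule mat_sum_cong)
    fix x assume x: "x \<in> S"
    have "f x * (Z * mat_sum l m g T) = f x * Z * mat_sum l m g T * 1\<^sub>m m"
      using f[OF x] Z by (simp add: mult_assoc_mat)
    also have "\<dots> = mat_sum n m (\<lambda>y. f x * Z * g y * 1\<^sub>m m) T"
      using f[OF x] Z T g by (subst mult_mat_sum) auto
    also have "\<dots> = mat_sum n m (\<lambda>y. f x * Z * g y) T"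
    proof (rule mat_sum_cong)
      fix y assume "y \<in> T"
      from g[OF this] show "f x * Z * g y * 1\<^sub>m m = f x * Z * g y" by simp
    qed
    finally show "f x * (Z * mat_sum l m g T) = mat_sum n m (\<lambda>y. f x * Z * g y) T" .
  qed
  also have "\<dots> = mat_sum n m (\<lambda>(x, y). f x * Z * g y) (S \<times> T)"
    by (rule eq_matI) (auto simp: sum.cartesian_product case_prod_unfold)
  finally show ?thesis .
qed

section \<open>Frobenius norm estimates\<close>

lemma sqrt_frob2: "sqrt (frob2 M) = L2_set (\<lambda>p. cmod (M $$ p)) ({..<dim_row M} \<times> {..<dim_col M})"
  by (simp add: frob2_def L2_set_def sum.cartesian_product)

lemma sqrt_frob2_add:
  assumes "A \<in> carrier_mat n m" "B \<in> carrier_mat n m"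
  shows "sqrt (frob2 (A + B)) \<le> sqrt (frob2 A) + sqrt (frob2 B)"
proof -
  let ?I = "{..<n} \<times> {..<m}"
  have "sqrt (frob2 (A + B)) = L2_set (\<lambda>p. cmod ((A + B) $$ p)) ?I"
    using assms by (simp add: sqrt_frob2)
  also have "\<dots> \<le> L2_set (\<lambda>p. cmod (A $$ p) + cmod (B $$ p)) ?I"
    using assms by (intro L2_set_mono) (auto intro: norm_triangle_ineq)
  also have "\<dots> \<le> L2_set (\<lambda>p. cmod (A $$ p)) ?I + L2_set (\<lambda>p. cmod (B $$ p)) ?I"
    by (rule L2_set_triangle_ineq)
  finally show ?thesis using assms by (simp add: sqrt_frob2)
qed

lemma sqrt_frob2_mat_sum:
  assumes "finite S" "\<And>x. x \<in> S \<Longrightarrow> f x \<in> carrier_mat n m"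
  shows "sqrt (frob2 (mat_sum n m f S)) \<le> (\<Sum>x\<in>S. sqrt (frob2 (f x)))"
  using assms
proof (induction S)
  case empty
  then show ?case by (simp add: frob2_def)
next
  case (insert x S)
  then have "mat_sum n m f (insert x S) = f x + mat_sum n m f S" by (intro mat_sum_insert) auto
  then show ?case
    using insert sqrt_frob2_add[of "f x" n m "mat_sum n m f S"] by fastforce
qed

lemma frob2_kron: "frob2 (kron A B) = frob2 A * frob2 B"
proof -
  have "complex_of_real (frob2 (kron A B)) = mat_trace (kron (A * mat_adjoint A) (B * mat_adjoint B))"
    by (simp add: trace_gram[symmetric] adjoint_kron kron_mult)
  also have "\<dots> = complex_of_real (frob2 A * frob2 B)"
    by (simp add: trace_kron trace_gram)
  finally show ?thesis by (simp only: of_real_eq_iff)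
qed

lemma frob2_isometry:
  assumes "dim_col U = dim_row X" "mat_adjoint U * U = 1\<^sub>m (dim_row X)"
  shows "frob2 (U * X) = frob2 X"
proof -
  have "mat_adjoint (U * X) * (U * X) = mat_adjoint X * ((mat_adjoint U * U) * X)"
    using assms(1) by (simp add: adjoint_mult mult_assoc_mat)
  also have "\<dots> = mat_adjoint X * X" using assms by simp
  finally have "complex_of_real (frob2 (mat_adjoint (U * X))) = complex_of_real (frob2 (mat_adjoint X))"
    using trace_gram[of "mat_adjoint (U * X)"] trace_gram[of "mat_adjoint X"] by simp
  then show ?thesis by (simp add: frob2_adjoint)
qed

text \<open>The basis vector |i> as a one-column matrix, so that |i><j| and <i| \<otimes> 1 become
  matrix expressions.\<close>

definition ucol :: "nat \<Rightarrow> nat \<Rightarrow> complex mat" where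
  "ucol D i = mat D 1 (\<lambda>(k, l). if k = i then 1 else 0)"

lemma dim_ucol [simp]: "dim_row (ucol D i) = D" "dim_col (ucol D i) = Suc 0"
  by (auto simp: ucol_def)

lemma ucol_orthonormal: "i < D \<Longrightarrow> mat_adjoint (ucol D i) * ucol D j = (if i = j then 1\<^sub>m 1 else 0\<^sub>m 1 1)"
  by (intro eq_matI) (auto simp: index_mult_mat_sum ucol_def if_distrib[of cnj] if_distrib[of "\<lambda>x. x * _"]
     simp del: index_mult_mat(1) cong: if_cong)

lemma ucol_outer: "ucol D i * mat_adjoint (ucol D j) = mat D D (\<lambda>(k, l). if k = i \<and> l = j then 1 else 0)"
  by (rule eq_matI) (auto simp: index_mult_mat_sum ucol_def simp del: index_mult_mat(1))

lemma ucol_complete: "mat_sum D D (\<lambda>i. ucol D i * mat_adjoint (ucol D i)) {..<D} = 1\<^sub>m D"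
proof (rule eq_matI)
  fix k l assume "k < dim_row (1\<^sub>m D :: complex mat)" "l < dim_col (1\<^sub>m D :: complex mat)"
  then have kl: "k < D" "l < D" by auto
  have "(ucol D i * mat_adjoint (ucol D i)) $$ (k, l) = (if k = i then if k = l then 1 else 0 else 0)" for i
    unfolding ucol_outer using kl by auto
  then show "mat_sum D D (\<lambda>i. ucol D i * mat_adjoint (ucol D i)) {..<D} $$ (k, l) = 1\<^sub>m D $$ (k, l)"
    using kl by simp
qed auto

text \<open>The operators <i| \<otimes> 1 form a complete measurement, so this Parseval identity is
  trace preservation applied to M M^dagger.\<close>

lemma frob2_block_rows:
  assumes M: "M \<in> carrier_mat (D * a) x"
  shows "(\<Sum>i<D. frob2 (kron (mat_adjoint (ucol D i)) (1\<^sub>m a) * M)) = frob2 M"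
proof -
  let ?R = "\<lambda>i. kron (mat_adjoint (ucol D i)) (1\<^sub>m a)"
  have R: "local_op [D, a] 0 (mat_adjoint (ucol D i)) = ?R i" for i by (simp add: local_op_def)
  have "mat_sum (prod_list [D, a]) (prod_list [D, a]) (\<lambda>i. mat_adjoint (?R i) * ?R i) {..<D} = 1\<^sub>m (prod_list [D, a])"
    unfolding R[symmetric] by (rule local_op_complete) (auto simp: ucol_complete)
  then have c: "mat_sum (D * a) (D * a) (\<lambda>i. mat_adjoint (?R i) * ?R i) {..<D} = 1\<^sub>m (D * a)" by simp
  have ch: "channel (D * a) a (\<lambda>X. mat_sum a a (\<lambda>i. (\<lambda>X. X) (?R i * X * mat_adjoint (?R i))) {..<D})"
    by (rule channel_round[of _ _ "\<lambda>i. a", OF _ c]) (auto simp: channel_def intro!: carrier_matI)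
  have "mat_trace (mat_sum a a (\<lambda>i. ?R i * (M * mat_adjoint M) * mat_adjoint (?R i)) {..<D}) = mat_trace (M * mat_adjoint M)"
  proof (rule channelD(2)[OF ch])
    show "M * mat_adjoint M \<in> carrier_mat (D * a) (D * a)" using M by (intro carrier_matI) auto
  qed
  moreover have "mat_trace (mat_sum a a (\<lambda>i. ?R i * (M * mat_adjoint M) * mat_adjoint (?R i)) {..<D}) =
     (\<Sum>i<D. mat_trace (?R i * (M * mat_adjoint M) * mat_adjoint (?R i)))"
    using M by (intro trace_mat_sum) (auto intro!: carrier_matI)
  moreover have "mat_trace (?R i * (M * mat_adjoint M) * mat_adjoint (?R i)) = complex_of_real (frob2 (?R i * M))" for i
    unfolding trace_gram[symmetric] using M by (simp add: adjoint_mult mult_assoc_mat)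
  ultimately have "complex_of_real (\<Sum>i<D. frob2 (?R i * M)) = complex_of_real (frob2 M)"
    by (simp add: trace_gram)
  then show ?thesis by (simp only: of_real_eq_iff)
qed

text \<open>The isometry |ii> \<otimes> 1 from the shield into key and shield, with the tensor
  factors in the order of the cut AA' : BB'.\<close>

definition shield_emb :: "nat \<Rightarrow> nat \<Rightarrow> nat \<Rightarrow> nat \<Rightarrow> complex mat" where
  "shield_emb D a b i = kron (kron (ucol D i) (1\<^sub>m a)) (kron (ucol D i) (1\<^sub>m b))"

lemma dim_shield_emb [simp]: "dim_row (shield_emb D a b i) = (D * a) * (D * b)" "dim_col (shield_emb D a b i) = a * b"
  by (auto simp: shield_emb_def)

lemma shield_emb_orthonormal:
  "i < D \<Longrightarrow> mat_adjoint (shield_emb D a b i) * shield_emb D a b j = (if i = j then 1\<^sub>m (a * b) else 0\<^sub>m (a * b) (a * b))"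
  by (simp add: shield_emb_def adjoint_kron kron_mult ucol_orthonormal kron_one)

lemma ketbra_diag_kron:
  assumes "i < D" "j < D"
  shows "ketbra_diag D i j = kron (ucol D i * mat_adjoint (ucol D j)) (ucol D i * mat_adjoint (ucol D j))"
proof (rule eq_matI)
  fix k l assume "k < dim_row (kron (ucol D i * mat_adjoint (ucol D j)) (ucol D i * mat_adjoint (ucol D j)))"
   "l < dim_col (kron (ucol D i * mat_adjoint (ucol D j)) (ucol D i * mat_adjoint (ucol D j)))"
  then have kl: "k < D * D" "l < D * D" by auto
  note b = div_less_fst[OF kl(1)] mod_less_snd[OF kl(1)] div_less_fst[OF kl(2)] mod_less_snd[OF kl(2)]
  have e: "(n = p * D + p) \<longleftrightarrow> n div D = p \<and> n mod D = p" if "p < D" for n p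
    using that by (metis block_div div_mult_mod_eq)
  have "kron (ucol D i * mat_adjoint (ucol D j)) (ucol D i * mat_adjoint (ucol D j)) $$ (k, l) =
     (if k div D = i \<and> l div D = j then 1 else 0) * (if k mod D = i \<and> l mod D = j then 1 else 0)"
    unfolding ucol_outer using kl b by (subst index_kron) auto
  then show "ketbra_diag D i j $$ (k, l) =
    kron (ucol D i * mat_adjoint (ucol D j)) (ucol D i * mat_adjoint (ucol D j)) $$ (k, l)"
    using kl assms by (auto simp: ketbra_diag_def e)
qed (auto simp: ketbra_diag_def)

lemma kron_col_mult: "dim_col u = Suc 0 \<Longrightarrow> dim_row A = a \<Longrightarrow> kron u (1\<^sub>m a) * A = kron u A"
  using kron_mult[of u "1\<^sub>m (Suc 0)" "1\<^sub>m a" A] by simp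

text \<open>This turns each summand of a private state into a sandwich, so that the whole sum
  factors as V \<sigma> V^dagger. Both sides are additive in Z, so products suffice.\<close>

lemma bkron_ketbra_diag:
  assumes ij: "i < D" "j < D" and "Z \<in> carrier_mat (a * b) (a * b)"
  shows "bkron D D a b (ketbra_diag D i j) Z = shield_emb D a b i * Z * mat_adjoint (shield_emb D a b j)"
proof -
  \<comment> \<open>A trivial third factor of dimension 1 makes the three-factor induction usable
    for two factors.\<close>
  have "Z \<in> carrier_mat (a * (b * 1)) (a * (b * 1))" using assms(3) by simp
  then show ?thesis
  proof (induction rule: kron3_induct)
    case zero
    then show ?case by simp
  next
    case (add X Y)
    then show ?case by (simp add: bkron_add_right mult_add_mat add_mult_mat)
  next
    case (kron A C B)
    let ?E = "ucol D i * mat_adjoint (ucol D j)"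
    define B' where "B' = kron C B"
    have B': "B' \<in> carrier_mat b b" using kron by (auto simp: B'_def)
    have "bkron D D a b (ketbra_diag D i j) (kron A B') = kron (kron ?E A) (kron ?E B')"
      unfolding ketbra_diag_kron[OF ij] using kron B' by (intro bkron_kron) (auto intro!: carrier_matI)
    also have "\<dots> = shield_emb D a b i * kron A B' * mat_adjoint (shield_emb D a b j)"
      using kron B' by (simp add: shield_emb_def adjoint_kron kron_mult kron_col_mult)
    finally show ?case by (simp add: B'_def)
  qed
qed

text \<open>\<open>V\<close> is the twisted maximally entangled state; \<open>V V\<^sup>*\<close> is the test that accepts \<open>\<gamma>\<close>
  with certainty but a separable state only with probability \<open>2 ^ (-m)\<close>.\<close>

lemma private_state_test:
  assumes "private_state m a b \<gamma>"
  obtains V \<sigma> where "V \<in> carrier_mat ((2^m * a) * (2^m * b)) (a * b)" "mat_adjoint V * V = 1\<^sub>m (a * b)"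
    "state (a * b) \<sigma>" "\<gamma> = V * \<sigma> * mat_adjoint V"
    "\<And>W. sep_cone (2^m * a) (2^m * b) W \<Longrightarrow> Re (mat_trace (mat_adjoint V * W * V)) \<le> Re (mat_trace W) / 2^m"
proof -
  define D :: nat where "D = 2^m"
  let ?N = "(D * a) * (D * b)"
  have D0: "D > 0" by (simp add: D_def)
  have Dr: "real D = 2^m" by (simp add: D_def)
  obtain \<sigma> U where \<sigma>: "state (a * b) \<sigma>" and U: "\<And>i. i < D \<Longrightarrow> unitary_op (a * b) (U i)"
    and \<gamma>: "\<gamma> = complex_of_real (1 / real D) \<cdot>\<^sub>m mat_sum ?N ?N
                (\<lambda>(i, j). bkron D D a b (ketbra_diag D i j) (U i * \<sigma> * mat_adjoint (U j))) ({..<D} \<times> {..<D})"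
    using assms unfolding private_state_def D_def[symmetric] Dr[symmetric] by auto
  have Uc: "U i \<in> carrier_mat (a * b) (a * b)" "mat_adjoint (U i) * U i = 1\<^sub>m (a * b)" "U i * mat_adjoint (U i) = 1\<^sub>m (a * b)"
    if "i < D" for i using U[OF that] by (auto simp: unitary_op_def)
  have Ud: "dim_row (U i) = a * b" "dim_col (U i) = a * b" if "i < D" for i
    using Uc[OF that] by auto
  have \<sigma>c: "\<sigma> \<in> carrier_mat (a * b) (a * b)" using \<sigma> by (auto simp: state_def)
  \<comment> \<open>The branch |ii> \<otimes> U i of the twisted state; V is D^(-1/2) times the sum
    of the branches.\<close>
  define f where "f i = shield_emb D a b i * U i" for i
  have fc: "f i \<in> carrier_mat ?N (a * b)" if "i < D" for i
    using Uc[OF that] by (auto simp: f_def intro!: carrier_matI)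
  define c where "c = complex_of_real (1 / sqrt (real D))"
  have cc: "cnj c = c" "c * c = complex_of_real (1 / real D)" "(cmod c)\<^sup>2 = 1 / real D"
    by (auto simp: c_def norm_divide power_divide simp flip: of_real_mult)
  define S where "S = mat_sum ?N (a * b) f {..<D}"
  define V where "V = c \<cdot>\<^sub>m S"
  have Sc: "S \<in> carrier_mat ?N (a * b)" by (simp add: S_def)
  have Vc: "V \<in> carrier_mat ?N (a * b)" using Sc by (simp add: V_def)
  have Sadj: "mat_adjoint S = mat_sum (a * b) ?N (\<lambda>i. mat_adjoint (f i)) {..<D}"
    unfolding S_def using fc by (intro adjoint_mat_sum) auto
  have fcadj: "mat_adjoint (f i) \<in> carrier_mat (a * b) ?N" if "i < D" for i
    using fc[OF that] by (intro carrier_matI) auto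
  have iso: "mat_adjoint V * V = 1\<^sub>m (a * b)"
  proof -
    have ff: "mat_adjoint (f i) * 1\<^sub>m ?N * f j = (if i = j then 1\<^sub>m (a * b) else 0\<^sub>m (a * b) (a * b))" if "i < D" "j < D" for i j
    proof -
      have "mat_adjoint (f i) * 1\<^sub>m ?N * f j = mat_adjoint (U i) * ((mat_adjoint (shield_emb D a b i) * shield_emb D a b j) * U j)"
        using Uc[OF that(1)] Uc[OF that(2)] by (simp add: f_def adjoint_mult mult_assoc_mat)
      then show ?thesis using Uc[OF that(1)] Uc[OF that(2)] that by (simp add: shield_emb_orthonormal)
    qed
    have "mat_adjoint S * S = mat_adjoint S * 1\<^sub>m ?N * S" using Sc by simp
    also have "\<dots> = mat_sum (a * b) (a * b) (\<lambda>(i, j). mat_adjoint (f i) * 1\<^sub>m ?N * f j) ({..<D} \<times> {..<D})"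
      unfolding Sadj unfolding S_def using fc fcadj by (intro mat_sum_mult_mat_sum) auto
    also have "\<dots> = mat_sum (a * b) (a * b) (\<lambda>(i, j). if i = j then 1\<^sub>m (a * b) else 0\<^sub>m (a * b) (a * b)) ({..<D} \<times> {..<D})"
      using ff by (intro mat_sum_cong) auto
    also have "\<dots> = complex_of_real (real D) \<cdot>\<^sub>m 1\<^sub>m (a * b)"
    proof (rule eq_matI)
      fix k l assume "k < dim_row (complex_of_real (real D) \<cdot>\<^sub>m 1\<^sub>m (a * b))" "l < dim_col (complex_of_real (real D) \<cdot>\<^sub>m 1\<^sub>m (a * b))"
      then have kl: "k < a * b" "l < a * b" by auto
      have "(if i = j then 1\<^sub>m (a * b) else 0\<^sub>m (a * b) (a * b)) $$ (k, l) = (if i = j then if k = l then 1 else 0 else (0::complex))" for i j :: nat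
        using kl by auto
      then show "mat_sum (a * b) (a * b) (\<lambda>(i, j). if i = j then 1\<^sub>m (a * b) else 0\<^sub>m (a * b) (a * b)) ({..<D} \<times> {..<D}) $$ (k, l)
         = (complex_of_real (real D) \<cdot>\<^sub>m 1\<^sub>m (a * b)) $$ (k, l)"
        using kl sum.cartesian_product[of "\<lambda>i j. if i = j then 1 else (0::complex)" "{..<D}" "{..<D}"]
        by (simp add: case_prod_unfold)
    qed auto
    finally have SS: "mat_adjoint S * S = complex_of_real (real D) \<cdot>\<^sub>m 1\<^sub>m (a * b)" .
    have "c * (c * complex_of_real (real D)) = 1" using cc(2) D0 by (simp flip: mult.assoc)
    then show ?thesis unfolding V_def using Sc cc(1)
      by (simp add: adjoint_smult smult_mult_mat smult_smult_mat SS, intro eq_matI) auto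
  qed
  have "V * \<sigma> * mat_adjoint V = complex_of_real (1 / real D) \<cdot>\<^sub>m (S * \<sigma> * mat_adjoint S)"
    unfolding V_def using Sc \<sigma>c cc by (simp add: adjoint_smult smult_mult_mat smult_smult_mat)
  also have "S * \<sigma> * mat_adjoint S = mat_sum ?N ?N (\<lambda>(i, j). f i * \<sigma> * mat_adjoint (f j)) ({..<D} \<times> {..<D})"
    unfolding Sadj unfolding S_def using fc fcadj \<sigma>c by (intro mat_sum_mult_mat_sum) auto
  also have "\<dots> = mat_sum ?N ?N (\<lambda>(i, j). bkron D D a b (ketbra_diag D i j) (U i * \<sigma> * mat_adjoint (U j))) ({..<D} \<times> {..<D})"
  proof (rule mat_sum_cong, clarsimp)
    fix i j assume ij: "i < D" "j < D"
    have "U i * \<sigma> * mat_adjoint (U j) \<in> carrier_mat (a * b) (a * b)"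
      using Uc[OF ij(1)] Uc[OF ij(2)] by (intro carrier_matI) auto
    then show "f i * \<sigma> * mat_adjoint (f j) = bkron D D a b (ketbra_diag D i j) (U i * \<sigma> * mat_adjoint (U j))"
      using Uc[OF ij(1)] Uc[OF ij(2)] \<sigma>c ij by (simp add: bkron_ketbra_diag f_def adjoint_mult mult_assoc_mat)
  qed
  finally have \<gamma>V: "\<gamma> = V * \<sigma> * mat_adjoint V" using \<gamma> by simp
  \<comment> \<open>For P = M M^dagger and Q = N N^dagger the accepted weight is the squared
    Frobenius norm of S^dagger (M \<otimes> N), divided by D. Its i-th summand is the adjoint of U i
    applied to <i|M \<otimes> <i|N, whose norm is a product of block-row norms. The triangle and
    Cauchy-Schwarz inequalities leave at most the product of the norms of M and N, and 1/D survives
    from the normalisation of V.\<close>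
  have prod_bound: "Re (mat_trace (mat_adjoint V * kron P Q * V)) \<le> Re (mat_trace (kron P Q)) / real D"
    if PQ: "psd P" "psd Q" "P \<in> carrier_mat (D * a) (D * a)" "Q \<in> carrier_mat (D * b) (D * b)" for P Q
  proof -
    obtain M x where M: "M \<in> carrier_mat (D * a) x" "P = M * mat_adjoint M" using psd_factor[OF PQ(1,3)] .
    obtain N y where N: "N \<in> carrier_mat (D * b) y" "Q = N * mat_adjoint N" using psd_factor[OF PQ(2,4)] .
    let ?M = "\<lambda>i. kron (mat_adjoint (ucol D i)) (1\<^sub>m a) * M" and ?N' = "\<lambda>i. kron (mat_adjoint (ucol D i)) (1\<^sub>m b) * N"
    define G where "G = mat_adjoint S * kron M N"
    have "mat_adjoint V * kron P Q * V = (c * c) \<cdot>\<^sub>m (G * mat_adjoint G)"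
      unfolding V_def G_def M(2) N(2) using M(1) N(1) Sc cc(1)
      by (simp add: adjoint_smult smult_mult_mat smult_smult_mat adjoint_mult adjoint_kron mult_assoc_mat flip: kron_mult)
    then have tr: "Re (mat_trace (mat_adjoint V * kron P Q * V)) = frob2 G / real D"
      using Sc by (simp add: trace_smult trace_gram cc(2) G_def)
    have "G = mat_sum (a * b) (x * y) (\<lambda>i. mat_adjoint (f i) * kron M N) {..<D}"
      unfolding G_def Sadj using M N fcadj by (subst mat_sum_mult) auto
    also have "\<dots> = mat_sum (a * b) (x * y) (\<lambda>i. mat_adjoint (U i) * kron (?M i) (?N' i)) {..<D}"
    proof (rule mat_sum_cong)
      fix i assume "i \<in> {..<D}"
      then show "mat_adjoint (f i) * kron M N = mat_adjoint (U i) * kron (?M i) (?N' i)"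
        using Uc[of i] M N by (simp add: f_def adjoint_mult mult_assoc_mat shield_emb_def adjoint_kron kron_mult)
    qed
    finally have "sqrt (frob2 G) \<le> (\<Sum>i<D. sqrt (frob2 (mat_adjoint (U i) * kron (?M i) (?N' i))))"
      using M(1) N(1) Ud by (auto intro!: sqrt_frob2_mat_sum carrier_matI)
    also have "\<dots> = (\<Sum>i<D. sqrt (frob2 (?M i)) * sqrt (frob2 (?N' i)))"
    proof (intro sum.cong refl)
      fix i assume "i \<in> {..<D}"
      \<comment> \<open>The twisting unitaries drop out of each norm, so the bound is that for the
        plain maximally entangled state.\<close>
      then have "frob2 (mat_adjoint (U i) * kron (?M i) (?N' i)) = frob2 (kron (?M i) (?N' i))"
        using Uc[of i] by (intro frob2_isometry) auto
      then show "sqrt (frob2 (mat_adjoint (U i) * kron (?M i) (?N' i))) = sqrt (frob2 (?M i)) * sqrt (frob2 (?N' i))"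
        by (simp add: frob2_kron real_sqrt_mult)
    qed
    also have "\<dots> \<le> L2_set (\<lambda>i. sqrt (frob2 (?M i))) {..<D} * L2_set (\<lambda>i. sqrt (frob2 (?N' i))) {..<D}"
      using L2_set_mult_ineq[of "\<lambda>i. sqrt (frob2 (?M i))" "\<lambda>i. sqrt (frob2 (?N' i))" "{..<D}"]
      by (simp add: frob2_nonneg)
    also have "\<dots> = sqrt (frob2 M) * sqrt (frob2 N)"
      by (simp add: L2_set_def frob2_nonneg frob2_block_rows[OF M(1)] frob2_block_rows[OF N(1)])
    finally have "frob2 G \<le> frob2 M * frob2 N"
      by (simp flip: real_sqrt_mult)
    moreover have "mat_trace (kron P Q) = complex_of_real (frob2 M * frob2 N)"
      unfolding M(2) N(2) by (simp add: trace_kron trace_gram)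
    ultimately show ?thesis unfolding tr using D0 by (simp add: divide_right_mono)
  qed
  have "Re (mat_trace (mat_adjoint V * W * V)) \<le> Re (mat_trace W) / real D" if "sep_cone (D * a) (D * b) W" for W
    using that
  proof (induction rule: sep_cone.induct)
    case sep_cone_zero
    then show ?case using Vc by simp
  next
    case (sep_cone_step P Q X)
    note X = sep_cone_carrier[OF sep_cone_step(5)]
    have "mat_adjoint V * (kron P Q + X) * V = mat_adjoint V * kron P Q * V + mat_adjoint V * X * V"
      using sep_cone_step(3,4) X Vc by (simp add: mult_add_mat add_mult_mat)
    moreover have "mat_trace \<dots> = mat_trace (mat_adjoint V * kron P Q * V) + mat_trace (mat_adjoint V * X * V)"
      using Vc by (intro trace_add) auto
    moreover have "mat_trace (kron P Q + X) = mat_trace (kron P Q) + mat_trace X"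
      using sep_cone_step(3,4) X by (intro trace_add) auto
    ultimately show ?case
      using prod_bound[OF sep_cone_step(1-4)] sep_cone_step(6) by (simp add: add_divide_distrib)
  qed
  then show thesis using that Vc iso \<sigma> \<gamma>V unfolding D_def by auto
qed

section \<open>Key of operators dominated by separable ones\<close>

text \<open>\<open>sep_dom s a b X c\<close>: up to positive terms, \<open>X\<close> is a sum of operators \<open>P \<le> Q\<close> with \<open>Q\<close> separable, and \<open>c\<close>
  is the sum of the interpolated weights \<open>(tr P) ^ (1 - s) * (tr Q) ^ s\<close>. A test that passes separable
  operators with weight at most \<open>2 ^ (-m)\<close> passes \<open>X\<close> with weight at most \<open>c * 2 ^ (-m s)\<close>.
  Unlike a single bound \<open>X \<le> Q\<close>, this behaves well under tensor powers.\<close>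

inductive sep_dom :: "real \<Rightarrow> nat \<Rightarrow> nat \<Rightarrow> complex mat \<Rightarrow> real \<Rightarrow> bool" for s a b where
  sep_dom_base: "psd P \<Longrightarrow> P \<in> carrier_mat (a * b) (a * b) \<Longrightarrow> sep_cone a b Q \<Longrightarrow> psd (Q - P) \<Longrightarrow>
    sep_dom s a b P (Re (mat_trace P) powr (1 - s) * Re (mat_trace Q) powr s)"
| sep_dom_add: "sep_dom s a b X c \<Longrightarrow> sep_dom s a b Y c' \<Longrightarrow> sep_dom s a b (X + Y) (c + c')"
| sep_dom_mono: "sep_dom s a b X c \<Longrightarrow> psd Y \<Longrightarrow> Y \<in> carrier_mat (a * b) (a * b) \<Longrightarrow> psd (X - Y) \<Longrightarrow> sep_dom s a b Y c"

lemma sep_dom_psd: "sep_dom s a b X c \<Longrightarrow> psd X \<and> X \<in> carrier_mat (a * b) (a * b)"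
  by (induction rule: sep_dom.induct) (auto intro!: psd_add)

lemma psd_trace_Re: "psd A \<Longrightarrow> 0 \<le> Re (mat_trace A)"
  using psd_trace[of A] by (simp add: less_eq_complex_def)

lemma psd_trace_of_real: "psd A \<Longrightarrow> mat_trace A = complex_of_real (Re (mat_trace A))"
  using psd_trace[of A] by (simp add: less_eq_complex_def complex_eq_iff)

text \<open>Q \<otimes> Q' - P \<otimes> P' = (Q - P) \<otimes> Q' + P \<otimes> (Q' - P') has
  positive summands, and traces multiply, so the interpolated weights multiply too. One operator
  stays a base term here; \<open>sep_dom_bkron\<close> inducts over it.\<close>

lemma sep_dom_bkron_base:
  assumes P: "psd P" "P \<in> carrier_mat (a1 * b1) (a1 * b1)" and Q: "sep_cone a1 b1 Q" "psd (Q - P)"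
    and Y: "sep_dom s a2 b2 Y c'"
  shows "sep_dom s (a1 * a2) (b1 * b2) (bkron a1 b1 a2 b2 P Y)
    (Re (mat_trace P) powr (1 - s) * Re (mat_trace Q) powr s * c')"
  using Y
proof (induction rule: sep_dom.induct)
  case (sep_dom_base P' Q')
  let ?k = "bkron a1 b1 a2 b2"
  note Qc = sep_cone_carrier[OF Q(1)] and Q'c = sep_cone_carrier[OF sep_dom_base(3)]
  note psds = sep_cone_psd[OF Q(1)] sep_cone_psd[OF sep_dom_base(3)]
  have tr: "Re (mat_trace (?k A B)) = Re (mat_trace A) * Re (mat_trace B)"
    if "psd A" "psd B" "A \<in> carrier_mat (a1 * b1) (a1 * b1)" "B \<in> carrier_mat (a2 * b2) (a2 * b2)" for A B
    using trace_bkron[OF that(3,4)] psd_trace_of_real[OF that(1)] psd_trace_of_real[OF that(2)]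
    by (metis Re_complex_of_real of_real_mult)
  have "?k Q Q' - ?k P P' = ?k (Q - P) Q' + ?k P (Q' - P')"
    using P(2) Qc Q'c sep_dom_base(2) by (simp add: bkron_add bkron_add_right, intro eq_matI) auto
  moreover have "psd (?k (Q - P) Q')" "psd (?k P (Q' - P'))"
    using P Q Qc Q'c sep_dom_base psds by (auto intro!: psd_bkron minus_carrier_mat)
  ultimately have "psd (?k Q Q' - ?k P P')" by (auto intro!: psd_add)
  then have "sep_dom s (a1 * a2) (b1 * b2) (?k P P') (Re (mat_trace (?k P P')) powr (1 - s) * Re (mat_trace (?k Q Q')) powr s)"
    using P Q sep_dom_base by (intro sep_dom.sep_dom_base psd_bkron sep_cone_bkron) auto
  moreover have "Re (mat_trace (?k P P')) powr (1 - s) * Re (mat_trace (?k Q Q')) powr s =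
     Re (mat_trace P) powr (1 - s) * Re (mat_trace Q) powr s * (Re (mat_trace P') powr (1 - s) * Re (mat_trace Q') powr s)"
    using tr[OF P(1) sep_dom_base(1) P(2) sep_dom_base(2)] tr[OF psds Qc Q'c] psd_trace_Re P(1) sep_dom_base(1) psds
    by (simp add: powr_mult)
  ultimately show ?case by simp
next
  case (sep_dom_add X c Y c')
  have "bkron a1 b1 a2 b2 P (X + Y) = bkron a1 b1 a2 b2 P X + bkron a1 b1 a2 b2 P Y"
    using sep_dom_psd[OF sep_dom_add(1)] sep_dom_psd[OF sep_dom_add(2)] by (intro bkron_add_right) auto
  then show ?case using sep_dom.sep_dom_add[OF sep_dom_add(3,4)] by (simp add: distrib_left)
next
  case (sep_dom_mono X c Y)
  have X: "X \<in> carrier_mat (a2 * b2) (a2 * b2)" using sep_dom_psd[OF sep_dom_mono(1)] by simp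
  show ?case
  proof (rule sep_dom.sep_dom_mono[OF sep_dom_mono(5)])
    have "psd (bkron a1 b1 a2 b2 P (X - Y))"
      using P sep_dom_mono by (intro psd_bkron minus_carrier_mat) auto
    then show "psd (bkron a1 b1 a2 b2 P X - bkron a1 b1 a2 b2 P Y)"
      using bkron_add_right(2)[OF X sep_dom_mono(3)] by simp
  qed (use P sep_dom_mono in \<open>auto intro!: psd_bkron\<close>)
qed

lemma sep_dom_bkron:
  assumes "sep_dom s a1 b1 X c" "sep_dom s a2 b2 Y c'"
  shows "sep_dom s (a1 * a2) (b1 * b2) (bkron a1 b1 a2 b2 X Y) (c * c')"
  using assms(1)
proof (induction rule: sep_dom.induct)
  case (sep_dom_base P Q)
  then show ?case using sep_dom_bkron_base assms(2) by blast
next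
  case (sep_dom_add X c Z c2)
  have "bkron a1 b1 a2 b2 (X + Z) Y = bkron a1 b1 a2 b2 X Y + bkron a1 b1 a2 b2 Z Y"
    using sep_dom_psd[OF sep_dom_add(1)] sep_dom_psd[OF sep_dom_add(2)] by (intro bkron_add) auto
  then show ?case using sep_dom.sep_dom_add[OF sep_dom_add(3,4)] by (simp add: distrib_right)
next
  case (sep_dom_mono X c Z)
  have X: "X \<in> carrier_mat (a1 * b1) (a1 * b1)" using sep_dom_psd[OF sep_dom_mono(1)] by simp
  note Y = sep_dom_psd[OF assms(2)]
  show ?case
  proof (rule sep_dom.sep_dom_mono[OF sep_dom_mono(5)])
    have "psd (bkron a1 b1 a2 b2 (X - Z) Y)"
      using Y sep_dom_mono by (intro psd_bkron minus_carrier_mat) auto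
    then show "psd (bkron a1 b1 a2 b2 X Y - bkron a1 b1 a2 b2 Z Y)"
      using bkron_add(2)[OF X sep_dom_mono(3)] by simp
  qed (use Y sep_dom_mono in \<open>auto intro!: psd_bkron\<close>)
qed

text \<open>Multiplicativity of the weights does the work of the binomial expansion: c ^ n accounts
  for all mixed terms.\<close>

lemma sep_dom_bpower:
  assumes "sep_dom s a b X c"
  shows "sep_dom s (a ^ n) (b ^ n) (bpower a b X n) (c ^ n)"
proof (induction n)
  case 0
  have "sep_cone 1 1 (kron (1\<^sub>m 1) (1\<^sub>m 1))" by (rule sep_cone_kron) auto
  then have "sep_dom s 1 1 (1\<^sub>m 1) (Re (mat_trace (1\<^sub>m 1)) powr (1 - s) * Re (mat_trace (1\<^sub>m 1)) powr s)"
    by (intro sep_dom_base) (auto simp: minus_r_inv_mat[of _ 1 1])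
  then show ?case by simp
next
  case (Suc n)
  then show ?case using sep_dom_bkron[OF assms Suc] by simp
qed

text \<open>On a base term the accepted weight t obeys t \<le> tr P, as V is an isometry, and t
  \<le> q tr Q, as F keeps Q separable. Splitting t into t^(1-s) and t^s applies one bound to each
  part. The other rules are harmless because acceptance is additive and monotone.\<close>

lemma sep_dom_test:
  assumes "sep_dom s a b X c" and s: "0 \<le> s" "s \<le> 1"
    and F: "channel (a * b) (a' * b') F" "\<And>Q. sep_cone a b Q \<Longrightarrow> sep_cone a' b' (F Q)"
    and V: "V \<in> carrier_mat (a' * b') k" "mat_adjoint V * V = 1\<^sub>m k"
    and q: "0 \<le> q" "\<And>W. sep_cone a' b' W \<Longrightarrow> Re (mat_trace (mat_adjoint V * W * V)) \<le> Re (mat_trace W) * q"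
  shows "Re (mat_trace (mat_adjoint V * F X * V)) \<le> c * q powr s"
proof -
  define f where "f X = Re (mat_trace (mat_adjoint V * F X * V))" for X
  have f_add: "f (X + Y) = f X + f Y" if "X \<in> carrier_mat (a * b) (a * b)" "Y \<in> carrier_mat (a * b) (a * b)" for X Y
  proof -
    have "mat_adjoint V * F (X + Y) * V = mat_adjoint V * F X * V + mat_adjoint V * F Y * V"
      using channelD(4)[OF F(1) that] channelD(1)[OF F(1) that(1)] channelD(1)[OF F(1) that(2)] V
      by (simp add: mult_add_mat add_mult_mat)
    moreover have "mat_trace \<dots> = mat_trace (mat_adjoint V * F X * V) + mat_trace (mat_adjoint V * F Y * V)"
      using V by (intro trace_add) auto
    ultimately show ?thesis by (simp add: f_def)
  qed
  have f_nonneg: "0 \<le> f X" if "psd X" "X \<in> carrier_mat (a * b) (a * b)" for X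
    using psd_conj[OF channelD(3)[OF F(1) that(2,1)], of "mat_adjoint V"] channelD(1)[OF F(1) that(2)] V
    by (auto simp: f_def intro!: psd_trace_Re)
  have f_mono: "f Y \<le> f X" if "psd (X - Y)" "X \<in> carrier_mat (a * b) (a * b)" "Y \<in> carrier_mat (a * b) (a * b)" for X Y
  proof -
    have "X - Y + Y = X" using that by (intro eq_matI) auto
    then show ?thesis
      using f_add[of "X - Y" Y] f_nonneg[OF that(1)] that(2,3) by (simp add: minus_carrier_mat)
  qed
  have "f X \<le> c * q powr s"
    using assms(1)
  proof (induction rule: sep_dom.induct)
    case (sep_dom_base P Q)
    note Qc = sep_cone_carrier[OF sep_dom_base(3)]
    have 1: "f P \<le> Re (mat_trace P)"
      using isometry_trace_le[OF V channelD(1)[OF F(1) sep_dom_base(2)] channelD(3)[OF F(1) sep_dom_base(2,1)]]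
        channelD(2)[OF F(1) sep_dom_base(2)]
      by (simp add: f_def less_eq_complex_def)
    have "f P \<le> f Q" by (rule f_mono[OF sep_dom_base(4) Qc sep_dom_base(2)])
    also have "\<dots> \<le> Re (mat_trace Q) * q"
      using q(2)[OF F(2)[OF sep_dom_base(3)]] channelD(2)[OF F(1) Qc] by (simp add: f_def)
    finally have 2: "f P \<le> Re (mat_trace Q) * q" .
    have 0: "0 \<le> f P" by (rule f_nonneg[OF sep_dom_base(1,2)])
    \<comment> \<open>At weight 0 both sides are 0, since 0 powr any exponent is 0.\<close>
    have "f P = f P powr (1 - s) * f P powr s"
      using 0 by (cases "f P = 0") (simp_all flip: powr_add)
    also have "\<dots> \<le> Re (mat_trace P) powr (1 - s) * (Re (mat_trace Q) * q) powr s"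
      using 0 1 2 s by (intro mult_mono powr_mono2) auto
    also have "\<dots> = Re (mat_trace P) powr (1 - s) * Re (mat_trace Q) powr s * q powr s"
      using q psd_trace_Re[OF sep_cone_psd[OF sep_dom_base(3)]] by (simp add: powr_mult)
    finally show ?case .
  next
    case (sep_dom_add X c Y c')
    then show ?case using sep_dom_psd[OF sep_dom_add(1)] sep_dom_psd[OF sep_dom_add(2)] by (simp add: f_add distrib_right)
  next
    case (sep_dom_mono X c Y)
    then show ?case using sep_dom_psd[OF sep_dom_mono(1)] f_mono[of X Y] by force
  qed
  then show ?thesis by (simp add: f_def)
qed

section \<open>From the test to the distillable key\<close>

text \<open>X \<ge> -|X|, and the test accepts at most the trace of |X|.\<close>

lemma trace_norm_test:
  assumes X: "X \<in> carrier_mat n n" "mat_adjoint X = X" and V: "V \<in> carrier_mat n k" "mat_adjoint V * V = 1\<^sub>m k"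
  shows "- trace_norm X \<le> Re (mat_trace (mat_adjoint V * X * V))"
proof -
  obtain A where A: "A \<in> carrier_mat n n" "psd A" "psd (A + X)" "mat_trace A = complex_of_real (trace_norm X)"
    using trace_norm_hermitian[OF X] by metis
  have "0 \<le> Re (mat_trace (mat_adjoint V * (A + X) * V))"
    using psd_conj[OF A(3), of "mat_adjoint V"] X V by (auto intro!: psd_trace_Re)
  also have "mat_adjoint V * (A + X) * V = mat_adjoint V * A * V + mat_adjoint V * X * V"
    using A X V by (simp add: mult_add_mat add_mult_mat)
  also have "mat_trace \<dots> = mat_trace (mat_adjoint V * A * V) + mat_trace (mat_adjoint V * X * V)"
    using V by (intro trace_add) auto
  finally have "0 \<le> Re (mat_trace (mat_adjoint V * A * V)) + Re (mat_trace (mat_adjoint V * X * V))" by simp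
  moreover have "Re (mat_trace (mat_adjoint V * A * V)) \<le> trace_norm X"
    using isometry_trace_le[OF V A(1,2)] A(4) by (simp add: less_eq_complex_def)
  ultimately show ?thesis by linarith
qed

text \<open>The private state passes its own test with certainty, as V^dagger \<gamma> V = \<sigma>
  has trace 1, so the protocol's output passes with weight at least 1 - \<epsilon>. The domination
  bounds the same weight from above.\<close>

lemma sep_dom_key_bound:
  assumes sep_dom: "sep_dom s a b X c" and s: "0 < s" "s \<le> 1"
    and \<Lambda>: "locc [a ^ n, b ^ n] [2^m * a', 2^m * b'] \<Lambda>" and \<gamma>: "private_state m a' b' \<gamma>"
    and tn: "trace_norm (\<Lambda> (bpower a b X n) - \<gamma>) \<le> \<epsilon>"
  shows "1 - \<epsilon> \<le> c ^ n * (1 / 2 ^ m) powr s"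
proof -
  let ?N = "(2^m * a') * (2^m * b')"
  obtain V \<sigma> where V: "V \<in> carrier_mat ?N (a' * b')" "mat_adjoint V * V = 1\<^sub>m (a' * b')"
    and \<sigma>: "state (a' * b') \<sigma>" and \<gamma>V: "\<gamma> = V * \<sigma> * mat_adjoint V"
    and sep: "\<And>W. sep_cone (2^m * a') (2^m * b') W \<Longrightarrow> Re (mat_trace (mat_adjoint V * W * V)) \<le> Re (mat_trace W) / 2^m"
    using private_state_test[OF \<gamma>] by blast
  have ch: "channel (a ^ n * b ^ n) ?N \<Lambda>" using locc_channel[OF \<Lambda>] by simp
  have sp: "sep_cone (2^m * a') (2^m * b') (\<Lambda> Q)" if "sep_cone (a ^ n) (b ^ n) Q" for Q
    using locc_sepc[OF \<Lambda>, of Q] that by simp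
  note dn = sep_dom_bpower[OF sep_dom, of n]
  have Xn: "psd (bpower a b X n)" "bpower a b X n \<in> carrier_mat (a ^ n * b ^ n) (a ^ n * b ^ n)"
    using sep_dom_psd[OF dn] by auto
  let ?Y = "\<Lambda> (bpower a b X n)"
  have Y: "?Y \<in> carrier_mat ?N ?N" "psd ?Y" using channelD[OF ch Xn(2)] Xn(1) by auto
  have \<sigma>': "\<sigma> \<in> carrier_mat (a' * b') (a' * b')" "psd \<sigma>" "mat_trace \<sigma> = 1" using \<sigma> by (auto simp: state_def)
  have \<gamma>c: "\<gamma> \<in> carrier_mat ?N ?N" "psd \<gamma>"
    unfolding \<gamma>V using V \<sigma>' by (auto intro!: psd_conj carrier_matI)
  have "mat_adjoint (?Y - \<gamma>) = ?Y - \<gamma>" "?Y - \<gamma> \<in> carrier_mat ?N ?N"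
    using Y \<gamma>c by (auto simp: adjoint_add psd_adjoint intro!: minus_carrier_mat)
  then have "- \<epsilon> \<le> Re (mat_trace (mat_adjoint V * (?Y - \<gamma>) * V))"
    using trace_norm_test[OF _ _ V] tn by fastforce
  also have "mat_adjoint V * (?Y - \<gamma>) * V = mat_adjoint V * ?Y * V - mat_adjoint V * \<gamma> * V"
    using Y \<gamma>c V by (simp add: mult_minus_mat minus_mult_mat)
  also have "mat_adjoint V * \<gamma> * V = (mat_adjoint V * V) * (\<sigma> * (mat_adjoint V * V))"
    unfolding \<gamma>V using V(1) \<sigma>' by (simp add: mult_assoc_mat)
  also have "\<dots> = \<sigma>" unfolding V(2) using \<sigma>' by simp
  also have "mat_trace (mat_adjoint V * ?Y * V - \<sigma>) = mat_trace (mat_adjoint V * ?Y * V) - 1"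
    using V \<sigma>' by (simp add: trace_add)
  finally have "1 - \<epsilon> \<le> Re (mat_trace (mat_adjoint V * ?Y * V))" by simp
  also have "\<dots> \<le> c ^ n * (1 / 2 ^ m) powr s"
    using dn s ch sp V sep by (intro sep_dom_test[where F = \<Lambda>]) auto
  finally show ?thesis .
qed

text \<open>The infimum over \<epsilon> is at most its value at 1/2. There the logarithm of the key
  bound costs one additive bit in s m, which disappears on division by n.\<close>

lemma distillable_key_le:
  assumes sep_dom: "sep_dom s a b X c" and s: "0 < s" "s \<le> 1" and c: "0 < c"
  shows "distillable_key a b X \<le> ereal (log 2 c / s)"
proof -
  define R where "R \<epsilon> n = {ereal (real m / real n) | m a' b' \<gamma> \<Lambda>.
        locc [a ^ n, b ^ n] [2^m * a', 2^m * b'] \<Lambda> \<and> private_state m a' b' \<gamma> \<and>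
        trace_norm (\<Lambda> (bpower a b X n) - \<gamma>) \<le> \<epsilon>}" for \<epsilon> :: real and n
  \<comment> \<open>Rates are quotients by n, so n = 0 is set aside; the limit superior ignores
    it.\<close>
  have bound: "Sup (R (1/2) n) \<le> ereal (log 2 c / s + 1 / s / real n)" if n: "n > 0" for n
  proof (rule Sup_least)
    fix x assume "x \<in> R (1/2) n"
    then obtain m a' b' \<gamma> \<Lambda> where x: "x = ereal (real m / real n)"
      and *: "locc [a ^ n, b ^ n] [2^m * a', 2^m * b'] \<Lambda>" "private_state m a' b' \<gamma>"
        "trace_norm (\<Lambda> (bpower a b X n) - \<gamma>) \<le> 1/2"
      unfolding R_def by blast
    have "1/2 \<le> c ^ n * (1 / 2 ^ m) powr s"
      using sep_dom_key_bound[OF sep_dom s *] by simp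
    then have "log 2 (1/2) \<le> log 2 (c ^ n * (1 / 2 ^ m) powr s)"
      using c by (intro log_mono) auto
    also have "\<dots> = real n * log 2 c - s * real m"
      using c by (simp add: log_mult log_nat_power log_powr log_divide)
    finally have "s * real m \<le> real n * log 2 c + 1" by (simp add: log_divide)
    then have "real m / real n \<le> log 2 c / s + 1 / s / real n"
      using n s by (simp add: field_simps)
    then show "x \<le> ereal (log 2 c / s + 1 / s / real n)" by (simp add: x)
  qed
  have "distillable_key a b X \<le> limsup (\<lambda>n. Sup (R (1/2) n))"
    unfolding distillable_key_def R_def by (rule INF_lower) simp
  also have "\<dots> \<le> limsup (\<lambda>n. ereal (log 2 c / s + 1 / s / real n))"
    using bound by (intro Limsup_mono) (auto simp: eventually_sequentially intro!: exI[of _ 1])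
  also have "\<dots> = ereal (log 2 c / s)"
  proof (rule lim_imp_Limsup)
    have "(\<lambda>n. log 2 c / s + 1 / s / real n) \<longlonglongrightarrow> log 2 c / s + 0"
      by (intro tendsto_add tendsto_const lim_const_over_n)
    then show "(\<lambda>n. ereal (log 2 c / s + 1 / s / real n)) \<longlonglongrightarrow> ereal (log 2 c / s)" by simp
  qed simp
  finally show ?thesis .
qed

section \<open>Comparison of the inputs and the final estimate\<close>

text \<open>From -A \<le> H \<le> A and -B \<le> K \<le> B follows H \<otimes> K \<le> A \<otimes>
  B: the difference is half of (A - H) \<otimes> (B + K) + (A + H) \<otimes> (B - K).\<close>

lemma psd_kron_diff:
  assumes "A \<in> carrier_mat n n" "H \<in> carrier_mat n n" "B \<in> carrier_mat m m" "K \<in> carrier_mat m m"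
    and "psd (A + H)" "psd (A - H)" "psd (B + K)" "psd (B - K)"
  shows "psd (kron A B - kron H K)"
proof -
  have "psd (complex_of_real (1/2) \<cdot>\<^sub>m (kron (A - H) (B + K) + kron (A + H) (B - K)))"
    using assms(1-4) by (intro psd_smult psd_add[OF psd_kron[OF assms(6,7)] psd_kron[OF assms(5,8)]]) auto
  also have "complex_of_real (1/2) \<cdot>\<^sub>m (kron (A - H) (B + K) + kron (A + H) (B - K)) = kron A B - kron H K"
    using assms(1-4) by (simp add: kron_add, intro eq_matI) (auto simp: algebra_simps)
  finally show ?thesis .
qed

text \<open>Bookkeeping for a telescoping: P and V are the two products to be compared, W is the
  hybrid with one factor exchanged.\<close>

lemma mat_diff_split:
  fixes P Q U V W :: "complex mat"
  assumes "P \<in> carrier_mat n m" "Q \<in> carrier_mat n m" "U \<in> carrier_mat n m" "V \<in> carrier_mat n m" "W \<in> carrier_mat n m"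
  shows "P + (Q + U) - V = (Q - (V - W)) + (U - (W - P))"
  using assms by (intro eq_matI) auto

text \<open>Telescope R \<otimes> R' - T \<otimes> T' = (R - T) \<otimes> R' + T \<otimes> (R' -
  T'). The first summand is at most |R - T| \<otimes> |R'|, of trace at most \<epsilon> times the
  trace norm of R'; the second is at most T \<otimes> |R' - T'|, of trace at most \<epsilon>. The
  other hybrid R \<otimes> T' brings in the trace norm of R instead, and the better choice gives the
  minimum.\<close>

lemma product_difference_dominated:
  assumes R: "R \<in> carrier_mat n n" "mat_adjoint R = R" and T: "T \<in> carrier_mat n n" "psd T" "mat_trace T = 1"
    and R': "R' \<in> carrier_mat n n" "mat_adjoint R' = R'" and T': "T' \<in> carrier_mat n n" "psd T'" "mat_trace T' = 1"
    and e: "trace_norm (R - T) \<le> \<epsilon>" "trace_norm (R' - T') \<le> \<epsilon>"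
  obtains Y where "Y \<in> carrier_mat (n * n) (n * n)" "psd Y" "psd (kron T T' + Y - kron R R')"
    "Re (mat_trace Y) \<le> \<epsilon> * (min (trace_norm R) (trace_norm R') + 1)"
proof -
  have hm: "mat_adjoint (R - T) = R - T" "mat_adjoint (R' - T') = R' - T'" "R - T \<in> carrier_mat n n" "R' - T' \<in> carrier_mat n n"
    using R T R' T' by (auto simp: adjoint_add psd_adjoint intro!: minus_carrier_mat)
  obtain A where A: "A \<in> carrier_mat n n" "psd A" "psd (A + (R - T))" "psd (A - (R - T))" "mat_trace A = complex_of_real (trace_norm (R - T))"
    by (rule trace_norm_hermitian[OF hm(3,1)])
  obtain A' where A': "A' \<in> carrier_mat n n" "psd A'" "psd (A' + (R' - T'))" "psd (A' - (R' - T'))" "mat_trace A' = complex_of_real (trace_norm (R' - T'))"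
    by (rule trace_norm_hermitian[OF hm(4,2)])
  obtain B where B: "B \<in> carrier_mat n n" "psd B" "psd (B + R)" "psd (B - R)" "mat_trace B = complex_of_real (trace_norm R)"
    by (rule trace_norm_hermitian[OF R])
  obtain B' where B': "B' \<in> carrier_mat n n" "psd B'" "psd (B' + R')" "psd (B' - R')" "mat_trace B' = complex_of_real (trace_norm R')"
    by (rule trace_norm_hermitian[OF R'])
  have nn: "0 \<le> trace_norm R" "0 \<le> trace_norm R'"
    using psd_trace[OF B(2)] psd_trace[OF B'(2)] B(5) B'(5) by (auto simp: less_eq_complex_def)
  show thesis
  proof (cases "trace_norm R' \<le> trace_norm R")
    case True
    let ?Y = "kron A B' + kron T A'"
    have "kron T T' + ?Y - kron R R' = (kron A B' - kron (R - T) R') + kron T (A' - (R' - T'))"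
    proof -
      have e: "kron (R - T) R' = kron R R' - kron T R'"
        "kron T (A' - (R' - T')) = kron T A' - (kron T R' - kron T T')"
        using A'(1) R(1) R'(1) T(1) T'(1) by (simp_all add: kron_add)
      show ?thesis
        unfolding e
        by (rule mat_diff_split[of _ "n * n" "n * n"]; rule kron_carrier; fact)
    qed
    moreover have "psd \<dots>"
      using A(1) A'(1) B'(1) R(1) R'(1) T(1) T'(1)
      by (intro psd_add[OF psd_kron_diff[OF A(1) hm(3) B'(1) R'(1) A(3,4) B'(3,4)] psd_kron[OF T(2) A'(4)]]) simp
    moreover have "Re (mat_trace ?Y) = trace_norm (R - T) * trace_norm R' + trace_norm (R' - T')"
      using A A' B' T by (simp add: trace_add trace_kron)
    moreover have "\<dots> \<le> \<epsilon> * trace_norm R' + \<epsilon>" using e nn by (intro add_mono mult_right_mono) auto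
    moreover have "psd ?Y" "?Y \<in> carrier_mat (n * n) (n * n)"
      using A A' B' T by (auto intro!: psd_add psd_kron)
    ultimately show thesis using True by (intro that[of ?Y]) (auto simp: distrib_left min_def)
  next
    case False
    let ?Y = "kron B A' + kron A T'"
    have "kron T T' + ?Y - kron R R' = (kron B A' - kron R (R' - T')) + kron (A - (R - T)) T'"
    proof -
      have e: "kron R (R' - T') = kron R R' - kron R T'"
        "kron (A - (R - T)) T' = kron A T' - (kron R T' - kron T T')"
        using A(1) R(1) R'(1) T(1) T'(1) by (simp_all add: kron_add)
      show ?thesis
        unfolding e
        by (rule mat_diff_split[of _ "n * n" "n * n"]; rule kron_carrier; fact)
    qed
    moreover have "psd \<dots>"
      using A(1) A'(1) B(1) R(1) R'(1) T(1) T'(1)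
      by (intro psd_add[OF psd_kron_diff[OF B(1) R(1) A'(1) hm(4) B(3,4) A'(3,4)] psd_kron[OF A(4) T'(2)]]) simp
    moreover have "Re (mat_trace ?Y) = trace_norm R * trace_norm (R' - T') + trace_norm (R - T)"
      using A A' B T' by (simp add: trace_add trace_kron)
    moreover have "\<dots> \<le> trace_norm R * \<epsilon> + \<epsilon>" using e nn by (intro add_mono mult_left_mono) auto
    moreover have "psd ?Y" "?Y \<in> carrier_mat (n * n) (n * n)"
      using A A' B T' by (auto intro!: psd_add psd_kron)
    ultimately show thesis using False by (intro that[of ?Y]) (auto simp: distrib_left min_def mult.commute)
  qed
qed

text \<open>The partial transpose is moved from the input onto Charlie's operations; after that, the output
  is dominated by the outputs of \<open>S\<close> and \<open>Y\<close>, and the pinching of \<open>Y\<close> shows that the latter is at most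
  \<open>d\<close> times a separable operator, whatever the output dimensions are.\<close>

lemma repeater_output_dom:
  assumes \<Lambda>: "locc [d, d * d, d] [a, c, b] \<Lambda>"
    and X: "X \<in> carrier_mat (d * (d * d * d)) (d * (d * d * d))" "psd X"
    and S: "sep_cone d (d * d * d) S" "mat_trace S = 1"
    and Y: "Y \<in> carrier_mat (d * (d * d * d)) (d * (d * d * d))" "psd Y"
    and le: "psd (S + Y - ptranspose_mid d (d * d) d X)"
  shows "sep_dom s a b (ptrace_mid a c b (\<Lambda> X))
    (1 + Re (mat_trace Y) powr (1 - s) * (real d * Re (mat_trace Y)) powr s)"
proof -
  let ?n = "d * (d * d * d)"
  let ?Z = "ptranspose_mid d (d * d) d X"
  obtain \<Lambda>' where \<Lambda>': "locc [d, d * d, d] [a, c, b] \<Lambda>'" "\<Lambda>' ?Z = ptranspose_mid a c b (\<Lambda> X)"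
    using locc_ptranspose_mid[OF \<Lambda> refl refl] X(1) by (metis mult.assoc)
  define F where "F X = ptrace_mid a c b (\<Lambda>' X)" for X
  have F: "channel ?n (a * b) F"
    unfolding F_def using channel_comp[OF locc_channel[OF \<Lambda>'(1)], of "a * b" "ptrace_mid a c b"] channel_ptrace_mid
    by (simp add: mult.assoc)
  have Fsep: "sep_cone a b (F Q)" if "sep_cone d (d * d * d) Q" for Q
    unfolding F_def using locc_sepc[OF \<Lambda>'(1), of Q] that by (intro sep_cone_ptrace_mid) (simp add: mult.assoc)
  have FZ: "F ?Z = ptrace_mid a c b (\<Lambda> X)" by (simp add: F_def \<Lambda>'(2) ptrace_mid_ptranspose_mid)
  have Zc: "?Z \<in> carrier_mat ?n ?n" using ptranspose_mid_carrier[of d "d * d" d X] by (simp add: mult.assoc)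
  \<comment> \<open>\<open>?Z\<close> need not be positive, so positivity of its image is taken from
    the original protocol acting on X.\<close>
  have out: "psd (F ?Z)" "F ?Z \<in> carrier_mat (a * b) (a * b)"
  proof -
    have "channel ?n (a * b) (\<lambda>X. ptrace_mid a c b (\<Lambda> X))"
      using channel_comp[OF locc_channel[OF \<Lambda>], of "a * b" "ptrace_mid a c b"] channel_ptrace_mid
      by (simp add: mult.assoc)
    from channelD[OF this X(1)] X(2) show "psd (F ?Z)" "F ?Z \<in> carrier_mat (a * b) (a * b)"
      unfolding FZ by auto
  qed
  note Sc = sep_cone_carrier[OF S(1)]
  obtain E where E: "sep_cone d (d * d * d) E" "mat_trace E = mat_trace Y" "psd (complex_of_real (real d) \<cdot>\<^sub>m E - Y)"
    by (rule pinching[OF Y(2,1)])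
  define E' where "E' = complex_of_real (real d) \<cdot>\<^sub>m E"
  have E': "sep_cone d (d * d * d) E'" unfolding E'_def using E(1) by (rule sep_cone_smult) simp
  note Ec = sep_cone_carrier[OF E(1)] and Ec' = sep_cone_carrier[OF E']
  have trE': "mat_trace E' = complex_of_real (real d) * mat_trace Y"
    unfolding E'_def using Ec E(2) by (simp add: trace_smult)
  have FS: "F S \<in> carrier_mat (a * b) (a * b)" "mat_trace (F S) = 1" using channelD[OF F Sc] S by auto
  \<comment> \<open>F S is separable and dominates itself; having trace 1, it has weight 1 for every
    s.\<close>
  have "sep_dom s a b (F S) (Re (mat_trace (F S)) powr (1 - s) * Re (mat_trace (F S)) powr s)"
    using FS Fsep[OF S(1)] by (intro sep_dom_base) (auto intro: sep_cone_psd simp: minus_r_inv_mat)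
  then have dS: "sep_dom s a b (F S) 1" by (simp add: FS)
  have "psd (F (E' - Y))"
    using channelD(3)[OF F minus_carrier_mat[OF Y(1)] E(3)] by (simp add: E'_def)
  then have "sep_dom s a b (F Y) (Re (mat_trace (F Y)) powr (1 - s) * Re (mat_trace (F E')) powr s)"
    using channelD[OF F Y(1)] Y(2) Fsep[OF E'] channel_diff[OF F Ec' Y(1)] by (intro sep_dom_base) auto
  then have "sep_dom s a b (F Y) (Re (mat_trace Y) powr (1 - s) * (real d * Re (mat_trace Y)) powr s)"
    using channelD(2)[OF F Y(1)] channelD(2)[OF F Ec'] trE' by simp
  note dSY = sep_dom_add[OF dS this]
  have "S + Y \<in> carrier_mat ?n ?n" using Sc Y by auto
  then have "psd (F (S + Y) - F ?Z)"
    using channelD(3)[OF F minus_carrier_mat[OF Zc] le] channel_diff[OF F _ Zc] by simp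
  then have "psd (F S + F Y - F ?Z)" using channelD(4)[OF F Sc Y(1)] by simp
  then show ?thesis using sep_dom_mono[OF dSY out] FZ by simp
qed

theorem theorem2:
  fixes d :: nat and \<rho> \<rho>t \<sigma> \<sigma>t :: "complex mat" and \<epsilon> \<mu> \<epsilon>' :: real
  assumes "state (d * d) \<rho>" and "state (d * d) \<rho>t"
    and "separable_state d d \<sigma>" and "separable_state d d \<sigma>t"
    and "trace_norm (ptranspose_snd d d \<rho> - ptranspose_snd d d \<sigma>) \<le> \<epsilon>"
    and "trace_norm (ptranspose_fst d d \<rho>t - ptranspose_fst d d \<sigma>t) \<le> \<epsilon>"
    and "\<mu> = min (trace_norm (ptranspose_snd d d \<rho>)) (trace_norm (ptranspose_fst d d \<rho>t))"
    and "\<epsilon>' = \<epsilon> * (\<mu> + 1)"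
    and "\<epsilon>' \<le> 1 / 3"
  shows "single_copy_repeater_rate d \<rho> \<rho>t \<le> ereal (4 * (1 + log 2 (real d)) * \<epsilon>' + 2 * \<eta> \<epsilon>')"
proof -
  have st: "\<rho> \<in> carrier_mat (d * d) (d * d)" "psd \<rho>" "mat_trace \<rho> = 1"
    "\<rho>t \<in> carrier_mat (d * d) (d * d)" "psd \<rho>t"
    using assms(1,2) by (auto simp: state_def)
  \<comment> \<open>Trace 1 excludes dimension 0, so log d is nonnegative.\<close>
  have "d \<noteq> 0" using st(1,3) by (intro notI) (simp add: mat_trace_def)
  then have d: "1 \<le> real d" by simp
  note sep = separable_state_ptranspose[OF assms(3)] and sept = separable_state_ptranspose[OF assms(4)]
  let ?S = "kron (ptranspose_snd d d \<sigma>) (ptranspose_fst d d \<sigma>t)"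
  obtain Y where Y: "Y \<in> carrier_mat (d * d * (d * d)) (d * d * (d * d))" "psd Y"
    and le: "psd (?S + Y - kron (ptranspose_snd d d \<rho>) (ptranspose_fst d d \<rho>t))"
    and tr: "Re (mat_trace Y) \<le> \<epsilon>'"
    unfolding assms(8,7)
    by (rule product_difference_dominated[of "ptranspose_snd d d \<rho>" "d * d" "ptranspose_snd d d \<sigma>"
        "ptranspose_fst d d \<rho>t" "ptranspose_fst d d \<sigma>t" \<epsilon>])
      (use assms(5,6) st sep sept sep_cone_psd in \<open>auto simp: adjoint_ptranspose psd_adjoint\<close>)
  define \<delta> where "\<delta> = Re (mat_trace Y)"
  have \<delta>: "0 \<le> \<delta>" "\<delta> \<le> \<epsilon>'" using psd_trace_Re[OF Y(2)] tr by (auto simp: \<delta>_def)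
  have S: "sep_cone d (d * d * d) ?S" "mat_trace ?S = 1"
    using sep_cone_kron_right[OF sep(1) sep_cone_psd[OF sept(2)], of "d * d"] sep(3) sept(4)
    by (auto simp: trace_kron mult.assoc)
  define s where "s = 1 / (1 + log 2 (real d))"
  have ld: "0 \<le> log 2 (real d)" using d by simp
  have s: "0 < s" "s \<le> 1" using ld by (auto simp: s_def)
  have ds: "real d powr s \<le> 2"
  proof -
    \<comment> \<open>The exponent becomes log d / (1 + log d) \<le> 1; the added 1 keeps s defined
      and at most 1 also for d = 1.\<close>
    have "real d powr s = 2 powr (log 2 (real d) * s)" using d by (simp flip: powr_powr)
    also have "\<dots> \<le> 2 powr 1" using ld by (intro powr_mono) (auto simp: s_def field_simps)
    finally show ?thesis by simp
  qed
  define c where "c = 1 + \<delta> powr (1 - s) * (real d * \<delta>) powr s"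
  have c: "1 \<le> c" "c \<le> 1 + 2 * \<epsilon>'"
  proof -
    have "\<delta> powr (1 - s) * (real d * \<delta>) powr s = real d powr s * \<delta>"
      using \<delta>(1) by (cases "\<delta> = 0") (simp_all add: powr_mult mult.left_commute flip: powr_add)
    also have "\<dots> \<le> 2 * \<epsilon>'" using ds \<delta> by (intro mult_mono) auto
    finally show "c \<le> 1 + 2 * \<epsilon>'" by (simp add: c_def)
  qed (simp add: c_def)
  have rate: "distillable_key a b (ptrace_mid a e b (\<Lambda> (kron \<rho> \<rho>t))) \<le> ereal (log 2 c / s)"
    if \<Lambda>: "locc [d, d * d, d] [a, e, b] \<Lambda>" for a e b \<Lambda>
  proof -
    have "sep_dom s a b (ptrace_mid a e b (\<Lambda> (kron \<rho> \<rho>t))) c"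
      unfolding c_def \<delta>_def
    proof (rule repeater_output_dom[OF \<Lambda> _ _ S])
      show "kron \<rho> \<rho>t \<in> carrier_mat (d * (d * d * d)) (d * (d * d * d))"
        using kron_carrier[OF st(1,4)] by (simp add: mult.assoc)
      show "psd (kron \<rho> \<rho>t)" using st by (intro psd_kron)
      show "psd (?S + Y - ptranspose_mid d (d * d) d (kron \<rho> \<rho>t))"
        using le ptranspose_mid_kron_states[OF st(1,4)] by simp
    qed (use Y in \<open>simp_all add: mult.assoc\<close>)
    then show ?thesis using s c by (intro distillable_key_le) auto
  qed
  have "log 2 c \<le> log 2 (1 + 2 * \<epsilon>')" using c by simp
  also have "\<dots> \<le> 4 * \<epsilon>'"
  proof -
    \<comment> \<open>The constant 4 comes from 2 / ln 2 \<le> 4, that is, from ln 2 \<ge>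
      1/2.\<close>
    have "ln (1 + 2 * \<epsilon>') \<le> 2 * \<epsilon>'" using \<delta> by (intro ln_add_one_self_le_self) auto
    also have "\<dots> \<le> 4 * \<epsilon>' * ln 2"
      using \<delta> ln_le_minus_one[of "1/2"] mult_left_mono[of "1/2" "ln 2" "4 * \<epsilon>'"] by (simp add: ln_div)
    finally show ?thesis by (simp add: log_def divide_le_eq)
  qed
  finally have "log 2 c / s \<le> 4 * \<epsilon>' * (1 + log 2 (real d))"
    using s ld by (simp add: s_def mult_right_mono)
  \<comment> \<open>As 0 \<le> \<epsilon>' \<le> 1/3 < 1, the logarithm is negative unless
    \<epsilon>' = 0, where the product is 0.\<close>
  moreover have "0 \<le> \<eta> \<epsilon>'"
    using \<delta> assms(9) by (cases "\<epsilon>' = 0") (auto simp: \<eta>_def mult_le_0_iff)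
  ultimately have "ereal (log 2 c / s) \<le> ereal (4 * (1 + log 2 (real d)) * \<epsilon>' + 2 * \<eta> \<epsilon>')"
    by (simp add: mult_ac)
  moreover have "single_copy_repeater_rate d \<rho> \<rho>t \<le> ereal (log 2 c / s)"
    unfolding single_copy_repeater_rate_def using rate by (intro Sup_least) blast
  ultimately show ?thesis by (rule order_trans[rotated])
qed

end
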